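(* The various versions of grid homology for knots and links in lens spaces defined using true and false sign assignments over $\mathbb Z[U_1,\ldots,U_{2n+m}]$ coincide. That is, let $g$ be a grid diagram of a (possibly singular) link in $L(p,q)$ with $n$ thick edges and $m$ regular $S^1$ components, let $\mathcal S$ be a true sign assignment and $\mathcal S'$ a false sign assignment on $g$; then for each version $\circ\in\{-,\widehat{\ },\widetilde{\ }\}$ the homologies of the complexes $CFK^\circ(g;\mathcal S)$ and $CFK^\circ(g;\mathcal S')$ are isomorphic as relatively bigraded modules (over $\mathbb Z[U_1,\dots,U_{2n+m}]$ for $\circ=-$, and over $\mathbb Z$ for $\circ=\widehat{\ },\widetilde{\ }$).
   Context: $p,q$ are coprime integers with $-p<q<p$; $L(p,q)=S^3_{-p/q}(\text{unknot})=V_\beta\cup_{T^2}V_\alpha$ with its standard genus one Heegaard splitting. A (possibly) singular link in $L(p,q)$ is a piecewise linear embedding of an oriented graph with thick and thin edges in which each vertex has exactly one thick and two thin edges, with either the thick edge incoming and both thin edges outgoing or the thick edge outgoing and both thin edges incoming; oriented circles without vertices (regular $S^1$ components) are allowed. Grid diagrams. Let $N=n+k$. A grid diagram $g$ of size $N$ is drawn on $T^2=\mathbb{R}^2/\mathbb{Z}^2$ with circles $\alpha_i=\{y=i/N\}$ and $\beta_i$ = image of the line $\{x=\frac{i}{pN}-\frac{q}{p}y\}$, $0\le i\le N-1$. Rows (columns) are annuli between adjacent $\alpha$ ($\beta$) circles; cells are the components of the complement of all circles. There are $n$ marks $XX$, $k$ marks $X$ and $2n+k$ marks $O_1,\dots,O_{2n+k}$,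 at most one per cell, at cell centres, so that each row and each column contains either exactly one $O$ and one $X$, or exactly one $XX$ and two $O$'s. Write $\mathbb{O}$, $\mathbb{X}_r$, $\mathbb{XX}$ for the sets of $O$, $X$, $XX$ marks and $\mathbb{X}=\mathbb{X}_r\cup\mathbb{XX}$. The diagram represents the singular link obtained by joining, in each row, the $O$'s to the $X$ or $XX$ (oriented from $O$), and in each column the $X$ or $XX$ to the $O$'s (oriented to $O$), pushing horizontal arcs into $V_\alpha$ and slanted arcs into $V_\beta$; each $XX$ gives one 4-valent vertex, i.e. one thick edge. Marks are numbered so that $O_1,\dots,O_{2n+m}$ lie on distinct thin edges or regular $S^1$ components. Generators and rectangles. $\boldsymbol S$ is the set of $N$-tuples $\boldsymbol x$ of intersection points of $\alpha$ and $\beta$ circles with exactly one point on each circle. If $\boldsymbol x,\boldsymbol y$ differ in exactly two points, $\mathrm{Rect}(\boldsymbol x,\boldsymbol y)$ is the set of embedded rectangles $r$ in $T^2$ with boundary on $\alpha\cup\beta$, with corners the points where $\boldsymbol x,\boldsymbol y$ differ, and with (for the boundary orientation) $\partial r\cap\boldsymbol\alpha$ going from $\boldsymbol x$ to $\boldsymbol y$; $r$ is empty ($r\in\mathrm{Rect}^\circ(\boldsymbol x,\boldsymbol y)$) if its interior contains no point of $\boldsymbol x$ or $\boldsymbol y$. $n_P(r)$ is the number of points of $P$ in $r$. Sign assignments. A true sign assignment is a function $\mathcal S$ from the set of all rectangles of $g$ to $\{\pm1\}$ such that (1) if $r_1*r_2=r_1'*r_2'$ are two decompositions of the same domain from $\boldsymbol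 x$ to $\boldsymbol z$ through different intermediate generators, then $\mathcal S(r_1)\mathcal S(r_2)=-\mathcal S(r_1')\mathcal S(r_2')$; (2) if $r_1*r_2$ is a horizontal annulus, then $\mathcal S(r_1)\mathcal S(r_2)=1$; (3) if $r_1*r_2$ is a vertical annulus, then $\mathcal S(r_1)\mathcal S(r_2)=-1$. A false sign assignment satisfies (1), and (2),(3) with the values $1$ and $-1$ exchanged. Complexes. $CFK^-(g;\mathcal S)$ is the free $\mathbb Z[U_1,\dots,U_{2n+k}]$-module on $\boldsymbol S$ with $$\partial^-_{\mathcal S}\boldsymbol x=\sum_{\boldsymbol y}\ \sum_{r\in\mathrm{Rect}^\circ(\boldsymbol x,\boldsymbol y),\,n_{\mathbb X}(r)=0}\mathcal S(r)\prod_{i=1}^{2n+k}U_i^{n_{O_i}(r)}\,\boldsymbol y;$$ $\widehat{CFK}=CFK^-/(U_1=\dots=U_{2n+m}=0)$ and $\widetilde{CFK}=CFK^-/(U_1=\dots=U_{2n+k}=0)$. Gradings. For a finite set of points of $T^2$, take representatives in $\{0\le y<1,\ -\frac qp y\le x<-\frac qp y+1\}$; $W$ records their coordinates $(a,b)\in[0,pN)\times[0,N)$ in the basis $v_1=(\frac1{pN},0)$, $v_2=(-\frac q{pN},\frac1N)$. $C_{p,q}$ sends a set $\{(a_i,b_i)\}$ to $\{((a_i+Nql)\bmod pN,\ (b_i+Nl)\bmod pN)\}_{i;\,0\le l\le p-1}$, and $\widetilde W=C_{p,q}\circ W$. For finite sets $A,B$ of coordinate pairs, $\mathcal I(A,B)$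 is the number of $(a_1,a_2)\in A,(b_1,b_2)\in B$ with $a_1<b_1$, $a_2<b_2$; $\mathcal J(A,B)=\frac12(\mathcal I(A,B)+\mathcal I(B,A))$, extended bilinearly. For $\boldsymbol x,\boldsymbol y$ connected by a sequence of rectangles, $$M(\boldsymbol x,\boldsymbol y)=M_{\mathbb O}(\boldsymbol x,\boldsymbol y)=\tfrac1p\big(\mathcal J(\widetilde W(\boldsymbol x),\widetilde W(\boldsymbol x))-\mathcal J(\widetilde W(\boldsymbol y),\widetilde W(\boldsymbol y))-2\mathcal J(\widetilde W(\mathbb O-\mathbb{XX}),\widetilde W(\boldsymbol x-\boldsymbol y))\big),$$ $M_{\mathbb X}$ is the same expression with $\mathbb O-\mathbb{XX}$ replaced by $\mathbb X_r+\mathbb{XX}$, and $A=\frac12(M_{\mathbb O}-M_{\mathbb X})$. Multiplication by $U_i$ lowers $M$ by 2 and $A$ by 1. $(M,A)$ is the relative bigrading. *)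

theory Defs
  imports
    Complex_Main
    "HOL-Algebra.Coset"
    "HOL-Library.Poly_Mapping"
    "HOL-Library.Real_Mod"
begin

section \<open>The torus and its circles\<close>

text \<open>Points of the torus are the classes of the plane modulo the integer lattice; generators and
  rectangles are sets of such points.\<close>

type_synonym tpoint = "(real \<times> real) set"
type_synonym gen = "tpoint set"
type_synonym rect = "tpoint set"

definition tor :: "real \<times> real \<Rightarrow> tpoint" where
  "tor u = {v. fst v - fst u \<in> \<int> \<and> snd v - snd u \<in> \<int>}"

text \<open>The data of a grid diagram. Marks are points of the torus (the centres of their cells);
  the mark \<open>O\<^sub>i\<close> of the usual numbering from 1 is \<open>mO g (i - 1)\<close>. The field \<open>nXX\<close> is the number
  of \<open>XX\<close> marks, that is of thick edges, and \<open>nX\<close> the number of \<open>X\<close> marks.\<close>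

record grid =
  lp :: int
  lq :: int
  nXX :: nat
  nX :: nat
  mO :: "nat \<Rightarrow> tpoint"
  mX :: "tpoint set"
  mXX :: "tpoint set"

definition gsize :: "grid \<Rightarrow> nat" where
  "gsize g = nXX g + nX g"

definition numO :: "grid \<Rightarrow> nat" where
  "numO g = 2 * nXX g + nX g"

definition setO :: "grid \<Rightarrow> tpoint set" where
  "setO g = mO g ` {..<numO g}"

definition alpha :: "grid \<Rightarrow> nat \<Rightarrow> tpoint set" where
  "alpha g i = tor ` {(x, y). y = real i / real (gsize g)}"

definition beta :: "grid \<Rightarrow> nat \<Rightarrow> tpoint set" where
  "beta g i = tor ` {(x, y). x = real i / (lp g * gsize g) - lq g / lp g * y}"

definition alphas :: "grid \<Rightarrow> tpoint set" where
  "alphas g = (\<Union>i<gsize g. alpha g i)"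

definition betas :: "grid \<Rightarrow> tpoint set" where
  "betas g = (\<Union>i<gsize g. beta g i)"

definition off_circles :: "grid \<Rightarrow> tpoint set" where
  "off_circles g = range tor - (alphas g \<union> betas g)"

definition grow :: "grid \<Rightarrow> nat \<Rightarrow> tpoint set" where
  "grow g i = tor ` {(x, y). real i / real (gsize g) < y \<and> y < (real i + 1) / real (gsize g)}"

definition gcolumn :: "grid \<Rightarrow> nat \<Rightarrow> tpoint set" where
  "gcolumn g i = tor ` {(x, y). real i / (lp g * gsize g) - lq g / lp g * y < x \<and>
     x < (real i + 1) / (lp g * gsize g) - lq g / lp g * y}"

text \<open>\<open>gvec g (a, b)\<close> is \<open>a v\<^sub>1 + b v\<^sub>2\<close> with \<open>v\<^sub>1 = (1/(pN), 0)\<close>, \<open>v\<^sub>2 = (-q/(pN), 1/N)\<close>. In these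
  coordinates the \<open>\<alpha>\<close> and \<open>\<beta>\<close> circles are the lines with integral second and first coordinate,
  so the cells are the open unit squares.\<close>

definition gvec :: "grid \<Rightarrow> real \<times> real \<Rightarrow> real \<times> real" where
  "gvec g u = (fst u / (lp g * gsize g) - snd u * lq g / (lp g * gsize g), snd u / gsize g)"

definition cell_centres :: "grid \<Rightarrow> tpoint set" where
  "cell_centres g = {tor (gvec g (of_int a + 1/2, of_int b + 1/2)) | a b. True}"


section \<open>Grid diagrams\<close>

definition line_ok :: "grid \<Rightarrow> tpoint set \<Rightarrow> bool" where
  "line_ok g L \<longleftrightarrow>
     card (L \<inter> setO g) = 1 \<and> card (L \<inter> mX g) = 1 \<and> L \<inter> mXX g = {} \<or>
     card (L \<inter> setO g) = 2 \<and> L \<inter> mX g = {} \<and> card (L \<inter> mXX g) = 1"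

definition same_row :: "grid \<Rightarrow> tpoint \<Rightarrow> tpoint \<Rightarrow> bool" where
  "same_row g P Q \<longleftrightarrow> (\<exists>i<gsize g. P \<in> grow g i \<and> Q \<in> grow g i)"

definition same_column :: "grid \<Rightarrow> tpoint \<Rightarrow> tpoint \<Rightarrow> bool" where
  "same_column g P Q \<longleftrightarrow> (\<exists>i<gsize g. P \<in> gcolumn g i \<and> Q \<in> gcolumn g i)"

text \<open>The link runs from an \<open>O\<close> along its row to the \<open>X\<close> or \<open>XX\<close>, and from there along the column
  to the next \<open>O\<close>; it meets the vertices exactly at the \<open>XX\<close> marks. So the thin edges and the
  regular circles correspond to the classes of \<open>O\<close> marks generated by passing through \<open>X\<close> marks,
  and the regular circles are the classes that never reach an \<open>XX\<close>.\<close>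

definition strand_step :: "grid \<Rightarrow> (nat \<times> nat) set" where
  "strand_step g = {(i, j). i < numO g \<and> j < numO g \<and>
     (\<exists>P\<in>mX g. same_row g (mO g i) P \<and> same_column g P (mO g j))}"

definition strand :: "grid \<Rightarrow> nat \<Rightarrow> nat set" where
  "strand g i = {j. (i, j) \<in> (strand_step g \<union> (strand_step g)\<inverse>)\<^sup>*}"

definition regular_circles :: "grid \<Rightarrow> nat set set" where
  "regular_circles g = {strand g i | i. i < numO g \<and>
     (\<forall>j\<in>strand g i. \<forall>P\<in>mXX g. \<not> same_row g (mO g j) P \<and> \<not> same_column g P (mO g j))}"

definition num_circles :: "grid \<Rightarrow> nat" where
  "num_circles g = card (regular_circles g)"

definition grid_diagram :: "grid \<Rightarrow> bool" where
  "grid_diagram g \<longleftrightarrow>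
     coprime (lp g) (lq g) \<and> - lp g < lq g \<and> lq g < lp g \<and> gsize g > 0 \<and>
     finite (mX g) \<and> card (mX g) = nX g \<and> finite (mXX g) \<and> card (mXX g) = nXX g \<and>
     inj_on (mO g) {..<numO g} \<and>
     setO g \<inter> mX g = {} \<and> setO g \<inter> mXX g = {} \<and> mX g \<inter> mXX g = {} \<and>
     setO g \<union> mX g \<union> mXX g \<subseteq> cell_centres g \<and>
     (\<forall>i<gsize g. line_ok g (grow g i) \<and> line_ok g (gcolumn g i)) \<and>
     inj_on (strand g) {..<2 * nXX g + num_circles g}"


section \<open>Generators, rectangles, sign assignments\<close>

definition gens :: "grid \<Rightarrow> gen set" where
  "gens g = {x. x \<subseteq> alphas g \<inter> betas g \<and>
     (\<forall>i<gsize g. card (x \<inter> alpha g i) = 1 \<and> card (x \<inter> beta g i) = 1)}"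

text \<open>An embedded rectangle with sides on the circles lifts to a closed parallelogram
  \<open>{s v\<^sub>1 + t v\<^sub>2 | a \<le> s \<le> a + w, b \<le> t \<le> b + h}\<close> in the plane on which the projection to the
  torus is injective. With the boundary orientation the lower side runs to the right and the upper
  side to the left, so horizontal sides run from \<open>x\<close> to \<open>y\<close> when the lower left and upper right
  corners belong to \<open>x\<close> and the other two to \<open>y\<close>.\<close>

definition pgram :: "grid \<Rightarrow> real \<Rightarrow> real \<Rightarrow> real \<Rightarrow> real \<Rightarrow> (real \<times> real) set" where
  "pgram g a b w h = gvec g ` ({a..a + w} \<times> {b..b + h})"

definition open_pgram :: "grid \<Rightarrow> real \<Rightarrow> real \<Rightarrow> real \<Rightarrow> real \<Rightarrow> (real \<times> real) set" where
  "open_pgram g a b w h = gvec g ` ({a<..<a + w} \<times> {b<..<b + h})"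

definition is_rect ::
  "grid \<Rightarrow> gen \<Rightarrow> gen \<Rightarrow> real \<Rightarrow> real \<Rightarrow> real \<Rightarrow> real \<Rightarrow> bool" where
  "is_rect g x y a b w h \<longleftrightarrow>
     w > 0 \<and> h > 0 \<and> inj_on tor (pgram g a b w h) \<and>
     (tor \<circ> gvec g) ` ({a..a + w} \<times> {b, b + h}) \<subseteq> alphas g \<and>
     (tor \<circ> gvec g) ` ({a, a + w} \<times> {b..b + h}) \<subseteq> betas g \<and>
     x - y = {tor (gvec g (a, b)), tor (gvec g (a + w, b + h))} \<and>
     y - x = {tor (gvec g (a + w, b)), tor (gvec g (a, b + h))}"

definition Rect :: "grid \<Rightarrow> gen \<Rightarrow> gen \<Rightarrow> rect set" where
  "Rect g x y = {tor ` pgram g a b w h | a b w h. is_rect g x y a b w h}"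

definition empty_Rect :: "grid \<Rightarrow> gen \<Rightarrow> gen \<Rightarrow> rect set" where
  "empty_Rect g x y = {tor ` pgram g a b w h | a b w h. is_rect g x y a b w h \<and>
     tor ` open_pgram g a b w h \<inter> (x \<union> y) = {}}"

text \<open>The domain of \<open>r\<^sub>1 * r\<^sub>2\<close> as a 2-chain, given by its multiplicities away from the circles.\<close>

definition domain2 :: "grid \<Rightarrow> rect \<Rightarrow> rect \<Rightarrow> tpoint \<Rightarrow> nat" where
  "domain2 g r1 r2 P =
     (if P \<in> off_circles g then of_bool (P \<in> r1) + of_bool (P \<in> r2) else 0)"

definition is_annulus :: "grid \<Rightarrow> rect \<Rightarrow> rect \<Rightarrow> tpoint set \<Rightarrow> bool" where
  "is_annulus g r1 r2 A \<longleftrightarrow> (\<forall>P\<in>off_circles g. domain2 g r1 r2 P = of_bool (P \<in> A))"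

definition horizontal_annulus :: "grid \<Rightarrow> rect \<Rightarrow> rect \<Rightarrow> bool" where
  "horizontal_annulus g r1 r2 \<longleftrightarrow> (\<exists>c d. c < d \<and> d < c + 1 \<and>
     tor ` {(x, y). y = c} \<subseteq> alphas g \<and> tor ` {(x, y). y = d} \<subseteq> alphas g \<and>
     is_annulus g r1 r2 (tor ` {(x, y). c \<le> y \<and> y \<le> d}))"

definition vertical_annulus :: "grid \<Rightarrow> rect \<Rightarrow> rect \<Rightarrow> bool" where
  "vertical_annulus g r1 r2 \<longleftrightarrow> (\<exists>c d. c < d \<and> d < c + 1 / lp g \<and>
     tor ` {(x, y). x = c - lq g / lp g * y} \<subseteq> betas g \<and>
     tor ` {(x, y). x = d - lq g / lp g * y} \<subseteq> betas g \<and>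
     is_annulus g r1 r2
       (tor ` {(x, y). c - lq g / lp g * y \<le> x \<and> x \<le> d - lq g / lp g * y}))"

text \<open>The same subset of the torus may connect many pairs of generators; these count as different
  rectangles. Hence a sign assignment takes \<open>x\<close>, \<open>y\<close> and \<open>r \<in> Rect g x y\<close> as arguments.\<close>

type_synonym signs = "gen \<Rightarrow> gen \<Rightarrow> rect \<Rightarrow> int"

definition sign_assignment :: "int \<Rightarrow> grid \<Rightarrow> signs \<Rightarrow> bool" where
  "sign_assignment e g S \<longleftrightarrow>
     (\<forall>x\<in>gens g. \<forall>y\<in>gens g. \<forall>r\<in>Rect g x y. S x y r \<in> {1, -1}) \<and>
     (\<forall>x\<in>gens g. \<forall>y\<in>gens g. \<forall>y'\<in>gens g. \<forall>z\<in>gens g.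
        \<forall>r1\<in>Rect g x y. \<forall>r2\<in>Rect g y z. \<forall>r1'\<in>Rect g x y'. \<forall>r2'\<in>Rect g y' z.
        y \<noteq> y' \<and> domain2 g r1 r2 = domain2 g r1' r2' \<longrightarrow>
        S x y r1 * S y z r2 = - (S x y' r1' * S y' z r2')) \<and>
     (\<forall>x\<in>gens g. \<forall>y\<in>gens g. \<forall>r1\<in>Rect g x y. \<forall>r2\<in>Rect g y x.
        horizontal_annulus g r1 r2 \<longrightarrow> S x y r1 * S y x r2 = e) \<and>
     (\<forall>x\<in>gens g. \<forall>y\<in>gens g. \<forall>r1\<in>Rect g x y. \<forall>r2\<in>Rect g y x.
        vertical_annulus g r1 r2 \<longrightarrow> S x y r1 * S y x r2 = - e)"

definition true_sign_assignment :: "grid \<Rightarrow> signs \<Rightarrow> bool" where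
  "true_sign_assignment g S \<longleftrightarrow> sign_assignment 1 g S"

definition false_sign_assignment :: "grid \<Rightarrow> signs \<Rightarrow> bool" where
  "false_sign_assignment g S \<longleftrightarrow> sign_assignment (-1) g S"


section \<open>Complexes and homology\<close>

text \<open>Integer polynomials in the variables \<open>Uvar 0, Uvar 1, \<dots>\<close>; \<open>poly_ring V\<close> is the subring of
  polynomials in the \<open>Uvar i\<close> with \<open>i \<in> V\<close>, in particular \<open>poly_ring {}\<close> is the ring of integers.\<close>

type_synonym upoly = "(nat \<Rightarrow>\<^sub>0 nat) \<Rightarrow>\<^sub>0 int"

definition Uvar :: "nat \<Rightarrow> upoly" where
  "Uvar i = Poly_Mapping.single (Poly_Mapping.single i 1) 1"

definition poly_ring :: "nat set \<Rightarrow> upoly set" where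
  "poly_ring V = {f. \<forall>u \<in> Poly_Mapping.keys f. Poly_Mapping.keys u \<subseteq> V}"

text \<open>For a set \<open>V\<close> of indices of \<open>O\<close> marks, \<open>cfk g V\<close> with \<open>cfk_diff g V S\<close> is the quotient of
  the full complex (which is the case \<open>V = {..<numO g}\<close>) by \<open>Uvar i = 0\<close> for all \<open>i \<notin> V\<close>: the free
  module over \<open>\<int>[Uvar i | i \<in> V]\<close> on the generators, as an additive group, with the
  substitution \<open>Uvar i \<mapsto> 0\<close> (\<open>i \<notin> V\<close>) applied to the coefficients of the differential.\<close>

definition cfk :: "grid \<Rightarrow> nat set \<Rightarrow> (gen \<Rightarrow> upoly) monoid" where
  "cfk g V =
     \<lparr>carrier = {c. (\<forall>x\<in>gens g. c x \<in> poly_ring V) \<and> (\<forall>x. x \<notin> gens g \<longrightarrow> c x = 0)},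
      mult = (\<lambda>c d x. c x + d x),
      one = (\<lambda>x. 0)\<rparr>"

definition diff_coeff :: "grid \<Rightarrow> nat set \<Rightarrow> signs \<Rightarrow> gen \<Rightarrow> gen \<Rightarrow> upoly" where
  "diff_coeff g V S x y =
     (\<Sum>r | r \<in> empty_Rect g x y \<and> card ((mX g \<union> mXX g) \<inter> r) = 0.
        of_int (S x y r) * (\<Prod>i<numO g. (if i \<in> V then Uvar i else 0) ^ card ({mO g i} \<inter> r)))"

definition cfk_diff :: "grid \<Rightarrow> nat set \<Rightarrow> signs \<Rightarrow> (gen \<Rightarrow> upoly) \<Rightarrow> (gen \<Rightarrow> upoly)" where
  "cfk_diff g V S c = (\<lambda>y. if y \<in> gens g then \<Sum>x\<in>gens g. c x * diff_coeff g V S x y else 0)"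

definition cfk_cycles :: "grid \<Rightarrow> nat set \<Rightarrow> signs \<Rightarrow> (gen \<Rightarrow> upoly) set" where
  "cfk_cycles g V S = kernel (cfk g V) (cfk g V) (cfk_diff g V S)"

definition cfk_boundaries :: "grid \<Rightarrow> nat set \<Rightarrow> signs \<Rightarrow> (gen \<Rightarrow> upoly) set" where
  "cfk_boundaries g V S = cfk_diff g V S ` carrier (cfk g V)"

definition grid_homology :: "grid \<Rightarrow> nat set \<Rightarrow> signs \<Rightarrow> (gen \<Rightarrow> upoly) set monoid" where
  "grid_homology g V S = (cfk g V)\<lparr>carrier := cfk_cycles g V S\<rparr> Mod cfk_boundaries g V S"

text \<open>The scalar multiplication induced on homology: the class of \<open>c\<close> is sent to that of \<open>f c\<close>.\<close>

definition hscale ::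
  "grid \<Rightarrow> nat set \<Rightarrow> signs \<Rightarrow> upoly \<Rightarrow> (gen \<Rightarrow> upoly) set \<Rightarrow> (gen \<Rightarrow> upoly) set" where
  "hscale g V S f \<xi> = cfk_boundaries g V S <#>\<^bsub>cfk g V\<^esub> ((\<lambda>c x. f * c x) ` \<xi>)"


section \<open>Relative gradings\<close>

definition Wcoord :: "grid \<Rightarrow> tpoint set \<Rightarrow> (real \<times> real) set" where
  "Wcoord g P = {(a, b). 0 \<le> a \<and> a < lp g * gsize g \<and> 0 \<le> b \<and> b < gsize g \<and>
     tor (gvec g (a, b)) \<in> P}"

definition Cpq :: "grid \<Rightarrow> (real \<times> real) set \<Rightarrow> (real \<times> real) set" where
  "Cpq g A = {((a + gsize g * lq g * l) rmod (lp g * gsize g),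
               (b + gsize g * l) rmod (lp g * gsize g)) | a b (l::int).
               (a, b) \<in> A \<and> 0 \<le> l \<and> l < lp g}"

definition Wt :: "grid \<Rightarrow> tpoint set \<Rightarrow> (real \<times> real) set" where
  "Wt g P = Cpq g (Wcoord g P)"

definition Icount :: "(real \<times> real) set \<Rightarrow> (real \<times> real) set \<Rightarrow> nat" where
  "Icount A B = card {(u, v). u \<in> A \<and> v \<in> B \<and> fst u < fst v \<and> snd u < snd v}"

definition Jsym :: "(real \<times> real) set \<Rightarrow> (real \<times> real) set \<Rightarrow> real" where
  "Jsym A B = (real (Icount A B) + real (Icount B A)) / 2"

definition Jdiff :: "grid \<Rightarrow> tpoint set \<Rightarrow> gen \<Rightarrow> gen \<Rightarrow> real" where
  "Jdiff g P x y = Jsym (Wt g P) (Wt g x) - Jsym (Wt g P) (Wt g y)"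

definition maslovO :: "grid \<Rightarrow> gen \<Rightarrow> gen \<Rightarrow> real" where
  "maslovO g x y = 1 / lp g * (Jsym (Wt g x) (Wt g x) - Jsym (Wt g y) (Wt g y)
     - 2 * (Jdiff g (setO g) x y - Jdiff g (mXX g) x y))"

definition maslovX :: "grid \<Rightarrow> gen \<Rightarrow> gen \<Rightarrow> real" where
  "maslovX g x y = 1 / lp g * (Jsym (Wt g x) (Wt g x) - Jsym (Wt g y) (Wt g y)
     - 2 * (Jdiff g (mX g) x y + Jdiff g (mXX g) x y))"

definition alexander :: "grid \<Rightarrow> gen \<Rightarrow> gen \<Rightarrow> real" where
  "alexander g x y = (maslovO g x y - maslovX g x y) / 2"

definition rect_connected :: "grid \<Rightarrow> gen \<Rightarrow> gen \<Rightarrow> bool" where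
  "rect_connected g x y \<longleftrightarrow>
     (x, y) \<in> {(u, v). u \<in> gens g \<and> v \<in> gens g \<and> (Rect g u v \<noteq> {} \<or> Rect g v u \<noteq> {})}\<^sup>*"

definition mdeg :: "(nat \<Rightarrow>\<^sub>0 nat) \<Rightarrow> nat" where
  "mdeg u = (\<Sum>i\<in>Poly_Mapping.keys u. Poly_Mapping.lookup u i)"

text \<open>\<open>c\<close> is supported on generators connected to \<open>x\<close> and has bidegree \<open>(a, b)\<close> relative
  to \<open>x\<close>. The zero chain has every bidegree.\<close>

definition homogeneous ::
  "grid \<Rightarrow> gen \<Rightarrow> real \<Rightarrow> real \<Rightarrow> (gen \<Rightarrow> upoly) \<Rightarrow> bool" where
  "homogeneous g x a b c \<longleftrightarrow>
     (\<forall>y\<in>gens g. \<forall>u\<in>Poly_Mapping.keys (c y). rect_connected g x y \<and>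
        maslovO g y x - 2 * real (mdeg u) = a \<and> alexander g y x - real (mdeg u) = b)"

definition hpart ::
  "grid \<Rightarrow> nat set \<Rightarrow> signs \<Rightarrow> gen \<Rightarrow> real \<Rightarrow> real \<Rightarrow> (gen \<Rightarrow> upoly) set set" where
  "hpart g V S x a b =
     {cfk_boundaries g V S #>\<^bsub>cfk g V\<^esub> c | c. c \<in> cfk_cycles g V S \<and> homogeneous g x a b c}"

text \<open>The bigrading is only relative, and only defined between connected generators. So an
  isomorphism has to respect the splitting along connected components and, on each component, the
  bigrading up to a shift. Linearity is over \<open>poly_ring R\<close>.\<close>

definition isomorphic_homology ::
  "grid \<Rightarrow> nat set \<Rightarrow> nat set \<Rightarrow> signs \<Rightarrow> signs \<Rightarrow> bool" where
  "isomorphic_homology g V R S S' \<longleftrightarrow>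
     (\<exists>\<phi> \<in> iso (grid_homology g V S) (grid_homology g V S').
        (\<forall>f\<in>poly_ring R. \<forall>\<xi>\<in>carrier (grid_homology g V S).
           \<phi> (hscale g V S f \<xi>) = hscale g V S' f (\<phi> \<xi>)) \<and>
        (\<forall>x\<in>gens g. \<exists>dM dA. \<forall>a b.
           \<phi> ` hpart g V S x a b = hpart g V S' x (a + dM) (b + dA)))"

end

theory Submission
  imports Defs
begin

text \<open>The two complexes have the same generators and their differentials differ only in signs. It
suffices to find a function \<open>f\<close> from generators to \<open>{1, -1}\<close> such that
\<open>S' x y r = f x * f y * S x y r\<close> for all rectangles \<open>r\<close> counted by the differential. Then
\<open>c \<mapsto> (\<lambda>x. f x * c x)\<close> is an isomorphism of chain complexes. It is linear over all polynomials and
preserves supports, so it respects the module structure and the bigrading, in all three versions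
at once (\<open>gauge_isomorphic_homology\<close>).

To find \<open>f\<close>, consider the product \<open>Q\<close> of the two sign assignments. It takes the same value on two
decompositions of a domain, and the value \<open>-1\<close> on every annulus. The latter is corrected as follows. A
horizontal annulus of \<open>h\<close> rows contains \<open>h\<close> marks \<open>X\<close> or \<open>XX\<close>, one in each row, and \<open>h - 1\<close> points of
the generator in its interior, one on each inner circle; the same holds for columns. So the
factor \<open>(-1) ^ a\<close>, where \<open>a\<close> counts the \<open>X\<close> and \<open>XX\<close> marks in \<open>r\<close> and the points of \<open>x\<close> in the interior of
\<open>r\<close>, is \<open>-1\<close> on every annulus. It agrees on two decompositions of a domain in all the cases that
occur below, and it is \<open>1\<close> on the rectangles counted by the differential. The corrected function
\<open>omega\<close> is a cocycle with value \<open>1\<close> on annuli, and it remains to see that it is a coboundary.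

A generator is lifted to the columns of its points on the \<open>N\<close> rows, \<open>N\<close> integers that are distinct
modulo \<open>N\<close>. A rectangle then acts as a transposition of the affine symmetric group on the columns
(\<open>is_rect_rc\<close>), and the rectangles of width one are the Coxeter generators. The relations of this
group come from pairs of decompositions: two far apart thin rectangles commute (\<open>eps_commute\<close>), and the
L-shaped domains on three columns give the braid relation (\<open>eps_triple\<close>). Sorting by descents
then gives a function \<open>F\<close> on lifted generators with coboundary \<open>omega\<close> on thin rectangles
(\<open>eps_thin_coboundary\<close>). Wider rectangles reduce to narrower ones: up to width \<open>N\<close> by the L-shaped
domains, and beyond \<open>N\<close> by a domain that wraps around the torus and moves only two points of the generator
(\<open>omega_fold\<close>).

Two lifts of a generator differ by multiples of \<open>p N\<close>. A horizontal annulus acts on lifts as the shift of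
one column by \<open>p N\<close> and of another by \<open>- p N\<close>, so its relation says that \<open>F\<close> is invariant
under these shifts (\<open>potential_periodic\<close>). Hence \<open>F\<close> descends to the required function \<open>f\<close>
(\<open>omega_gauge\<close>).\<close>

section \<open>The torus in lattice coordinates\<close>

locale grid_torus =
  fixes g :: grid
  assumes grid: "grid_diagram g"
begin

abbreviation p :: int where "p \<equiv> lp g"
abbreviation q :: int where "q \<equiv> lq g"
abbreviation n :: nat where "n \<equiv> gsize g"
abbreviation N :: int where "N \<equiv> int (gsize g)"

lemma p_pos: "p > 0"
  using grid unfolding grid_diagram_def by linarith

lemma N_pos: "N > 0"
  using grid unfolding grid_diagram_def by simp

lemma coprime_pq: "coprime p q"
  using grid unfolding grid_diagram_def by simp

text \<open>The coordinates \<open>(a, b)\<close> are those of \<open>gvec\<close>, in which the circles are the lines with an integral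
  coordinate. The torus is the quotient of the plane by the lattice \<open>lat\<close> of rank two, see \<open>pt_eq_iff\<close>.\<close>

definition pt :: "real \<Rightarrow> real \<Rightarrow> tpoint" where
  "pt a b = tor (gvec g (a, b))"

definition lat :: "int \<Rightarrow> int \<Rightarrow> bool" where
  "lat x y \<longleftrightarrow> (\<exists>l m. x = N * (q * l + p * m) \<and> y = N * l)"

lemma tor_eq_iff: "tor u = tor v \<longleftrightarrow> fst u - fst v \<in> \<int> \<and> snd u - snd v \<in> \<int>"
proof
  assume "tor u = tor v"
  moreover have "u \<in> tor u" by (simp add: tor_def)
  ultimately have "u \<in> tor v" by simp
  then show "fst u - fst v \<in> \<int> \<and> snd u - snd v \<in> \<int>" by (simp add: tor_def)
next
  assume *: "fst u - fst v \<in> \<int> \<and> snd u - snd v \<in> \<int>"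
  have aux: "a - c \<in> \<int> \<longleftrightarrow> a - d \<in> \<int>" if "c - d \<in> \<int>" for a c d :: real
  proof -
    have "a - d = (a - c) + (c - d)" "a - c = (a - d) - (c - d)" by simp_all
    then show ?thesis using that Ints_add Ints_diff by metis
  qed
  show "tor u = tor v" unfolding tor_def using * aux by blast
qed

lemma pt_eq_iff:
  "pt a b = pt a' b' \<longleftrightarrow> (\<exists>x y. lat x y \<and> a - a' = of_int x \<and> b - b' = of_int y)"
proof -
  have N0: "real n > 0" using N_pos by simp
  have p0: "real_of_int p > 0" using p_pos by simp
  have 1: "fst (gvec g (a, b)) - fst (gvec g (a', b'))
      = ((a - a') - (b - b') * q) / (p * real n)"
    by (simp add: gvec_def diff_divide_distrib left_diff_distrib)
  have 2: "snd (gvec g (a, b)) - snd (gvec g (a', b')) = (b - b') / real n"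
    by (simp add: gvec_def diff_divide_distrib)
  have "pt a b = pt a' b' \<longleftrightarrow> (\<exists>m::int. ((a - a') - (b - b') * q) / (p * real n) = of_int m)
      \<and> (\<exists>l::int. (b - b') / real n = of_int l)"
    unfolding pt_def tor_eq_iff 1 2 by (auto simp: Ints_def)
  also have "\<dots> \<longleftrightarrow> (\<exists>l m::int. b - b' = of_int (N * l) \<and> a - a' = of_int (N * (q * l + p * m)))"
    (is "?L \<longleftrightarrow> ?R")
  proof
    assume ?L
    then obtain m l :: int where m: "((a - a') - (b - b') * q) / (p * real n) = of_int m"
      and l: "(b - b') / real n = of_int l" by blast
    have "b - b' = of_int (N * l)" using l N0 by (simp add: field_simps)
    moreover have "a - a' - (b - b') * q = of_int m * (p * real n)"
      using m N0 p0 by (simp add: field_simps)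
    ultimately show ?R
      by (intro exI[of _ l] exI[of _ m]) (simp add: algebra_simps)
  next
    assume ?R
    then obtain m l :: int where ml: "b - b' = of_int (N * l)"
      "a - a' = of_int (N * (q * l + p * m))" by blast
    have "((a - a') - (b - b') * q) / (p * real n) = of_int m"
      unfolding ml using N0 p0 by (simp add: field_simps)
    moreover have "(b - b') / real n = of_int l"
      unfolding ml using N0 by (simp add: field_simps)
    ultimately show ?L by blast
  qed
  also have "\<dots> \<longleftrightarrow> (\<exists>x y. lat x y \<and> a - a' = of_int x \<and> b - b' = of_int y)"
    unfolding lat_def by metis
  finally show ?thesis .
qed

lemma range_tor: "P \<in> range tor \<longleftrightarrow> (\<exists>s t. P = pt s t)"
proof
  assume "P \<in> range tor"
  then obtain x y where P: "P = tor (x, y)" by auto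
  have N0: "real n > 0" using N_pos by simp
  have p0: "real_of_int p > 0" using p_pos by simp
  have "gvec g (p * real n * x + real n * y * q, real n * y) = (x, y)"
    using N0 p0 by (simp add: gvec_def field_simps)
  then have "P = pt (p * real n * x + real n * y * q) (real n * y)" unfolding pt_def P by simp
  then show "\<exists>s t. P = pt s t" by blast
qed (auto simp: pt_def)

lemma lat_0 [simp]: "lat 0 0"
  unfolding lat_def by (intro exI[of _ 0]) simp

lemma lat_add: "lat x y \<Longrightarrow> lat x' y' \<Longrightarrow> lat (x + x') (y + y')"
  unfolding lat_def
  apply clarify
  subgoal for l l' m m'
    by (intro exI[of _ "l + l'"] exI[of _ "m + m'"]) (simp add: algebra_simps)
  done

lemma lat_uminus: "lat x y \<Longrightarrow> lat (- x) (- y)"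
  unfolding lat_def
  apply clarify
  subgoal for l m by (intro exI[of _ "- l"] exI[of _ "- m"]) (simp add: algebra_simps)
  done

lemma lat_diff: "lat x y \<Longrightarrow> lat x' y' \<Longrightarrow> lat (x - x') (y - y')"
  using lat_add[OF _ lat_uminus] by fastforce

lemma lat_dvd: "lat x y \<Longrightarrow> N dvd x" "lat x y \<Longrightarrow> N dvd y"
  unfolding lat_def by auto

text \<open>The vertical period is \<open>p N\<close> and not \<open>N\<close>, since \<open>p\<close> and \<open>q\<close> are coprime: a \<open>\<beta>\<close> circle meets every
  \<open>\<alpha>\<close> circle \<open>p\<close> times. Coprimality also makes every column congruent to a given one modulo
  \<open>N\<close> a translate of it (\<open>lat_ex_right\<close>).\<close>

lemma lat_vert: "lat 0 y \<longleftrightarrow> p * N dvd y"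
proof
  assume "lat 0 y"
  then obtain l m where 0: "0 = N * (q * l + p * m)" and y: "y = N * l" unfolding lat_def by auto
  then have "q * l + p * m = 0" using N_pos by simp
  then have "q * l = p * (- m)" by simp
  then have "p dvd q * l" by simp
  then have "p dvd l" using coprime_pq coprime_dvd_mult_right_iff by blast
  then show "p * N dvd y" unfolding y by (simp add: mult.commute)
next
  assume "p * N dvd y"
  then obtain k where "y = p * N * k" by blast
  then show "lat 0 y" unfolding lat_def
    by (intro exI[of _ "p * k"] exI[of _ "- q * k"]) (simp add: algebra_simps)
qed

lemma lat_horiz: "lat x 0 \<longleftrightarrow> p * N dvd x"
proof
  assume "lat x 0"
  then obtain l m where "x = N * (q * l + p * m)" "0 = N * l" unfolding lat_def by auto
  then show "p * N dvd x" using N_pos by simp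
next
  assume "p * N dvd x"
  then obtain k where "x = p * N * k" by blast
  then show "lat x 0" unfolding lat_def
    by (intro exI[of _ 0] exI[of _ k]) (simp add: algebra_simps)
qed

lemma lat_ex_right:
  assumes "N dvd x" shows "\<exists>y. lat x y"
proof -
  obtain k where k: "x = N * k" using assms by blast
  obtain u v where uv: "q * u + p * v = 1"
    using coprime_pq bezout_int[of q p] by (metis coprime_iff_gcd_eq_1 gcd.commute mult.commute)
  have "q * (u * k) + p * (v * k) = k"
    using uv by (metis (no_types) mult.assoc distrib_right mult_1)
  then show ?thesis unfolding lat_def k by metis
qed

lemma lat_ex_left: "N dvd y \<Longrightarrow> \<exists>x. lat x y"
  unfolding lat_def by blast

text \<open>A closed \<open>W\<close> by \<open>H\<close> box projects injectively to the torus iff no nonzero lattice vector fits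
  into it (\<open>inj_pgram_iff\<close>).\<close>

definition emb :: "int \<Rightarrow> int \<Rightarrow> bool" where
  "emb W H \<longleftrightarrow> (\<forall>x y. lat x y \<longrightarrow> \<bar>x\<bar> \<le> W \<longrightarrow> \<bar>y\<bar> \<le> H \<longrightarrow> x = 0 \<and> y = 0)"

lemma embD: "emb W H \<Longrightarrow> lat x y \<Longrightarrow> \<bar>x\<bar> \<le> W \<Longrightarrow> \<bar>y\<bar> \<le> H \<Longrightarrow> x = 0 \<and> y = 0"
  unfolding emb_def by blast

lemma emb_mono: "emb W H \<Longrightarrow> W' \<le> W \<Longrightarrow> H' \<le> H \<Longrightarrow> emb W' H'"
  unfolding emb_def by (meson order_trans)

lemma dvd_small: "(d::int) dvd x \<Longrightarrow> \<bar>x\<bar> < d \<Longrightarrow> x = 0"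
  by (metis abs_ge_zero abs_of_nonneg dvd_abs_iff zdvd_not_zless linorder_not_less order_le_less abs_eq_0)

lemma emb_narrow: "W < N \<Longrightarrow> H < p * N \<Longrightarrow> emb W H"
  unfolding emb_def
proof (intro allI impI)
  fix x y assume *: "W < N" "H < p * N" "lat x y" "\<bar>x\<bar> \<le> W" "\<bar>y\<bar> \<le> H"
  have "x = 0" using * lat_dvd(1)[of x y] dvd_small[of N x] by linarith
  then show "x = 0 \<and> y = 0" using * lat_vert[of y] dvd_small[of "p * N" y] by auto
qed

lemma emb_low: "H < N \<Longrightarrow> W < p * N \<Longrightarrow> emb W H"
  unfolding emb_def
proof (intro allI impI)
  fix x y assume *: "H < N" "W < p * N" "lat x y" "\<bar>x\<bar> \<le> W" "\<bar>y\<bar> \<le> H"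
  have "y = 0" using * lat_dvd(2)[of x y] dvd_small[of N y] by linarith
  then show "x = 0 \<and> y = 0" using * lat_horiz[of x] dvd_small[of "p * N" x] by auto
qed

lemma emb_bounds:
  assumes "emb W H" "0 \<le> W" "0 \<le> H" shows "W < p * N" "H < p * N"
proof -
  have pN: "p * N > 0" using p_pos N_pos by simp
  show "W < p * N"
    using embD[OF assms(1), of "p * N" 0] lat_horiz[of "p * N"] pN assms by force
  show "H < p * N"
    using embD[OF assms(1), of 0 "p * N"] lat_vert[of "p * N"] pN assms by force
qed

definition box :: "int \<Rightarrow> int \<Rightarrow> int \<Rightarrow> int \<Rightarrow> rect" where
  "box a b W H = tor ` pgram g a b W H"

lemma box_alt:
  "box a b W H = {pt s t | s t. of_int a \<le> s \<and> s \<le> of_int (a + W) \<and> of_int b \<le> t \<and> t \<le> of_int (b + H)}"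
proof -
  have "box a b W H = (\<lambda>v. tor (gvec g v)) ` ({real_of_int a..a + W} \<times> {real_of_int b..b + H})"
    unfolding box_def pgram_def image_image by simp
  then show ?thesis unfolding pt_def by (auto simp: image_iff) blast+
qed

lemma mem_box:
  "pt s t \<in> box a b W H \<longleftrightarrow>
   (\<exists>x y. lat x y \<and> of_int a \<le> s + of_int x \<and> s + of_int x \<le> of_int (a + W) \<and>
      of_int b \<le> t + of_int y \<and> t + of_int y \<le> of_int (b + H))"
proof -
  have "pt s t \<in> box a b W H \<longleftrightarrow> (\<exists>s' t'. of_int a \<le> s' \<and> s' \<le> of_int (a + W) \<and>
      of_int b \<le> t' \<and> t' \<le> of_int (b + H) \<and> pt s' t' = pt s t)"
    unfolding box_alt mem_Collect_eq by metis
  also have "\<dots> \<longleftrightarrow> (\<exists>x y. lat x y \<and> of_int a \<le> s + of_int x \<and> s + of_int x \<le> of_int (a + W) \<and>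
      of_int b \<le> t + of_int y \<and> t + of_int y \<le> of_int (b + H))"
    unfolding pt_eq_iff
    apply (rule iffI)
     apply clarify
    subgoal for s' t' x y by (intro exI[of _ x] exI[of _ y]) (simp add: algebra_simps)
    apply clarify
    subgoal for x y by (intro exI[of _ "s + x"] exI[of _ "t + y"]) auto
    done
  finally show ?thesis .
qed

lemma mem_box_int:
  "pt (of_int s) (of_int t) \<in> box a b W H \<longleftrightarrow>
   (\<exists>x y. lat x y \<and> a \<le> s + x \<and> s + x \<le> a + W \<and> b \<le> t + y \<and> t + y \<le> b + H)"
  unfolding mem_box of_int_add[symmetric] of_int_le_iff by simp

lemma box_pts: "P \<in> box a b W H \<Longrightarrow> \<exists>s t. P = pt s t"
  unfolding box_alt by auto

lemma box_translate:
  assumes "lat x y" shows "box (a + x) (b + y) W H = box a b W H"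
proof -
  have *: "P \<in> box (a + x) (b + y) W H" if "lat x y" "P \<in> box a b W H" for P x y a b
  proof -
    obtain s t where P: "P = pt s t" using box_pts \<open>P \<in> _\<close> by blast
    then obtain x' y' where xy: "lat x' y'" "a \<le> s + of_int x'" "s + of_int x' \<le> a + W"
      "b \<le> t + of_int y'" "t + of_int y' \<le> b + H" using \<open>P \<in> _\<close> unfolding P mem_box by blast
    show ?thesis unfolding P mem_box
      by (rule exI[of _ "x' + x"], rule exI[of _ "y' + y"])
        (use xy lat_add[OF xy(1) \<open>lat x y\<close>] in auto)
  qed
  have "box a b W H \<subseteq> box (a + x) (b + y) W H" using *[OF assms] by blast
  moreover have "box (a + x) (b + y) W H \<subseteq> box a b W H"
    using *[OF lat_uminus[OF assms], of _ "a + x" "b + y"] by auto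
  ultimately show ?thesis by blast
qed

text \<open>Cutting a box counts the points on the cut twice. The domain identities below are therefore stated for
  points none of whose translates lies on the columns in \<open>A\<close> or the rows in \<open>B\<close>. This covers two kinds of
  points: those off all circles, which determine domains, and the points of a generator that are not
  moved.\<close>

definition avoids :: "real \<Rightarrow> real \<Rightarrow> int set \<Rightarrow> int set \<Rightarrow> bool" where
  "avoids s t A B \<longleftrightarrow> (\<forall>x y. lat x y \<longrightarrow> s + of_int x \<notin> of_int ` A \<and> t + of_int y \<notin> of_int ` B)"

lemma avoids_non_int: "s \<notin> \<int> \<Longrightarrow> t \<notin> \<int> \<Longrightarrow> avoids s t A B"
proof -
  assume *: "s \<notin> \<int>" "t \<notin> \<int>"
  have "r \<in> \<int>" if "r + of_int x = of_int a" for r :: real and x a :: int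
  proof -
    have "r = of_int (a - x)" using that by simp
    then show ?thesis by simp
  qed
  then show ?thesis using * unfolding avoids_def by blast
qed

lemma avoids_int:
  assumes "\<And>a. a \<in> A \<Longrightarrow> \<not> N dvd (s - a)" "\<And>b. b \<in> B \<Longrightarrow> \<not> N dvd (t - b)"
  shows "avoids (of_int s) (of_int t) A B"
  unfolding avoids_def
proof (intro allI impI conjI notI)
  fix x y assume "lat x y"
  { assume "real_of_int s + of_int x \<in> of_int ` A"
    then obtain a where "a \<in> A" "s + x = a" by (auto simp flip: of_int_add)
    then have "s - a = - x" by simp
    then show False using assms(1)[OF \<open>a \<in> A\<close>] lat_dvd(1)[OF \<open>lat x y\<close>] by simp }
  { assume "real_of_int t + of_int y \<in> of_int ` B"
    then obtain a where "a \<in> B" "t + y = a" by (auto simp flip: of_int_add)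
    then have "t - a = - y" by simp
    then show False using assms(2)[OF \<open>a \<in> B\<close>] lat_dvd(2)[OF \<open>lat x y\<close>] by simp }
qed

abbreviation ind :: "tpoint \<Rightarrow> tpoint set \<Rightarrow> nat" where
  "ind P r \<equiv> of_bool (P \<in> r)"

text \<open>If the point lay in both halves, the big box would contain two of its lifts; they would coincide
  since the box is embedded, and lie on the cut.\<close>

lemma box_split_width:
  assumes "0 \<le> W1" "0 \<le> W2" "emb (W1 + W2) H" "avoids s t A B" "a + W1 \<in> A"
  shows "ind (pt s t) (box a b (W1 + W2) H) = ind (pt s t) (box a b W1 H) + ind (pt s t) (box (a + W1) b W2 H)"
proof -
  have cut: "s + of_int x \<noteq> real_of_int (a + W1)" if "lat x y" for x y
    using assms(4,5) that unfolding avoids_def by blast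
  have union: "pt s t \<in> box a b (W1 + W2) H \<longleftrightarrow> pt s t \<in> box a b W1 H \<or> pt s t \<in> box (a + W1) b W2 H"
    unfolding mem_box using assms(1,2) by (smt (verit) of_int_add of_int_0_le_iff)
  have disj: "\<not> (pt s t \<in> box a b W1 H \<and> pt s t \<in> box (a + W1) b W2 H)"
  proof
    assume "pt s t \<in> box a b W1 H \<and> pt s t \<in> box (a + W1) b W2 H"
    then obtain x y x' y' where 1: "lat x y" "a \<le> s + of_int x" "s + of_int x \<le> a + W1" "b \<le> t + of_int y" "t + of_int y \<le> b + H"
      and 2: "lat x' y'" "a + W1 \<le> s + of_int x'" "s + of_int x' \<le> a + W1 + W2" "b \<le> t + of_int y'" "t + of_int y' \<le> b + H"
      unfolding mem_box by auto
    have "lat (x' - x) (y' - y)" using lat_diff 1 2 by blast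
    moreover have "real_of_int \<bar>x' - x\<bar> \<le> of_int (W1 + W2)" using 1 2 assms(1,2) by auto
    moreover have "real_of_int \<bar>y' - y\<bar> \<le> of_int H" using 1 2 by auto
    ultimately have "x' = x" using embD[OF assms(3)] by (metis of_int_le_iff eq_iff_diff_eq_0)
    then show False using 1 2 cut[OF 1(1)] by auto
  qed
  show ?thesis using union disj by auto
qed

lemma box_split_height:
  assumes "0 \<le> H1" "0 \<le> H2" "emb W (H1 + H2)" "avoids s t A B" "b + H1 \<in> B"
  shows "ind (pt s t) (box a b W (H1 + H2)) = ind (pt s t) (box a b W H1) + ind (pt s t) (box a (b + H1) W H2)"
proof -
  have cut: "t + of_int y \<noteq> real_of_int (b + H1)" if "lat x y" for x y
    using assms(4,5) that unfolding avoids_def by blast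
  have union: "pt s t \<in> box a b W (H1 + H2) \<longleftrightarrow> pt s t \<in> box a b W H1 \<or> pt s t \<in> box a (b + H1) W H2"
    unfolding mem_box using assms(1,2) by (smt (verit) of_int_add of_int_0_le_iff)
  have disj: "\<not> (pt s t \<in> box a b W H1 \<and> pt s t \<in> box a (b + H1) W H2)"
  proof
    assume "pt s t \<in> box a b W H1 \<and> pt s t \<in> box a (b + H1) W H2"
    then obtain x y x' y' where 1: "lat x y" "a \<le> s + of_int x" "s + of_int x \<le> a + W" "b \<le> t + of_int y" "t + of_int y \<le> b + H1"
      and 2: "lat x' y'" "a \<le> s + of_int x'" "s + of_int x' \<le> a + W" "b + H1 \<le> t + of_int y'" "t + of_int y' \<le> b + H1 + H2"
      unfolding mem_box by auto
    have "lat (x' - x) (y' - y)" using lat_diff 1 2 by blast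
    moreover have "real_of_int \<bar>x' - x\<bar> \<le> of_int W" using 1 2 by auto
    moreover have "real_of_int \<bar>y' - y\<bar> \<le> of_int (H1 + H2)" using 1 2 assms(1,2) by auto
    ultimately have "y' = y" using embD[OF assms(3)] by (metis of_int_le_iff eq_iff_diff_eq_0)
    then show False using 1 2 cut[OF 1(1)] by auto
  qed
  show ?thesis using union disj by auto
qed

lemma alpha_iff: "pt a b \<in> alpha g i \<longleftrightarrow> (\<exists>k::int. b = of_int (int i + N * k))"
proof -
  have N0: "real n > 0" using N_pos by simp
  have *: "P \<in> alpha g i \<longleftrightarrow> (\<exists>x. P = pt x (real i))" for P
  proof
    assume "P \<in> alpha g i"
    then obtain x where P: "P = tor (x, real i / real n)" unfolding alpha_def by auto
    have p0: "real_of_int p > 0" using p_pos by simp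
    have "gvec g (p * real n * x + i * q, i) = (x, real i / real n)"
      using N0 p0 by (simp add: gvec_def field_simps)
    then have "P = pt (p * real n * x + i * q) i" unfolding P pt_def by simp
    then show "\<exists>x. P = pt x i" by blast
  next
    assume "\<exists>x. P = pt x i"
    then show "P \<in> alpha g i" unfolding alpha_def pt_def gvec_def by auto
  qed
  show ?thesis
  proof
    assume "pt a b \<in> alpha g i"
    then obtain x where "pt a b = pt x i" using * by blast
    then obtain x' y where "lat x' y" "b - i = of_int y" unfolding pt_eq_iff by auto
    moreover from this obtain k where "y = N * k" using lat_dvd(2) by blast
    ultimately have "b = of_int (int i + N * k)" by simp
    then show "\<exists>k::int. b = of_int (int i + N * k)" by blast
  next
    assume "\<exists>k::int. b = of_int (int i + N * k)"
    then obtain k where b: "b = of_int (int i + N * k)" by blast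
    obtain x where x: "lat x (N * k)" using lat_ex_left by (metis dvd_triv_left)
    have "pt a b = pt (a - of_int x) i" unfolding pt_eq_iff
      by (rule exI[of _ x], rule exI[of _ "N * k"]) (simp add: x b)
    then show "pt a b \<in> alpha g i" using * by blast
  qed
qed

lemma beta_iff: "pt a b \<in> beta g i \<longleftrightarrow> (\<exists>k::int. a = of_int (int i + N * k))"
proof -
  have N0: "real n > 0" using N_pos by simp
  have p0: "real_of_int p > 0" using p_pos by simp
  have *: "P \<in> beta g i \<longleftrightarrow> (\<exists>y. P = pt (real i) y)" for P
  proof
    assume "P \<in> beta g i"
    then obtain y where P: "P = tor (real i / (lp g * gsize g) - lq g / lp g * y, y)" unfolding beta_def by auto
    have "gvec g (i, real n * y) = (real i / (lp g * gsize g) - lq g / lp g * y, y)"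
      using N0 p0 by (simp add: gvec_def field_simps)
    then have "P = pt i (real n * y)" unfolding P pt_def by simp
    then show "\<exists>y. P = pt i y" by blast
  next
    assume "\<exists>y. P = pt i y"
    then obtain y where P: "P = pt i y" by blast
    have "gvec g (i, y) = (real i / (lp g * gsize g) - lq g / lp g * (y / n), y / n)"
      using N0 p0 by (simp add: gvec_def field_simps)
    then show "P \<in> beta g i" unfolding beta_def P pt_def by auto
  qed
  show ?thesis
  proof
    assume "pt a b \<in> beta g i"
    then obtain y where "pt a b = pt i y" using * by blast
    then obtain x y where "lat x y" "a - i = of_int x" unfolding pt_eq_iff by auto
    moreover from this obtain k where "x = N * k" using lat_dvd(1) by blast
    ultimately have "a = of_int (int i + N * k)" by simp
    then show "\<exists>k::int. a = of_int (int i + N * k)" by blast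
  next
    assume "\<exists>k::int. a = of_int (int i + N * k)"
    then obtain k where a: "a = of_int (int i + N * k)" by blast
    obtain y where y: "lat (N * k) y" using lat_ex_right by (metis dvd_triv_left)
    have "pt a b = pt i (b - of_int y)" unfolding pt_eq_iff
      by (rule exI[of _ "N * k"], rule exI[of _ y]) (simp add: y a)
    then show "pt a b \<in> beta g i" using * by blast
  qed
qed

lemma residue_ex: "\<exists>i<n. \<exists>k. c = int i + N * k"
proof -
  have "0 \<le> c mod N" "c mod N < N" using N_pos by simp_all
  then show ?thesis
    by (intro exI[of _ "nat (c mod N)"]) (auto intro!: exI[of _ "c div N"] simp: nat_less_iff)
qed

lemma alphas_iff: "pt a b \<in> alphas g \<longleftrightarrow> b \<in> \<int>"
proof -
  have "pt a b \<in> alphas g \<longleftrightarrow> (\<exists>i<n. \<exists>k::int. b = of_int (int i + N * k))"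
    unfolding alphas_def using alpha_iff by blast
  also have "\<dots> \<longleftrightarrow> (\<exists>c::int. b = of_int c)" using residue_ex by metis
  finally show ?thesis by (auto simp: Ints_def)
qed

lemma betas_iff: "pt a b \<in> betas g \<longleftrightarrow> a \<in> \<int>"
proof -
  have "pt a b \<in> betas g \<longleftrightarrow> (\<exists>i<n. \<exists>k::int. a = of_int (int i + N * k))"
    unfolding betas_def using beta_iff by blast
  also have "\<dots> \<longleftrightarrow> (\<exists>c::int. a = of_int c)" using residue_ex by metis
  finally show ?thesis by (auto simp: Ints_def)
qed

lemma off_circles_iff: "P \<in> off_circles g \<longleftrightarrow> (\<exists>s t. P = pt s t \<and> s \<notin> \<int> \<and> t \<notin> \<int>)"
  unfolding off_circles_def Diff_iff Un_iff range_tor by (metis alphas_iff betas_iff)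

lemma inj_pgram_iff:
  assumes "0 \<le> W" "0 \<le> H"
  shows "inj_on tor (pgram g (of_int a) (of_int b) (of_int W) (of_int H)) \<longleftrightarrow> emb W H"
proof
  have inj: "gvec g v = gvec g w \<Longrightarrow> v = w" for v w
    unfolding gvec_def using N_pos p_pos by (auto simp: prod_eq_iff field_simps)
  assume *: "inj_on tor (pgram g (of_int a) (of_int b) (of_int W) (of_int H))"
  show "emb W H" unfolding emb_def
  proof (intro allI impI)
    fix x y assume xy: "lat x y" "\<bar>x\<bar> \<le> W" "\<bar>y\<bar> \<le> H"
    \<comment> \<open>Every vector in the symmetric box is a difference of two points of the box.\<close>
    define s s' t t' where "s = max 0 x" and "s' = max 0 (- x)" and "t = max 0 y" and "t' = max 0 (- y)"
    have st: "s - s' = x" "t - t' = y" "0 \<le> s" "s \<le> W" "0 \<le> s'" "s' \<le> W" "0 \<le> t" "t \<le> H" "0 \<le> t'" "t' \<le> H"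
      using xy assms unfolding s_def s'_def t_def t'_def by auto
    let ?v = "(real_of_int (a + s), real_of_int (b + t))"
    let ?w = "(real_of_int (a + s'), real_of_int (b + t'))"
    have "tor (gvec g ?v) = tor (gvec g ?w)"
      unfolding pt_def[symmetric] pt_eq_iff
      by (rule exI[of _ x], rule exI[of _ y]) (use xy(1) st(1,2) in auto)
    moreover have "gvec g ?v \<in> pgram g a b W H" "gvec g ?w \<in> pgram g a b W H"
      unfolding pgram_def using st by (auto simp flip: of_int_add)
    ultimately have "?v = ?w" using * inj unfolding inj_on_def by blast
    then show "x = 0 \<and> y = 0" using st(1,2) by auto
  qed
next
  assume e: "emb W H"
  show "inj_on tor (pgram g (of_int a) (of_int b) (of_int W) (of_int H))"
  proof (rule inj_onI)
    fix v w assume "v \<in> pgram g (of_int a) (of_int b) (of_int W) (of_int H)"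
      "w \<in> pgram g (of_int a) (of_int b) (of_int W) (of_int H)" and eq: "tor v = tor w"
    then obtain s t s' t' where v: "v = gvec g (s, t)" "s \<in> {of_int a..of_int a + of_int W}" "t \<in> {of_int b..of_int b + of_int H}"
      and w: "w = gvec g (s', t')" "s' \<in> {of_int a..of_int a + of_int W}" "t' \<in> {of_int b..of_int b + of_int H}"
      unfolding pgram_def by auto
    have "pt s t = pt s' t'" using eq v w unfolding pt_def by simp
    then obtain x y where xy: "lat x y" "s - s' = of_int x" "t - t' = of_int y" unfolding pt_eq_iff by blast
    have "real_of_int \<bar>x\<bar> \<le> W" "real_of_int \<bar>y\<bar> \<le> H" using v w xy by auto
    then have "x = 0 \<and> y = 0" using embD[OF e xy(1)] by simp
    then show "v = w" using v w xy by simp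
  qed
qed

end

context grid_torus
begin

section \<open>Generators and rectangles as affine permutations\<close>

lemma dvd_lin: "(d::int) dvd a \<Longrightarrow> d dvd b \<Longrightarrow> c = s * a + t * b \<Longrightarrow> d dvd c"
  by simp

lemma dvd_congruent: "(d::int) dvd a - a' \<Longrightarrow> d dvd b - b' \<Longrightarrow> d dvd a - b \<Longrightarrow> d dvd a' - b'"
proof -
  assume "d dvd a - a'" "d dvd b - b'" "d dvd a - b"
  then have "d dvd (a - b) - (a - a') + (b - b')" by (simp only: dvd_add dvd_diff)
  then show ?thesis by simp
qed

text \<open>A state lists, for each row \<open>k < n\<close>, the column of a lift of the point that a generator has on this row.
  Distinct rows have distinct columns modulo \<open>N\<close>. The value \<open>0\<close> beyond \<open>n\<close> makes a state determined by
  its relevant entries.\<close>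

definition state :: "(nat \<Rightarrow> int) \<Rightarrow> bool" where
  "state u \<longleftrightarrow> (\<forall>i<n. \<forall>j<n. N dvd (u i - u j) \<longrightarrow> i = j) \<and> (\<forall>k\<ge>n. u k = 0)"

definition ipt :: "int \<Rightarrow> int \<Rightarrow> tpoint" where
  "ipt a b = pt (of_int a) (of_int b)"

definition gen :: "(nat \<Rightarrow> int) \<Rightarrow> gen" where
  "gen u = (\<lambda>k. ipt (u k) (int k)) ` {..<n}"

text \<open>The lattice point \<open>(c, b)\<close> lies over a point of the generator \<open>gen u\<close>, see \<open>on_iff\<close>.\<close>

definition on :: "(nat \<Rightarrow> int) \<Rightarrow> int \<Rightarrow> int \<Rightarrow> bool" where
  "on u c b \<longleftrightarrow> (\<exists>k<n. lat (c - u k) (b - int k))"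

text \<open>The transposition in the affine symmetric group that exchanges the columns \<open>c + j N\<close> and
  \<open>c + W + j N\<close> for all \<open>j\<close>, if \<open>W\<close> is not divisible by \<open>N\<close>.\<close>

definition col_tr :: "int \<Rightarrow> int \<Rightarrow> int \<Rightarrow> int" where
  "col_tr c W x = (if N dvd (x - c) then x + W else if N dvd (x - (c + W)) then x - W else x)"

definition tr :: "int \<Rightarrow> int \<Rightarrow> (nat \<Rightarrow> int) \<Rightarrow> nat \<Rightarrow> int" where
  "tr c W u = (\<lambda>k. if n \<le> k then u k else col_tr c W (u k))"

lemma tr_alt:
  "tr c W u = (\<lambda>k. if n \<le> k then u k else if N dvd (u k - c) then u k + W
     else if N dvd (u k - (c + W)) then u k - W else u k)"
  unfolding tr_def col_tr_def ..

lemma ipt_eq: "ipt a b = ipt a' b' \<longleftrightarrow> lat (a - a') (b - b')"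
  unfolding ipt_def pt_eq_iff by (auto simp flip: of_int_diff)

lemma on_iff: "on u c b \<longleftrightarrow> ipt c b \<in> gen u"
  unfolding on_def gen_def by (auto simp: image_iff ipt_eq)

lemma gen_pts: "P \<in> gen u \<Longrightarrow> \<exists>c b. P = ipt c b \<and> on u c b"
  unfolding gen_def on_def using lat_0 by fastforce

lemma state_inj: "state u \<Longrightarrow> i < n \<Longrightarrow> j < n \<Longrightarrow> N dvd (u i - u j) \<Longrightarrow> i = j"
  unfolding state_def by blast

lemma row_inj: "i < n \<Longrightarrow> j < n \<Longrightarrow> N dvd (int i - int j) \<Longrightarrow> i = j"
  using dvd_small[of N "int i - int j"] by linarith

text \<open>The columns of the \<open>n\<close> rows are distinct modulo \<open>N\<close>, hence exhaust all residues.\<close>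

lemma strand_ex:
  assumes "state u" shows "\<exists>k<n. N dvd (u k - c)"
proof -
  have inj: "inj_on (\<lambda>k. u k mod N) {..<n}"
    by (rule inj_onI) (use assms state_inj mod_eq_dvd_iff in blast)
  have sub: "(\<lambda>k. u k mod N) ` {..<n} \<subseteq> {0..<N}" using N_pos by auto
  have "card ((\<lambda>k. u k mod N) ` {..<n}) = card {0..<N}" using inj by (simp add: card_image)
  then have "(\<lambda>k. u k mod N) ` {..<n} = {0..<N}" using sub by (intro card_subset_eq) auto
  moreover have "c mod N \<in> {0..<N}" using N_pos by simp
  ultimately have "\<exists>k<n. c mod N = u k mod N" by auto
  then show ?thesis using mod_eq_dvd_iff by metis
qed

lemma on_lat: "lat x y \<Longrightarrow> on u (c + x) (b + y) \<longleftrightarrow> on u c b"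
proof -
  assume *: "lat x y"
  have "lat (c + x - u k) (b + y - int k) \<longleftrightarrow> lat (c - u k) (b - int k)" for k
  proof -
    have "c + x - u k = (c - u k) + x" "b + y - int k = (b - int k) + y"
      "c - u k = (c + x - u k) - x" "b - int k = (b + y - int k) - y" by simp_all
    then show ?thesis using lat_add[OF _ *] lat_diff[OF _ *] by metis
  qed
  then show ?thesis unfolding on_def by simp
qed

lemma on_latI: "on u c b \<Longrightarrow> lat (c' - c) (b' - b) \<Longrightarrow> on u c' b'"
  using on_lat[of "c' - c" "b' - b" u c b] by simp

lemma on_ex: assumes "state u" shows "\<exists>b. on u c b"
proof -
  obtain k where k: "k < n" "N dvd (u k - c)" using strand_ex assms by blast
  then have "N dvd (c - u k)" by (metis dvd_diff_commute)
  then obtain y where "lat (c - u k) y" using lat_ex_right by blast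
  then have "lat (c - u k) (int k + y - int k)" by simp
  then show ?thesis unfolding on_def using k by blast
qed

lemma on_column:
  assumes "state u" "on u c b" "on u c' b'" "N dvd (c - c')"
  shows "lat (c - c') (b - b')"
proof -
  obtain k k' where k: "k < n" "lat (c - u k) (b - int k)" and k': "k' < n" "lat (c' - u k') (b' - int k')"
    using assms unfolding on_def by blast
  have "u k - u k' = (c - c') - (c - u k) + (c' - u k')" by simp
  then have "N dvd (u k - u k')" using assms(4) lat_dvd(1) k k' by (metis dvd_add dvd_diff)
  then have "k = k'" using state_inj assms(1) k k' by blast
  then show ?thesis using lat_diff[OF k(2) k'(2)] by simp
qed

lemma on_row:
  assumes "on u c b" "on u c' b'" "N dvd (b - b')"
  shows "lat (c - c') (b - b')"
proof -
  obtain k k' where k: "k < n" "lat (c - u k) (b - int k)" and k': "k' < n" "lat (c' - u k') (b' - int k')"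
    using assms unfolding on_def by blast
  have "int k - int k' = (b - b') - (b - int k) + (b' - int k')" by simp
  then have "N dvd (int k - int k')" using assms(3) lat_dvd(2) k k' by (metis dvd_add dvd_diff)
  then have "k = k'" using row_inj k k' by blast
  then show ?thesis using lat_diff[OF k(2) k'(2)] by simp
qed

lemma on_column_iff: "state u \<Longrightarrow> on u c b \<Longrightarrow> on u c b' \<longleftrightarrow> p * N dvd (b - b')"
  using on_column[of u c b c b'] on_latI[of u c b c b'] lat_vert
  by (metis cancel_comm_monoid_add_class.diff_cancel dvd_0_right dvd_diff_commute)

lemma dvd_shift: "N dvd x - c \<Longrightarrow> N dvd (x - d) \<longleftrightarrow> N dvd (c - d)" for x c d :: int
proof -
  assume *: "N dvd x - c"
  have "x - d = (x - c) + (c - d)" by simp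
  then show ?thesis using * by (metis dvd_add_right_iff)
qed

lemma col_tr_cong: "N dvd x - y \<Longrightarrow> col_tr c W x - x = col_tr c W y - y"
  unfolding col_tr_def by (simp add: dvd_shift[of x y])

lemma col_tr_involution:
  assumes W: "\<not> N dvd W" shows "col_tr c W (col_tr c W x) = x"
proof (cases "N dvd x - c")
  case True
  then have "\<not> N dvd x + W - c" using W dvd_lin[of N "x + W - c" "x - c" W 1 "-1"] by auto
  then show ?thesis using True unfolding col_tr_def by auto
next
  case False
  then show ?thesis unfolding col_tr_def by (auto simp: algebra_simps)
qed

lemma tr_tr: "\<not> N dvd W \<Longrightarrow> tr c W (tr c W u) = u"
  unfolding tr_def using col_tr_involution by auto

lemma state_tr:
  assumes "state u" shows "state (tr c W u)"
proof -
  have "N dvd x - y" if "N dvd col_tr c W x - col_tr c W y" for x y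
  proof (cases "N dvd W")
    case True
    then have "N dvd col_tr c W z - z" for z unfolding col_tr_def by auto
    then show ?thesis using that dvd_congruent by blast
  next
    case False
    have "col_tr c W (col_tr c W x) - col_tr c W x = col_tr c W (col_tr c W y) - col_tr c W y"
      by (rule col_tr_cong) (rule that)
    then have "x - y = col_tr c W x - col_tr c W y" unfolding col_tr_involution[OF False] by simp
    then show ?thesis using that by simp
  qed
  then show ?thesis using assms unfolding state_def tr_def by auto
qed

lemma tr_shift: "N dvd x \<Longrightarrow> tr (c + x) W u = tr c W u"
proof -
  assume x: "N dvd x"
  have "N dvd u k - (c + x) \<longleftrightarrow> N dvd u k - c" "N dvd u k - (c + x + W) \<longleftrightarrow> N dvd u k - (c + W)" for k
  proof -
    have "u k - c = (u k - (c + x)) + x" "u k - (c + W) = (u k - (c + x + W)) + x" by simp_all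
    then show "N dvd u k - (c + x) \<longleftrightarrow> N dvd u k - c" "N dvd u k - (c + x + W) \<longleftrightarrow> N dvd u k - (c + W)"
      using dvd_add_left_iff[OF x] by metis+
  qed
  then show ?thesis unfolding tr_alt by (intro ext) (simp only:)
qed

text \<open>The transposition exchanges the rows of the points in two columns and moves no other point. All
  computations with rectangles below use only this description.\<close>

lemma on_tr_left:
  assumes W: "\<not> N dvd W" shows "on (tr c W u) c b \<longleftrightarrow> on u (c + W) b"
proof -
  have "lat (c - tr c W u k) (b - int k) \<longleftrightarrow> lat (c + W - u k) (b - int k)" if k: "k < n" for k
  proof
    assume l: "lat (c - tr c W u k) (b - int k)"
    then have d: "N dvd c - tr c W u k" using lat_dvd by blast
    have 1: "\<not> N dvd u k - c"
    proof
      assume *: "N dvd u k - c"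
      then have "N dvd c - (u k + W)" using d k unfolding tr_alt by simp
      then show False using W * dvd_lin[of N "c - (u k + W)" "u k - c" W "-1" "-1"] by auto
    qed
    then have "tr c W u k = u k - W" using d k unfolding tr_alt by (auto split: if_splits simp: dvd_diff_commute)
    then have "c + W - u k = c - tr c W u k" by simp
    then show "lat (c + W - u k) (b - int k)" using l by (simp only:)
  next
    assume l: "lat (c + W - u k) (b - int k)"
    then have d: "N dvd u k - (c + W)" using lat_dvd dvd_diff_commute by metis
    then have 1: "\<not> N dvd u k - c" using W dvd_lin[of N "u k - (c + W)" "u k - c" W "-1" 1] by auto
    then have "tr c W u k = u k - W" using k d unfolding tr_alt by auto
    then have "c - tr c W u k = c + W - u k" by simp
    then show "lat (c - tr c W u k) (b - int k)" using l by (simp only:)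
  qed
  then show ?thesis unfolding on_def by blast
qed

lemma on_tr_right:
  assumes "\<not> N dvd W" shows "on (tr c W u) (c + W) b \<longleftrightarrow> on u c b"
  using on_tr_left[OF assms, of c "tr c W u" b] tr_tr[OF assms] by simp

lemma on_tr_other:
  assumes d: "\<not> N dvd d - c" "\<not> N dvd d - (c + W)" shows "on (tr c W u) d b \<longleftrightarrow> on u d b"
proof -
  have "lat (d - tr c W u k) (b - int k) \<longleftrightarrow> lat (d - u k) (b - int k)" if k: "k < n" for k
  proof -
    consider "N dvd u k - c" | "\<not> N dvd u k - c" "N dvd u k - (c + W)" | "tr c W u k = u k"
      unfolding tr_alt by presburger
    then show ?thesis
    proof cases
      case 1
      then have "\<not> N dvd d - u k" "\<not> N dvd d - (u k + W)"
        using d dvd_lin[of N "d - u k" "u k - c" "d - c" 1 1]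
          dvd_lin[of N "d - (u k + W)" "u k - c" "d - (c + W)" 1 1] by auto
      then show ?thesis using 1 k lat_dvd(1) unfolding tr_alt by auto
    next
      case 2
      then have "\<not> N dvd d - u k" "\<not> N dvd d - (u k - W)"
        using d dvd_lin[of N "d - u k" "u k - (c + W)" "d - (c + W)" 1 1]
          dvd_lin[of N "d - (u k - W)" "u k - (c + W)" "d - c" 1 1] by auto
      then show ?thesis using 2 k lat_dvd(1) unfolding tr_alt by auto
    qed auto
  qed
  then show ?thesis unfolding on_def by blast
qed

text \<open>The data of a rectangle from \<open>gen u\<close> to \<open>gen (tr c W u)\<close> with lower left corner \<open>(c, b)\<close>,
  width \<open>W\<close> and height \<open>H\<close>.\<close>

definition rc :: "(nat \<Rightarrow> int) \<Rightarrow> int \<Rightarrow> int \<Rightarrow> int \<Rightarrow> int \<Rightarrow> bool" where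
  "rc u c b W H \<longleftrightarrow> state u \<and> 0 < W \<and> 0 < H \<and> emb W H \<and> on u c b \<and> on u (c + W) (b + H)"

text \<open>Otherwise the two corners would be points of the generator on the same circle, hence equal, against
  the embeddedness of the rectangle.\<close>

lemma rc_not_dvd:
  assumes "rc u c b W H" shows "\<not> N dvd W" "\<not> N dvd H"
proof -
  note r = assms[unfolded rc_def]
  have e: "\<not> lat W H" using r embD[of W H W H] by auto
  show "\<not> N dvd W"
  proof
    assume "N dvd W"
    then have "lat (c + W - c) (b + H - b)" using r on_column[of u "c + W" "b + H" c b] by simp
    then show False using e by simp
  qed
  show "\<not> N dvd H"
  proof
    assume "N dvd H"
    then have "lat (c + W - c) (b + H - b)" using r on_row[of u "c + W" "b + H" c b] by simp
    then show False using e by simp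
  qed
qed

lemma ipt_alphas: "ipt a b \<in> alphas g" "ipt a b \<in> betas g"
  unfolding ipt_def using alphas_iff betas_iff by auto

lemma ipt_alpha: "ipt a b \<in> alpha g i \<longleftrightarrow> N dvd b - int i"
proof -
  have "real_of_int b = of_int (int i + N * k) \<longleftrightarrow> b - int i = N * k" for k
    unfolding of_int_eq_iff by linarith
  then show ?thesis unfolding ipt_def alpha_iff dvd_def by simp
qed

lemma ipt_beta: "ipt a b \<in> beta g i \<longleftrightarrow> N dvd a - int i"
proof -
  have "real_of_int a = of_int (int i + N * k) \<longleftrightarrow> a - int i = N * k" for k
    unfolding of_int_eq_iff by linarith
  then show ?thesis unfolding ipt_def beta_iff dvd_def by simp
qed

lemma gen_in_gens:
  assumes "state u" shows "gen u \<in> gens g"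
proof -
  have "card (gen u \<inter> alpha g i) = 1" if i: "i < n" for i
  proof -
    have "ipt (u k) (int k) \<in> alpha g i \<longleftrightarrow> k = i" if "k < n" for k
      unfolding ipt_alpha using row_inj[OF that i] by auto
    then have "gen u \<inter> alpha g i = {ipt (u i) (int i)}" using i unfolding gen_def by auto
    then show ?thesis by simp
  qed
  moreover have "card (gen u \<inter> beta g i) = 1" if i: "i < n" for i
  proof -
    obtain k where k: "k < n" "N dvd (u k - int i)" using strand_ex[OF assms] by blast
    have "ipt (u l) (int l) \<in> beta g i \<longleftrightarrow> l = k" if "l < n" for l
      unfolding ipt_beta using k state_inj[OF assms that k(1)]
        dvd_lin[of N "u l - int i" "u k - int i" "u l - u k" 1 "-1"] by auto
    then have "gen u \<inter> beta g i = {ipt (u k) (int k)}" using k unfolding gen_def by auto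
    then show ?thesis by simp
  qed
  moreover have "gen u \<subseteq> alphas g \<inter> betas g" unfolding gen_def using ipt_alphas by blast
  ultimately show ?thesis unfolding gens_def by blast
qed

text \<open>Each row of a generator carries one point; moving it by a lattice vector brings its second
  coordinate to the row number.\<close>

lemma gens_ex:
  assumes "x \<in> gens g" shows "\<exists>u. state u \<and> gen u = x"
proof -
  have sub: "x \<subseteq> alphas g \<inter> betas g" and ca: "\<And>i. i < n \<Longrightarrow> card (x \<inter> alpha g i) = 1"
    and cb: "\<And>i. i < n \<Longrightarrow> card (x \<inter> beta g i) = 1"
    using assms unfolding gens_def by auto
  have ex: "\<exists>a::int. x \<inter> alpha g i = {ipt a (int i)}" if i: "i < n" for i
  proof -
    obtain P where P: "x \<inter> alpha g i = {P}" using ca[OF i] card_1_singletonE by blast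
    then have "P \<in> alphas g" "P \<in> betas g" "P \<in> alpha g i" using sub by blast+
    moreover obtain s t where st: "P = pt s t" using \<open>P \<in> alphas g\<close> range_tor[of P]
      unfolding alphas_def alpha_def by blast
    ultimately obtain a where a: "s = of_int a" using betas_iff by (auto simp: Ints_def)
    obtain k where k: "t = of_int (int i + N * k)" using \<open>P \<in> alpha g i\<close> st alpha_iff by blast
    have P2: "P = ipt a (int i + N * k)" unfolding st a k ipt_def ..
    obtain y where "lat y (N * k)" using lat_ex_left by (metis dvd_triv_left)
    then have "P = ipt (a - y) (int i)" unfolding P2 ipt_eq by simp
    then show ?thesis using P by blast
  qed
  define u where "u = (\<lambda>i. if i < n then SOME a::int. x \<inter> alpha g i = {ipt a (int i)} else 0)"
  have u: "x \<inter> alpha g i = {ipt (u i) (int i)}" if "i < n" for i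
    using someI_ex[OF ex[OF that]] that unfolding u_def by simp
  have g: "gen u = x"
  proof
    show "gen u \<subseteq> x" unfolding gen_def using u by blast
    show "x \<subseteq> gen u"
    proof
      fix P assume "P \<in> x"
      then obtain i where "i < n" "P \<in> alpha g i" using sub unfolding alphas_def by blast
      then have "P = ipt (u i) (int i)" using u \<open>P \<in> x\<close> by blast
      then show "P \<in> gen u" unfolding gen_def using \<open>i < n\<close> by blast
    qed
  qed
  have "i = j" if ij: "i < n" "j < n" "N dvd (u i - u j)" for i j
  proof -
    obtain l m where l: "l < n" "u i = int l + N * m" using residue_ex by blast
    have "N dvd u i - int l" using l by simp
    moreover from this have "N dvd u j - int l" using dvd_lin[OF ij(3), of "u i - int l" "u j - int l" "-1" 1] by auto
    ultimately have "ipt (u i) (int i) \<in> x \<inter> beta g l" "ipt (u j) (int j) \<in> x \<inter> beta g l"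
      using u ij ipt_beta by blast+
    then have "ipt (u i) (int i) = ipt (u j) (int j)"
      using cb[OF l(1)] card_1_singletonE by (metis singletonD)
    then show "i = j" unfolding ipt_eq using row_inj ij lat_dvd(2) by blast
  qed
  then have "state u" unfolding state_def u_def by simp
  then show ?thesis using g by blast
qed

lemma gen_tr_diff:
  assumes "rc u c b W H"
  shows "gen u - gen (tr c W u) = {ipt c b, ipt (c + W) (b + H)}"
    and "gen (tr c W u) - gen u = {ipt (c + W) b, ipt c (b + H)}"
proof -
  note r = assms[unfolded rc_def] and nd = rc_not_dvd[OF assms]
  have main: "gen u - gen (tr c W u) = {ipt c b, ipt (c + W) b'}"
    if st: "state u" and on: "on u c b" "on u (c + W) b'" and bb: "\<not> N dvd b - b'" for u b b'
  proof (intro equalityI subsetI)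
    fix P assume "P \<in> gen u - gen (tr c W u)"
    then obtain d e where P: "P = ipt d e" "on u d e" "\<not> on (tr c W u) d e"
      using gen_pts on_iff by (metis DiffE)
    consider "N dvd d - c" | "N dvd d - (c + W)" using P on_tr_other by blast
    then show "P \<in> {ipt c b, ipt (c + W) b'}"
    proof cases
      case 1
      then have "P = ipt c b" using on_column[OF st P(2) on(1)] unfolding P ipt_eq by blast
      then show ?thesis by blast
    next
      case 2
      then have "P = ipt (c + W) b'" using on_column[OF st P(2) on(2)] unfolding P ipt_eq by blast
      then show ?thesis by blast
    qed
  next
    fix P assume "P \<in> {ipt c b, ipt (c + W) b'}"
    then consider "P = ipt c b" | "P = ipt (c + W) b'" by blast
    then show "P \<in> gen u - gen (tr c W u)"
    proof cases
      case 1
      have "\<not> on (tr c W u) c b" unfolding on_tr_left[OF nd(1)]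
        using on_column[OF st on(2), of "c + W" b] lat_dvd(2) bb dvd_diff_commute by (metis cancel_comm_monoid_add_class.diff_cancel dvd_0_right)
      then show ?thesis using 1 on on_iff by blast
    next
      case 2
      have "\<not> on (tr c W u) (c + W) b'" unfolding on_tr_right[OF nd(1)]
        using on_column[OF st on(1), of c b'] lat_dvd(2) bb by (metis cancel_comm_monoid_add_class.diff_cancel dvd_0_right)
      then show ?thesis using 2 on on_iff by blast
    qed
  qed
  show "gen u - gen (tr c W u) = {ipt c b, ipt (c + W) (b + H)}"
    using main r nd by simp
  show "gen (tr c W u) - gen u = {ipt (c + W) b, ipt c (b + H)}"
    using main[of "tr c W u" "b + H" b] state_tr on_tr_left[OF nd(1)] on_tr_right[OF nd(1)] tr_tr[OF nd(1)] r nd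
    by (auto simp: insert_commute)
qed

lemma segments_on_circles:
  shows "(tor \<circ> gvec g) ` ({a..a + w} \<times> {of_int b, of_int b'}) \<subseteq> alphas g"
    and "(tor \<circ> gvec g) ` ({of_int b, of_int b'} \<times> {a..a + w}) \<subseteq> betas g"
  using alphas_iff betas_iff unfolding pt_def by auto

lemma rc_is_rect:
  assumes "rc u c b W H"
  shows "is_rect g (gen u) (gen (tr c W u)) (of_int c) (of_int b) (of_int W) (of_int H)"
  unfolding is_rect_def
  using assms[unfolded rc_def] inj_pgram_iff[of W H c b] gen_tr_diff[OF assms]
    segments_on_circles(1)[of "of_int c" "of_int W" b "b + H"]
    segments_on_circles(2)[of c "c + W" "of_int b" "of_int H"]
  by (simp add: pt_def ipt_def)

lemma rc_Rect: "rc u c b W H \<Longrightarrow> box c b W H \<in> Rect g (gen u) (gen (tr c W u))"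
  unfolding Rect_def box_def using rc_is_rect by blast

text \<open>Conversely, every rectangle that starts at \<open>gen u\<close> is a transposition of the columns of \<open>u\<close>: its
  sides lie on circles, so its parameters are integers.\<close>

lemma is_rect_rc:
  assumes "state u" "y \<in> gens g" "is_rect g (gen u) y a b w h"
  shows "\<exists>c e W H. a = of_int c \<and> b = of_int e \<and> w = of_int W \<and> h = of_int H \<and> rc u c e W H \<and> y = gen (tr c W u)"
proof -
  note r = assms(3)[unfolded is_rect_def]
  have "pt a b \<in> alphas g" "pt a (b + h) \<in> alphas g" "pt a b \<in> betas g" "pt (a + w) b \<in> betas g"
    using r unfolding pt_def by force+
  then have "b \<in> \<int>" "b + h \<in> \<int>" "a \<in> \<int>" "a + w \<in> \<int>" using alphas_iff betas_iff by blast+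
  then have "h \<in> \<int>" "w \<in> \<int>" using Ints_diff by fastforce+
  then obtain c e W H where ce: "a = of_int c" "b = of_int e" "w = of_int W" "h = of_int H"
    using \<open>b \<in> \<int>\<close> \<open>a \<in> \<int>\<close> by (auto simp: Ints_def)
  have WH: "0 < W" "0 < H" using r ce by auto
  have d1: "gen u - y = {ipt c e, ipt (c + W) (e + H)}"
   and d2: "y - gen u = {ipt (c + W) e, ipt c (e + H)}"
    using r unfolding ipt_def pt_def ce by simp_all
  have e: "emb W H" using r WH inj_pgram_iff[of W H c e] unfolding ce by simp
  have "ipt c e \<in> gen u" "ipt (c + W) (e + H) \<in> gen u" using d1 by blast+
  then have rc: "rc u c e W H" unfolding rc_def on_iff using assms(1) WH e by blast
  have set_eq: "A = (B - (B - A)) \<union> (A - B)" for A B :: gen by blast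
  have "y = gen (tr c W u)"
    using set_eq[of y "gen u"] set_eq[of "gen (tr c W u)" "gen u"] gen_tr_diff[OF rc] d1 d2 by metis
  then show ?thesis using rc ce by blast
qed

text \<open>The horizontal period of the torus is \<open>p N\<close>, so this is the ambiguity of the lift of each point.\<close>

lemma gen_eq_iff:
  assumes "state u" "state v" shows "gen u = gen v \<longleftrightarrow> (\<forall>k<n. p * N dvd (u k - v k))"
proof
  assume eq: "gen u = gen v"
  show "\<forall>k<n. p * N dvd (u k - v k)"
  proof (intro allI impI)
    fix k assume k: "k < n"
    have "on u (u k) (int k)" "on v (v k) (int k)" unfolding on_def using k lat_0 by (metis diff_self)+
    then have "on u (u k) (int k)" "on u (v k) (int k)" using eq on_iff by auto
    then have "lat (u k - v k) (int k - int k)" by (rule on_row) simp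
    then show "p * N dvd (u k - v k)" using lat_horiz by simp
  qed
next
  assume *: "\<forall>k<n. p * N dvd (u k - v k)"
  have "ipt (u k) (int k) = ipt (v k) (int k)" if "k < n" for k
    unfolding ipt_eq using * that lat_horiz by simp
  then show "gen u = gen v" unfolding gen_def by simp
qed

end

section \<open>Unmoved points and marks in a rectangle\<close>

lemma card_eq_sum_of_bool: "finite K \<Longrightarrow> card {k \<in> K. P k} = (\<Sum>k\<in>K. of_bool (P k))"
  by (simp add: of_bool_def sum.If_cases Int_def)

context grid_torus
begin

abbreviation marks :: "tpoint set" where "marks \<equiv> mX g \<union> mXX g"

lemma finite_marks: "finite marks"
  using grid unfolding grid_diagram_def by blast

lemma marks_centres: "P \<in> marks \<Longrightarrow> \<exists>a b. P = pt (of_int a + 1/2) (of_int b + 1/2)"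
  using grid unfolding grid_diagram_def cell_centres_def pt_def by blast

lemma half_notin_Ints: "real_of_int a + 1/2 \<notin> \<int>"
proof
  assume "real_of_int a + 1/2 \<in> \<int>"
  then obtain c :: int where "real_of_int a + 1/2 = of_int c" by (auto simp: Ints_def)
  then have "real_of_int (2 * a + 1) = of_int (2 * c)" by simp
  then have "2 * a + 1 = 2 * c" by (simp only: of_int_eq_iff)
  then show False by presburger
qed

lemma marks_off: "marks \<subseteq> off_circles g"
proof
  fix P assume "P \<in> marks"
  then obtain a b where "P = pt (of_int a + 1/2) (of_int b + 1/2)" using marks_centres by blast
  then show "P \<in> off_circles g" using half_notin_Ints unfolding off_circles_iff by blast
qed

text \<open>Written as a sum of incidences, the number of marks depends only on the domain.\<close>

lemma card_marks: "card (marks \<inter> r) = (\<Sum>P\<in>marks. ind P r)"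
  using card_eq_sum_of_bool[OF finite_marks, of "\<lambda>P. P \<in> r"] unfolding Int_def .

text \<open>The rows of the points of \<open>u\<close> that the rectangle \<open>r\<close> does not move and that lie in \<open>r\<close>. Such
  points lie in the interior, since the circles through the corners carry no other points of the generator.\<close>

definition others :: "(nat \<Rightarrow> int) \<Rightarrow> int \<Rightarrow> int \<Rightarrow> rect \<Rightarrow> nat set" where
  "others u c W r = {k. k < n \<and> \<not> N dvd u k - c \<and> \<not> N dvd u k - (c + W) \<and> ipt (u k) (int k) \<in> r}"

lemma on_strand: "k < n \<Longrightarrow> on u (u k) (int k)"
  unfolding on_def using lat_0 by (intro exI[of _ k]) simp

definition in_cols :: "int set \<Rightarrow> int \<Rightarrow> bool" where
  "in_cols A x \<longleftrightarrow> (\<exists>a\<in>A. N dvd x - a)"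

lemma in_cols_shift: "N dvd x - y \<Longrightarrow> in_cols A x \<longleftrightarrow> in_cols A y"
  unfolding in_cols_def using dvd_shift by blast

lemma tr_in_cols:
  assumes "in_cols A c" "in_cols A (c + W)"
  shows "in_cols A (tr c W u k) \<longleftrightarrow> in_cols A (u k)" "\<not> in_cols A (u k) \<Longrightarrow> tr c W u k = u k"
proof -
  consider "N dvd u k - c" "tr c W u k = u k + W" | "N dvd u k - (c + W)" "tr c W u k = u k - W" | "tr c W u k = u k"
    unfolding tr_alt by presburger
  then show "in_cols A (tr c W u k) \<longleftrightarrow> in_cols A (u k)"
  proof cases
    case 1
    then have "N dvd tr c W u k - (c + W)" by simp
    then show ?thesis using 1 assms in_cols_shift by blast
  next
    case 2
    then have "N dvd tr c W u k - c" by (simp add: diff_diff_eq add.commute)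
    then show ?thesis using 2 assms in_cols_shift by blast
  qed simp
  show "\<not> in_cols A (u k) \<Longrightarrow> tr c W u k = u k"
    using assms in_cols_shift unfolding tr_alt by metis
qed

text \<open>The points of \<open>u\<close> in the columns \<open>A\<close> that are not corners of \<open>r\<close> do not lie in \<open>r\<close>. If \<open>A\<close>
  contains the columns of all points that two decompositions move, then the points in the other columns
  stay fixed throughout, and \<open>others\<close> counts only these (\<open>others_eq\<close>).\<close>

definition clear :: "(nat \<Rightarrow> int) \<Rightarrow> int set \<Rightarrow> int \<Rightarrow> int \<Rightarrow> rect \<Rightarrow> bool" where
  "clear u A c W r \<longleftrightarrow> (\<forall>a\<in>A. \<forall>b. \<not> N dvd a - c \<longrightarrow> \<not> N dvd a - (c + W) \<longrightarrow> on u a b \<longrightarrow> ipt a b \<notin> r)"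

lemma others_eq:
  assumes "\<And>k. \<not> in_cols A (u k) \<Longrightarrow> v k = u k" "\<And>k. in_cols A (u k) \<Longrightarrow> in_cols A (v k)"
    and "in_cols A c" "in_cols A (c + W)"
    and excl: "clear v A c W r"
  shows "others v c W r = {k. k < n \<and> \<not> in_cols A (u k) \<and> ipt (u k) (int k) \<in> r}"
proof (intro equalityI subsetI)
  fix k assume k: "k \<in> others v c W r"
  have "\<not> in_cols A (v k)"
  proof
    assume "in_cols A (v k)"
    then obtain a where a: "a \<in> A" "N dvd v k - a" unfolding in_cols_def by blast
    then have "N dvd a - v k" by (simp add: dvd_diff_commute)
    then obtain y where y: "lat (a - v k) y" using lat_ex_right by blast
    have "ipt a (int k + y) = ipt (v k) (int k)" unfolding ipt_eq using y by simp
    moreover have "on v a (int k + y)" using on_latI[OF on_strand[of k v]] k y unfolding others_def by simp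
    moreover have "\<not> N dvd a - c" "\<not> N dvd a - (c + W)" using k dvd_shift[OF a(2)] unfolding others_def by auto
    ultimately have "ipt (v k) (int k) \<notin> r" using excl a(1) unfolding clear_def by metis
    then show False using k unfolding others_def by blast
  qed
  then have "\<not> in_cols A (u k)" "v k = u k" using assms(1,2) by blast+
  then show "k \<in> {k. k < n \<and> \<not> in_cols A (u k) \<and> ipt (u k) (int k) \<in> r}" using k unfolding others_def by auto
next
  fix k assume k: "k \<in> {k. k < n \<and> \<not> in_cols A (u k) \<and> ipt (u k) (int k) \<in> r}"
  then have "v k = u k" using assms(1) by blast
  moreover have "\<not> N dvd u k - c" "\<not> N dvd u k - (c + W)" using k assms(3,4) in_cols_shift by blast+
  ultimately show "k \<in> others v c W r" using k unfolding others_def by auto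
qed

lemma gen_neqI:
  assumes "state v" "on v' a b'" "on v a b" "\<not> p * N dvd b' - b"
  shows "gen v \<noteq> gen v'"
  using assms on_iff on_column_iff[of v a b' b] by blast

text \<open>Points in different columns are different points of the generator, so they lie on different
  \<open>\<alpha>\<close> circles.\<close>

lemma on_diff_rows:
  assumes "on u c b" "on u c' b'" "\<not> N dvd c - c'" shows "\<not> N dvd b - b'" "\<not> p * N dvd b - b'"
proof -
  show 1: "\<not> N dvd b - b'" using on_row[OF assms(1,2)] lat_dvd(1) assms(3) by blast
  show "\<not> p * N dvd b - b'" using 1 dvd_mult_right by blast
qed

text \<open>Boxes of width below \<open>N\<close> are embedded up to the height \<open>p N\<close>. So any two columns at distance
  below \<open>N\<close> span a rectangle upwards from a given point.\<close>

lemma rc_ex_narrow: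
  assumes "state u" "0 < W" "W < N" "on u c b"
  shows "\<exists>H. rc u c b W H"
proof -
  obtain b2 where b2: "on u (c + W) b2" using on_ex assms(1) by blast
  define H where "H = (b2 - b) mod (p * N)"
  have pN: "p * N > 0" using p_pos N_pos by simp
  have H: "0 \<le> H" "H < p * N" unfolding H_def using pN by simp_all
  have "p * N dvd (b + H) - b2" unfolding H_def
    by (metis (no_types, opaque_lifting) add.commute add_diff_eq diff_diff_eq2 dvd_minus_mod dvd_diff_commute)
  then have on: "on u (c + W) (b + H)" using on_column_iff[OF assms(1) b2] dvd_diff_commute by blast
  have "\<not> N dvd W" using assms(2,3) zdvd_not_zless by blast
  then have "H \<noteq> 0" using on_diff_rows(1)[OF on assms(4)] by auto
  then show ?thesis unfolding rc_def using assms H on emb_narrow[of W H]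
    by (intro exI[of _ H]) auto
qed

text \<open>A translate of the point in the box has to be a vertical one, as the box is narrower than \<open>N\<close>; but the
  rows of the box miss all vertical translates.\<close>

lemma middle_not_in_box:
  assumes "state v" "on v a b0" "c < a" "a < c + W" "W < N" "e + H < b0" "b0 < e + p * N" "on v a b"
  shows "ipt a b \<notin> box c e W H"
proof
  assume "ipt a b \<in> box c e W H"
  then obtain x y where xy: "lat x y" "c \<le> a + x" "a + x \<le> c + W" "e \<le> b + y" "b + y \<le> e + H"
    unfolding ipt_def mem_box_int by blast
  have "x = 0" using dvd_small[OF lat_dvd(1)[OF xy(1)]] xy assms by linarith
  then have "p * N dvd y" using xy lat_vert by simp
  moreover have "p * N dvd b - b0" using on_column_iff assms by blast
  ultimately have "p * N dvd (b + y) - b0" using dvd_lin[of "p * N" y "b - b0" "b + y - b0" 1 1] by simp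
  then show False using dvd_small[of "p * N" "b + y - b0"] xy assms by linarith
qed

lemma outside_not_in_box:
  assumes "c + W < a + N * j" "a + N * j < c + N"
  shows "ipt a b \<notin> box c e W H"
proof
  assume "ipt a b \<in> box c e W H"
  then obtain x y where xy: "lat x y" "c \<le> a + x" "a + x \<le> c + W"
    unfolding ipt_def mem_box_int by blast
  obtain k where k: "x = N * k" using lat_dvd(1)[OF xy(1)] by blast
  have "N * k < N * j" using xy assms k by linarith
  then have "k < j" using N_pos by simp
  then have "N * (k + 1) \<le> N * j" using N_pos by (intro mult_left_mono) auto
  then show False using xy assms k by (simp add: algebra_simps)
qed

lemma clear_thin: "clear u A c 1 (box c e 1 H)"
  unfolding clear_def
proof (intro ballI allI impI notI)
  fix a b assume nd: "\<not> N dvd a - c" "\<not> N dvd a - (c + 1)" and "ipt a b \<in> box c e 1 H"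
  then obtain x y where xy: "lat x y" "c \<le> a + x" "a + x \<le> c + 1"
    unfolding ipt_def mem_box_int by blast
  then have "a - c = - x \<or> a - (c + 1) = - x" by auto
  then show False using nd lat_dvd(1)[OF xy(1)] by (metis dvd_minus_iff)
qed

lemma dvd_periodic:
  "(d::int) dvd a + j * d \<longleftrightarrow> d dvd a" "d dvd j * d + a \<longleftrightarrow> d dvd a" "d dvd j * d - a \<longleftrightarrow> d dvd a"
    "d dvd b + (a + j * d) \<longleftrightarrow> d dvd b + a"
  by (simp_all add: dvd_diff_right_iff flip: add.assoc)

lemma not_dvd_narrow: "0 < W \<Longrightarrow> W < N \<Longrightarrow> \<not> N dvd W"
  using zdvd_not_zless by blast

text \<open>The product of two transpositions on three columns has three factorizations, and so does its inverse.
  The first steps of the factorizations lead to the intermediate generators in the squares below.\<close>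

lemma col_tr_triple:
  assumes "0 < w1" "0 < w2" "w1 + w2 < N"
  shows "col_tr c (w1 + w2) (col_tr c w1 x) = col_tr c w1 (col_tr (c + w1) w2 x) \<and>
    col_tr (c + w1) w2 (col_tr c (w1 + w2) x) = col_tr c w1 (col_tr (c + w1) w2 x) \<and>
    col_tr c (w1 + w2) (col_tr (c + w1) w2 x) = col_tr (c + w1) w2 (col_tr c w1 x) \<and>
    col_tr c w1 (col_tr c (w1 + w2) x) = col_tr (c + w1) w2 (col_tr c w1 x)"
proof -
  have nd: "\<not> N dvd w1" "\<not> N dvd w2" "\<not> N dvd w1 + w2" "\<not> N dvd w2 + w1"
    using not_dvd_narrow[of w1] not_dvd_narrow[of w2] not_dvd_narrow[of "w1 + w2"] assms
    by (simp_all add: add.commute)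
  consider j where "x - c = N * j" | j where "x - (c + w1) = N * j" | j where "x - (c + (w1 + w2)) = N * j" |
    "\<not> N dvd x - c" "\<not> N dvd x - (c + w1)" "\<not> N dvd x - (c + (w1 + w2))"
    unfolding dvd_def by metis
  then show ?thesis
  proof cases
    case 1
    then have x: "x = c + N * j" by simp
    show ?thesis unfolding x col_tr_def using nd by (simp add: algebra_simps dvd_periodic)
  next
    case 2
    then have x: "x = c + w1 + N * j" by simp
    show ?thesis unfolding x col_tr_def using nd by (simp add: algebra_simps dvd_periodic)
  next
    case 3
    then have x: "x = c + (w1 + w2) + N * j" by simp
    show ?thesis unfolding x col_tr_def using nd by (simp add: algebra_simps dvd_periodic)
  next
    case 4
    then show ?thesis unfolding col_tr_def by (simp add: algebra_simps)
  qed
qed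

lemma tr_triple:
  assumes "0 < w1" "0 < w2" "w1 + w2 < N"
  shows "tr c (w1 + w2) (tr c w1 u) = tr c w1 (tr (c + w1) w2 u)"
    and "tr (c + w1) w2 (tr c (w1 + w2) u) = tr c w1 (tr (c + w1) w2 u)"
    and "tr (c + w1) w2 (tr c w1 u) = tr c (w1 + w2) (tr (c + w1) w2 u)"
    and "tr (c + w1) w2 (tr c w1 u) = tr c w1 (tr c (w1 + w2) u)"
  unfolding tr_def using col_tr_triple[OF assms, of c] by auto

lemma tr_commute:
  assumes "\<not> N dvd c - d" "\<not> N dvd c - (d + 1)" "\<not> N dvd (c + 1) - d"
  shows "tr d 1 (tr c 1 u) = tr c 1 (tr d 1 u)"
proof -
  have 1: "col_tr d 1 (col_tr c 1 x) = col_tr c 1 (col_tr d 1 x)" for x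
  proof -
    have "\<not> N dvd 1" using assms(1) by (metis dvd_trans one_dvd)
    then have unit: "\<not> N dvd y - c \<or> \<not> N dvd y - (c + 1)" for y c
      using dvd_lin[of N "y - c" "y - (c + 1)" 1 1 "-1"] by auto
    have nd: "\<not> N dvd d - c" "\<not> N dvd d - (c + 1)" "\<not> N dvd (d + 1) - c"
      using assms dvd_diff_commute by metis+
    consider j where "x - c = N * j" | j where "x - (c + 1) = N * j" |
      j where "x - d = N * j" | j where "x - (d + 1) = N * j" |
      "\<not> N dvd x - c" "\<not> N dvd x - (c + 1)" "\<not> N dvd x - d" "\<not> N dvd x - (d + 1)"
      unfolding dvd_def by metis
    then show ?thesis
    proof cases
      case 1
      then have "N dvd x - c" by simp
      then have "\<not> N dvd x - d" "\<not> N dvd x - (d + 1)" "\<not> N dvd x + 1 - d" "\<not> N dvd x + 1 - (d + 1)"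
        using assms dvd_lin[of N "x - c" "x - d" "c - d" "-1" 1] dvd_lin[of N "x - c" "x - (d + 1)" "c - (d + 1)" "-1" 1]
          dvd_lin[of N "x - c" "x + 1 - d" "c + 1 - d" "-1" 1] by auto
      then show ?thesis using \<open>N dvd x - c\<close> unfolding col_tr_def by simp
    next
      case 2
      then have *: "N dvd x - (c + 1)" by simp
      then have "\<not> N dvd x - d" "\<not> N dvd x - (d + 1)" "\<not> N dvd x - 1 - d" "\<not> N dvd x - 1 - (d + 1)"
        using assms dvd_lin[of N "x - (c + 1)" "x - d" "c + 1 - d" "-1" 1] dvd_lin[of N "x - (c + 1)" "x - (d + 1)" "c - d" "-1" 1]
          dvd_lin[of N "x - (c + 1)" "x - 1 - d" "c - d" "-1" 1] dvd_lin[of N "x - (c + 1)" "x - 1 - (d + 1)" "c - (d + 1)" "-1" 1]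
        by auto
      then show ?thesis using * unit[of x c] unfolding col_tr_def by simp
    next
      case 3
      then have "N dvd x - d" by simp
      then have "\<not> N dvd x - c" "\<not> N dvd x - (c + 1)" "\<not> N dvd x + 1 - c" "\<not> N dvd x + 1 - (c + 1)"
        using nd dvd_lin[of N "x - d" "x - c" "d - c" "-1" 1] dvd_lin[of N "x - d" "x - (c + 1)" "d - (c + 1)" "-1" 1]
          dvd_lin[of N "x - d" "x + 1 - c" "d + 1 - c" "-1" 1] by auto
      then show ?thesis using \<open>N dvd x - d\<close> unfolding col_tr_def by simp
    next
      case 4
      then have *: "N dvd x - (d + 1)" by simp
      then have "\<not> N dvd x - c" "\<not> N dvd x - (c + 1)" "\<not> N dvd x - 1 - c" "\<not> N dvd x - 1 - (c + 1)"
        using nd dvd_lin[of N "x - (d + 1)" "x - c" "d + 1 - c" "-1" 1] dvd_lin[of N "x - (d + 1)" "x - (c + 1)" "d - c" "-1" 1]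
          dvd_lin[of N "x - (d + 1)" "x - 1 - c" "d - c" "-1" 1] dvd_lin[of N "x - (d + 1)" "x - 1 - (c + 1)" "d - (c + 1)" "-1" 1]
        by auto
      then show ?thesis using * unit[of x d] unfolding col_tr_def by simp
    next
      case 5
      then show ?thesis unfolding col_tr_def by simp
    qed
  qed
  then show ?thesis unfolding tr_def by auto
qed

end

section \<open>The corrected cocycle\<close>

text \<open>The properties of the product of a true and a false sign assignment: the signs in the relation for
  two decompositions cancel, and the values on annuli multiply to \<open>-1\<close> in both directions.\<close>

locale sign_quotient = grid_torus +
  fixes Q :: "gen \<Rightarrow> gen \<Rightarrow> rect \<Rightarrow> int"
  assumes Q_unit: "x \<in> gens g \<Longrightarrow> y \<in> gens g \<Longrightarrow> r \<in> Rect g x y \<Longrightarrow> Q x y r \<in> {1, -1}"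
    and Q_square: "x \<in> gens g \<Longrightarrow> y \<in> gens g \<Longrightarrow> y' \<in> gens g \<Longrightarrow> z \<in> gens g \<Longrightarrow>
      r1 \<in> Rect g x y \<Longrightarrow> r2 \<in> Rect g y z \<Longrightarrow> r1' \<in> Rect g x y' \<Longrightarrow> r2' \<in> Rect g y' z \<Longrightarrow>
      y \<noteq> y' \<Longrightarrow> domain2 g r1 r2 = domain2 g r1' r2' \<Longrightarrow> Q x y r1 * Q y z r2 = Q x y' r1' * Q y' z r2'"
    and Q_horizontal: "x \<in> gens g \<Longrightarrow> y \<in> gens g \<Longrightarrow> r1 \<in> Rect g x y \<Longrightarrow> r2 \<in> Rect g y x \<Longrightarrow>
      horizontal_annulus g r1 r2 \<Longrightarrow> Q x y r1 * Q y x r2 = -1"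
    and Q_vertical: "x \<in> gens g \<Longrightarrow> y \<in> gens g \<Longrightarrow> r1 \<in> Rect g x y \<Longrightarrow> r2 \<in> Rect g y x \<Longrightarrow>
      vertical_annulus g r1 r2 \<Longrightarrow> Q x y r1 * Q y x r2 = -1"
begin

text \<open>The corrected cocycle. The two exponents count the \<open>X\<close> and \<open>XX\<close> marks and the points of the
  generator in the rectangle; together they give \<open>-1\<close> on annuli (\<open>omega_annulus\<close>).\<close>

definition omega :: "(nat \<Rightarrow> int) \<Rightarrow> int \<Rightarrow> int \<Rightarrow> int \<Rightarrow> int \<Rightarrow> int" where
  "omega u c b W H = Q (gen u) (gen (tr c W u)) (box c b W H) *
     (-1) ^ (card (marks \<inter> box c b W H) + card (others u c W (box c b W H)))"

lemma rc_gens: "rc u c b W H \<Longrightarrow> gen u \<in> gens g \<and> gen (tr c W u) \<in> gens g"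
  unfolding rc_def using gen_in_gens state_tr by blast

lemma omega_unit: "rc u c b W H \<Longrightarrow> omega u c b W H \<in> {1, -1}"
proof -
  assume "rc u c b W H"
  then have "Q (gen u) (gen (tr c W u)) (box c b W H) \<in> {1, -1}" using Q_unit rc_gens rc_Rect by blast
  then show ?thesis unfolding omega_def
    by (cases "even (card (marks \<inter> box c b W H) + card (others u c W (box c b W H)))") auto
qed

text \<open>Two decompositions of a domain have the same number of marks. They also contain the same number of
  unmoved points: by \<open>clear\<close> only points in columns outside \<open>A\<close> are counted, these are the same for all
  four generators, and the domain identity \<open>dom\<close> applies to them.\<close>

lemma omega_square:
  assumes r1: "rc u c1 b1 W1 H1" and r2: "rc (tr c1 W1 u) c2 b2 W2 H2"
    and r3: "rc u c3 b3 W3 H3" and r4: "rc (tr c3 W3 u) c4 b4 W4 H4"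
    and z: "tr c2 W2 (tr c1 W1 u) = tr c4 W4 (tr c3 W3 u)"
    and ne: "gen (tr c1 W1 u) \<noteq> gen (tr c3 W3 u)"
    and cols: "in_cols A c1" "in_cols A (c1 + W1)" "in_cols A c2" "in_cols A (c2 + W2)"
      "in_cols A c3" "in_cols A (c3 + W3)" "in_cols A c4" "in_cols A (c4 + W4)"
    and e: "clear u A c1 W1 (box c1 b1 W1 H1)" "clear (tr c1 W1 u) A c2 W2 (box c2 b2 W2 H2)"
      "clear u A c3 W3 (box c3 b3 W3 H3)" "clear (tr c3 W3 u) A c4 W4 (box c4 b4 W4 H4)"
    and rows: "\<And>b. b \<in> B \<Longrightarrow> \<exists>a\<in>A. on u a b"
    and dom: "\<And>s t. avoids s t A B \<Longrightarrow>
      ind (pt s t) (box c1 b1 W1 H1) + ind (pt s t) (box c2 b2 W2 H2) =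
      ind (pt s t) (box c3 b3 W3 H3) + ind (pt s t) (box c4 b4 W4 H4)"
  shows "omega u c1 b1 W1 H1 * omega (tr c1 W1 u) c2 b2 W2 H2 = omega u c3 b3 W3 H3 * omega (tr c3 W3 u) c4 b4 W4 H4"
proof -
  define B1 B2 B3 B4 where "B1 = box c1 b1 W1 H1" and "B2 = box c2 b2 W2 H2"
    and "B3 = box c3 b3 W3 H3" and "B4 = box c4 b4 W4 H4"
  note Bs = B1_def[symmetric] B2_def[symmetric] B3_def[symmetric] B4_def[symmetric]
  define K where "K = {k. k < n \<and> \<not> in_cols A (u k)}"
  have K: "finite K" unfolding K_def by simp
  \<comment> \<open>Points off the circles avoid all cuts, so the identity \<open>dom\<close> is the equality of domains.\<close>
  have off: "ind P B1 + ind P B2 = ind P B3 + ind P B4" if "P \<in> off_circles g" for P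
    using that dom avoids_non_int unfolding off_circles_iff Bs by blast
  then have "domain2 g B1 B2 = domain2 g B3 B4" unfolding domain2_def by auto
  then have Q: "Q (gen u) (gen (tr c1 W1 u)) B1 * Q (gen (tr c1 W1 u)) (gen (tr c2 W2 (tr c1 W1 u))) B2
      = Q (gen u) (gen (tr c3 W3 u)) B3 * Q (gen (tr c3 W3 u)) (gen (tr c2 W2 (tr c1 W1 u))) B4"
    using Q_square[of "gen u" "gen (tr c1 W1 u)" "gen (tr c3 W3 u)" "gen (tr c2 W2 (tr c1 W1 u))" B1 B2 B3 B4]
      rc_gens[OF r1] rc_gens[OF r2] rc_gens[OF r3] rc_Rect[OF r1] rc_Rect[OF r2] rc_Rect[OF r3] rc_Rect[OF r4] ne
    unfolding z Bs by blast
  have M: "card (marks \<inter> B1) + card (marks \<inter> B2) = card (marks \<inter> B3) + card (marks \<inter> B4)"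
    unfolding card_marks sum.distrib[symmetric] by (rule sum.cong) (use off marks_off in blast)+
  have o1: "others u c1 W1 B1 = {k \<in> K. ipt (u k) (int k) \<in> B1}"
    using others_eq[of A u u, OF _ _ cols(1,2) e(1)] unfolding K_def Bs by auto
  have o2: "others (tr c1 W1 u) c2 W2 B2 = {k \<in> K. ipt (u k) (int k) \<in> B2}"
    using others_eq[of A u "tr c1 W1 u", OF _ _ cols(3,4) e(2)] tr_in_cols[OF cols(1,2)] unfolding K_def Bs by auto
  have o3: "others u c3 W3 B3 = {k \<in> K. ipt (u k) (int k) \<in> B3}"
    using others_eq[of A u u, OF _ _ cols(5,6) e(3)] unfolding K_def Bs by auto
  have o4: "others (tr c3 W3 u) c4 W4 B4 = {k \<in> K. ipt (u k) (int k) \<in> B4}"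
    using others_eq[of A u "tr c3 W3 u", OF _ _ cols(7,8) e(4)] tr_in_cols[OF cols(5,6)] unfolding K_def Bs by auto
  have av: "avoids (of_int (u k)) (of_int (int k)) A B" if k: "k \<in> K" for k
  proof (rule avoids_int)
    show "\<not> N dvd u k - a" if "a \<in> A" for a using k that unfolding K_def in_cols_def by blast
    show "\<not> N dvd int k - b" if bB: "b \<in> B" for b
    proof
      assume d: "N dvd int k - b"
      obtain a where a: "a \<in> A" "on u a b" using rows[OF bB] by blast
      have "lat (u k - a) (int k - b)" using on_row[OF on_strand a(2) d] k unfolding K_def by blast
      then show False using lat_dvd(1) k a unfolding K_def in_cols_def by blast
    qed
  qed
  have cs: "card {k \<in> K. ipt (u k) (int k) \<in> R} = (\<Sum>k\<in>K. ind (ipt (u k) (int k)) R)" for R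
    by (rule card_eq_sum_of_bool[OF K])
  have O: "card (others u c1 W1 B1) + card (others (tr c1 W1 u) c2 W2 B2) =
      card (others u c3 W3 B3) + card (others (tr c3 W3 u) c4 W4 B4)"
    unfolding o1 o2 o3 o4 cs sum.distrib[symmetric]
    by (rule sum.cong) (use dom[OF av] in \<open>simp_all add: Bs ipt_def\<close>)
  have sgn: "(-1::int) ^ ((card (marks \<inter> B1) + card (others u c1 W1 B1)) + (card (marks \<inter> B2) + card (others (tr c1 W1 u) c2 W2 B2)))
     = (-1) ^ ((card (marks \<inter> B3) + card (others u c3 W3 B3)) + (card (marks \<inter> B4) + card (others (tr c3 W3 u) c4 W4 B4)))"
    using M O by (intro arg_cong[where f = "power (-1)"]) linarith
  have prod: "(a * s) * (b * t) = (c * x) * (d * y)" if "a * b = c * d" "s * t = x * y" for a b c d s t x y :: int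
  proof -
    have "(a * s) * (b * t) = (a * b) * (s * t)" "(c * x) * (d * y) = (c * d) * (x * y)" by (simp_all add: mult_ac)
    then show ?thesis using that by simp
  qed
  show ?thesis unfolding omega_def Bs z[symmetric]
    by (rule prod[OF Q]) (use sgn in \<open>simp only: power_add\<close>)
qed

text \<open>For width below \<open>N\<close> the two columns determine the rectangle: its lower left corner is unique up to
  the vertical period, and its height lies between \<open>0\<close> and \<open>p N\<close>.\<close>

lemma omega_narrow_unique:
  assumes r: "rc u c b W H" "rc u c b' W H'" "W < N"
  shows "omega u c b W H = omega u c b' W H'"
proof -
  note r' = r(1,2)[unfolded rc_def]
  have 1: "p * N dvd b' - b" using on_column_iff r' by blast
  have "p * N dvd (b' + H') - (b + H)" using on_column_iff r' by blast
  then have "p * N dvd H' - H" using dvd_lin[OF 1, of "(b' + H') - (b + H)" "H' - H" "-1" 1] by simp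
  moreover have "H < p * N" "H' < p * N" using emb_bounds(2)[of W H] emb_bounds(2)[of W H'] r' by linarith+
  ultimately have H: "H' = H" using dvd_small[of "p * N" "H' - H"] r' by auto
  have "box (c + 0) (b + (b' - b)) W H = box c b W H" using box_translate 1 lat_vert by blast
  then have "box c b' W H' = box c b W H" using H by simp
  then show ?thesis unfolding omega_def by simp
qed

text \<open>The value of \<open>omega\<close> on the unique rectangle between two columns at distance below \<open>N\<close>. Such a
  rectangle exists for every state (\<open>rc_ex_narrow\<close>), so \<open>eps\<close> is a function on edges of the Cayley graph of the
  affine symmetric group.\<close>

definition eps :: "(nat \<Rightarrow> int) \<Rightarrow> int \<Rightarrow> int \<Rightarrow> int" where
  "eps u c W = (let (b, H) = (SOME (b, H). rc u c b W H) in omega u c b W H)"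

lemma eps_eq: assumes "rc u c b W H" "W < N" shows "eps u c W = omega u c b W H"
proof -
  obtain b' H' where bH: "(SOME (b, H). rc u c b W H) = (b', H')" by fastforce
  have "case (SOME (b, H). rc u c b W H) of (b, H) \<Rightarrow> rc u c b W H"
    by (rule someI[of "\<lambda>(b, H). rc u c b W H" "(b, H)"]) (simp add: assms(1))
  then have r: "rc u c b' W H'" unfolding bH by simp
  have "eps u c W = omega u c b' W H'" unfolding eps_def bH by simp
  also have "\<dots> = omega u c b W H" by (rule omega_narrow_unique[OF r assms])
  finally show ?thesis .
qed

lemma eps_unit: assumes "state u" "0 < W" "W < N" shows "eps u c W \<in> {1, -1}"
proof -
  obtain b where "on u c b" using on_ex assms by blast
  then obtain H where "rc u c b W H" using rc_ex_narrow assms by blast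
  then show ?thesis using eps_eq omega_unit assms by metis
qed

lemma box_shift: "lat x y \<Longrightarrow> c' = c + x \<Longrightarrow> b' = b + y \<Longrightarrow> box c' b' W H = box c b W H"
  using box_translate by simp

lemma eps_shift:
  assumes "state u" "0 < W" "W < N" "N dvd x" shows "eps u (c + x) W = eps u c W"
proof -
  obtain b where b: "on u c b" using on_ex assms by blast
  then obtain H where H: "rc u c b W H" using rc_ex_narrow assms by blast
  obtain y where y: "lat x y" using lat_ex_right assms by blast
  have r: "rc u (c + x) (b + y) W H" using H on_lat[OF y, of u c b] on_lat[OF y, of u "c + W" "b + H"]
    unfolding rc_def by (simp add: add_ac)
  have "N dvd u k - (c + x) \<longleftrightarrow> N dvd u k - c" "N dvd u k - (c + x + W) \<longleftrightarrow> N dvd u k - (c + W)" for k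
  proof -
    have "u k - c = (u k - (c + x)) + x" "u k - (c + W) = (u k - (c + x + W)) + x" by simp_all
    then show "N dvd u k - (c + x) \<longleftrightarrow> N dvd u k - c" "N dvd u k - (c + x + W) \<longleftrightarrow> N dvd u k - (c + W)"
      using dvd_add_left_iff[OF assms(4)] by metis+
  qed
  then have "omega u (c + x) (b + y) W H = omega u c b W H"
    unfolding omega_def others_def box_translate[OF y] tr_shift[OF assms(4)] by simp
  then show ?thesis using eps_eq[OF H] eps_eq[OF r] assms by simp
qed

end

context sign_quotient
begin

section \<open>Commuting squares and L-shaped squares\<close>

lemma eps_commute:
  assumes st: "state u" and d: "\<not> N dvd c - d" "\<not> N dvd c - (d + 1)" "\<not> N dvd (c + 1) - d" and N2: "1 < N"
  shows "eps u c 1 * eps (tr c 1 u) d 1 = eps u d 1 * eps (tr d 1 u) c 1"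
proof -
  have nd: "\<not> N dvd d - c" "\<not> N dvd d - (c + 1)" "\<not> N dvd (d + 1) - c" "\<not> N dvd (c + 1) - (d + 1)" "\<not> N dvd (d + 1) - (c + 1)"
    using d dvd_diff_commute by (metis, metis, metis, simp, metis add_diff_cancel_right)
  have 1: "\<not> N dvd 1" using not_dvd_narrow N2 by simp
  obtain b where b: "on u c b" using on_ex st by blast
  obtain H where r1: "rc u c b 1 H" using rc_ex_narrow st b N2 by fastforce
  obtain e where e: "on u d e" using on_ex st by blast
  obtain K where r3: "rc u d e 1 K" using rc_ex_narrow st e N2 by fastforce
  have r2: "rc (tr c 1 u) d e 1 K" using r3 on_tr_other nd st state_tr unfolding rc_def by simp
  have r4: "rc (tr d 1 u) c b 1 H" using r1 on_tr_other d nd st state_tr unfolding rc_def by simp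
  have ne: "gen (tr c 1 u) \<noteq> gen (tr d 1 u)"
  proof (rule gen_neqI)
    show "on (tr c 1 u) c (b + H)" using on_tr_left[OF 1] r1 unfolding rc_def by simp
    show "on (tr d 1 u) c b" using on_tr_other d b by simp
    show "state (tr c 1 u)" using st state_tr by simp
    show "\<not> p * N dvd b - (b + H)" using rc_not_dvd(2)[OF r1] dvd_mult_right[of p N "b - (b + H)"] by auto
  qed
  have "omega u c b 1 H * omega (tr c 1 u) d e 1 K = omega u d e 1 K * omega (tr d 1 u) c b 1 H"
    by (rule omega_square[OF r1 r2 r3 r4 tr_commute[OF d] ne, where A = "{c, c + 1, d, d + 1}" and B = "{}"])
      (auto simp: in_cols_def clear_thin)
  then show ?thesis using eps_eq[OF r1] eps_eq[OF r2] eps_eq[OF r3] eps_eq[OF r4] N2 by simp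
qed

lemma in_cols_triple: "in_cols {c, c + w1, c + w1 + w2} c" "in_cols {c, c + w1, c + w1 + w2} (c + w1)"
  "in_cols {c, c + w1, c + w1 + w2} (c + w1 + w2)" "in_cols {c, c + w1, c + w1 + w2} (c + (w1 + w2))"
  by (auto simp: in_cols_def add.assoc)

lemma on_triple:
  assumes "0 < w1" "0 < w2" "w1 + w2 < N"
  shows "on (tr c w1 u) c b \<longleftrightarrow> on u (c + w1) b"
    "on (tr c w1 u) (c + w1) b \<longleftrightarrow> on u c b"
    "on (tr c w1 u) (c + w1 + w2) b \<longleftrightarrow> on u (c + w1 + w2) b"
    "on (tr (c + w1) w2 u) c b \<longleftrightarrow> on u c b"
    "on (tr (c + w1) w2 u) (c + w1) b \<longleftrightarrow> on u (c + w1 + w2) b"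
    "on (tr (c + w1) w2 u) (c + w1 + w2) b \<longleftrightarrow> on u (c + w1) b"
    "on (tr c (w1 + w2) u) c b \<longleftrightarrow> on u (c + w1 + w2) b"
    "on (tr c (w1 + w2) u) (c + w1) b \<longleftrightarrow> on u (c + w1) b"
    "on (tr c (w1 + w2) u) (c + w1 + w2) b \<longleftrightarrow> on u c b"
proof -
  have nd: "\<not> N dvd w1" "\<not> N dvd w2" "\<not> N dvd w1 + w2"
    using not_dvd_narrow[of w1] not_dvd_narrow[of w2] not_dvd_narrow[of "w1 + w2"] assms by simp_all
  show "on (tr c w1 u) c b \<longleftrightarrow> on u (c + w1) b" "on (tr c w1 u) (c + w1) b \<longleftrightarrow> on u c b"
    using on_tr_left on_tr_right nd by blast+
  show "on (tr (c + w1) w2 u) (c + w1) b \<longleftrightarrow> on u (c + w1 + w2) b" "on (tr (c + w1) w2 u) (c + w1 + w2) b \<longleftrightarrow> on u (c + w1) b"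
    using on_tr_left on_tr_right nd by blast+
  show "on (tr c (w1 + w2) u) c b \<longleftrightarrow> on u (c + w1 + w2) b" "on (tr c (w1 + w2) u) (c + w1 + w2) b \<longleftrightarrow> on u c b"
    using on_tr_left[OF nd(3), of c u b] on_tr_right[OF nd(3), of c u b] by (simp_all add: add.assoc)
  have nd': "\<not> N dvd c - (c + w1)" "\<not> N dvd c - (c + w1 + w2)" "\<not> N dvd (c + w1) - (c + (w1 + w2))"
    using nd dvd_minus_iff[of N w1] dvd_minus_iff[of N w2] dvd_minus_iff[of N "w1 + w2"]
    by (simp_all del: dvd_minus_iff)
  show "on (tr c w1 u) (c + w1 + w2) b \<longleftrightarrow> on u (c + w1 + w2) b"
    using on_tr_other[of "c + w1 + w2" c w1] nd by (simp add: add.assoc)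
  show "on (tr (c + w1) w2 u) c b \<longleftrightarrow> on u c b"
    using on_tr_other[of c "c + w1" w2] nd' by simp
  show "on (tr c (w1 + w2) u) (c + w1) b \<longleftrightarrow> on u (c + w1) b"
    using on_tr_other[of "c + w1" c "w1 + w2"] nd nd' by simp
qed

lemma clear_left:
  assumes "0 < w1" "0 < w2" "w1 + w2 < N" shows "clear v {c, c + w1, c + w1 + w2} c w1 (box c e w1 H)"
  unfolding clear_def using assms outside_not_in_box[of c w1 "c + w1 + w2" 0] by auto

lemma clear_right:
  assumes "0 < w1" "0 < w2" "w1 + w2 < N" shows "clear v {c, c + w1, c + w1 + w2} (c + w1) w2 (box (c + w1) e w2 H)"
  unfolding clear_def using assms outside_not_in_box[of "c + w1" w2 c 1] by auto

lemma clear_mid: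
  assumes "0 < w1" "0 < w2" "w1 + w2 < N" "state v" "on v (c + w1) b0" "e + H < b0" "b0 < e + p * N"
  shows "clear v {c, c + w1, c + w1 + w2} c (w1 + w2) (box c e (w1 + w2) H)"
  unfolding clear_def using assms middle_not_in_box[of v "c + w1" b0 c "w1 + w2" e H] by (auto simp: add.assoc)

lemma rc_narrowI:
  assumes "state u" "0 < W" "W < N" "0 < H" "H < p * N" "on u c b" "on u (c + W) (b + H)"
  shows "rc u c b W H"
  unfolding rc_def using assms emb_narrow by blast

lemma not_dvd_period: "0 < h \<Longrightarrow> h < p * N \<Longrightarrow> \<not> p * N dvd h"
  using zdvd_not_zless by blast

text \<open>In the next three lemmas the digits give the vertical order of the points in the columns
  \<open>c\<close>, \<open>c + w1\<close> and \<open>c + w1 + w2\<close>; for example \<open>132\<close> means that the middle column carries the highest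
  point. Each square comes from cutting an L-shaped domain along either of the two segments that start at
  its reentrant corner. The third point never lies in the wide rectangle.\<close>

lemma squares_123:
  assumes st: "state u" and w: "0 < w1" "0 < w2" "w1 + w2 < N" and h: "0 < h1" "0 < h2" "h1 + h2 < p * N"
    and on: "on u c b" "on u (c + w1) (b + h1)" "on u (c + w1 + w2) (b + h1 + h2)"
  shows "eps u c w1 * eps (tr c w1 u) c (w1 + w2) = eps u (c + w1) w2 * eps (tr (c + w1) w2 u) c w1" (is ?eqA)
    and "eps u c w1 * eps (tr c w1 u) (c + w1) w2 = eps u (c + w1) w2 * eps (tr (c + w1) w2 u) c (w1 + w2)" (is ?eqB)
proof -
  note ont = on_triple[OF w]
  note st' = state_tr[OF st]
  have bl: "w1 < N" "w2 < N" "h1 < p * N" "h2 < p * N" using w h by linarith+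
  have r1: "rc u c b w1 h1" by (rule rc_narrowI) (use st w h bl on in auto)
  have r2: "rc (tr c w1 u) c (b + h1) (w1 + w2) h2"
    by (rule rc_narrowI) (use st' w h bl on ont in \<open>auto simp: add.assoc[symmetric]\<close>)
  have r3: "rc u (c + w1) (b + h1) w2 h2" by (rule rc_narrowI) (use st w h bl on in auto)
  have r4: "rc (tr (c + w1) w2 u) c b w1 (h1 + h2)"
    by (rule rc_narrowI) (use st' w h bl on ont in \<open>auto simp: add.assoc[symmetric]\<close>)
  have r5: "rc (tr c w1 u) (c + w1) b w2 (h1 + h2)"
    by (rule rc_narrowI) (use st' w h bl on ont in \<open>auto simp: add.assoc[symmetric]\<close>)
  have r6: "rc (tr (c + w1) w2 u) c b (w1 + w2) h1"
    by (rule rc_narrowI) (use st' w h bl on ont in \<open>auto simp: add.assoc[symmetric]\<close>)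
  have ne: "gen (tr c w1 u) \<noteq> gen (tr (c + w1) w2 u)"
    by (rule gen_neqI[of _ _ c b "b + h1"]) (use st' ont on not_dvd_period[of h1] h bl dvd_minus_iff[of "p * N" h1] in auto)
  have e: "emb (w1 + w2) h2" "emb (w1 + w2) h1" "emb w1 (h1 + h2)" "emb w2 (h1 + h2)"
    by (rule emb_narrow; use w h bl in linarith)+
  let ?A = "{c, c + w1, c + w1 + w2}" and ?B = "{b, b + h1, b + h1 + h2}"
  have mid: "clear (tr c w1 u) {c, c + w1, c + w1 + w2} c (w1 + w2) (box c (b + h1) (w1 + w2) h2)"
    by (rule clear_mid[OF w, of _ _ "b + p * N"]) (use st' ont on h on_lat[of 0 "p * N" "u" c b] lat_vert[of "p * N"] in auto)
  have "omega u c b w1 h1 * omega (tr c w1 u) c (b + h1) (w1 + w2) h2 =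
     omega u (c + w1) (b + h1) w2 h2 * omega (tr (c + w1) w2 u) c b w1 (h1 + h2)"
  proof (rule omega_square[OF r1 r2 r3 r4 tr_triple(1)[OF w] ne in_cols_triple(1,2,1,4,2,3,1,2) clear_left[OF w] mid clear_right[OF w] clear_left[OF w]])
    show "\<exists>a\<in>?A. on u a b'" if "b' \<in> ?B" for b' using on that by auto
    show "ind (pt s t) (box c b w1 h1) + ind (pt s t) (box c (b + h1) (w1 + w2) h2) =
        ind (pt s t) (box (c + w1) (b + h1) w2 h2) + ind (pt s t) (box c b w1 (h1 + h2))" if av: "avoids s t ?A ?B" for s t
      using box_split_width[OF _ _ e(1) av, of c "b + h1"] box_split_height[OF _ _ e(3) av, of b c] w h by auto
  qed
  then show ?eqA using eps_eq[OF r1] eps_eq[OF r2] eps_eq[OF r3] eps_eq[OF r4] bl w by simp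
  have mid: "clear (tr (c + w1) w2 u) {c, c + w1, c + w1 + w2} c (w1 + w2) (box c b (w1 + w2) h1)"
    by (rule clear_mid[OF w, of _ _ "b + h1 + h2"]) (use st' ont on h in auto)
  have "omega u c b w1 h1 * omega (tr c w1 u) (c + w1) b w2 (h1 + h2) =
     omega u (c + w1) (b + h1) w2 h2 * omega (tr (c + w1) w2 u) c b (w1 + w2) h1"
  proof (rule omega_square[OF r1 r5 r3 r6 tr_triple(3)[OF w] ne in_cols_triple(1,2,2,3,2,3,1,4) clear_left[OF w] clear_right[OF w] clear_right[OF w] mid])
    show "\<exists>a\<in>?A. on u a b'" if "b' \<in> ?B" for b' using on that by auto
    show "ind (pt s t) (box c b w1 h1) + ind (pt s t) (box (c + w1) b w2 (h1 + h2)) =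
        ind (pt s t) (box (c + w1) (b + h1) w2 h2) + ind (pt s t) (box c b (w1 + w2) h1)" if av: "avoids s t ?A ?B" for s t
      using box_split_width[OF _ _ e(2) av, of c b] box_split_height[OF _ _ e(4) av, of b "c + w1"] w h by auto
  qed
  then show ?eqB using eps_eq[OF r1] eps_eq[OF r5] eps_eq[OF r3] eps_eq[OF r6] bl w by simp
qed

lemma square_132:
  assumes st: "state u" and w: "0 < w1" "0 < w2" "w1 + w2 < N" and h: "0 < h1" "0 < h2" "h1 + h2 < p * N"
    and on: "on u c b" "on u (c + w1) (b + h1 + h2)" "on u (c + w1 + w2) (b + h1)"
  shows "eps u c w1 * eps (tr c w1 u) (c + w1) w2 = eps u c (w1 + w2) * eps (tr c (w1 + w2) u) c w1"
proof -
  note ont = on_triple[OF w]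
  note st' = state_tr[OF st]
  have bl: "w1 < N" "w2 < N" "h1 < p * N" "h2 < p * N" using w h by linarith+
  have r1: "rc u c b w1 (h1 + h2)" by (rule rc_narrowI) (use st w h bl on in \<open>auto simp: add.assoc[symmetric]\<close>)
  have r2: "rc (tr c w1 u) (c + w1) b w2 h1"
    by (rule rc_narrowI) (use st' w h bl on ont in \<open>auto simp: add.assoc[symmetric]\<close>)
  have r3: "rc u c b (w1 + w2) h1" by (rule rc_narrowI) (use st w h bl on in \<open>auto simp: add.assoc[symmetric]\<close>)
  have r4: "rc (tr c (w1 + w2) u) c (b + h1) w1 h2"
    by (rule rc_narrowI) (use st' w h bl on ont in \<open>auto simp: add.assoc[symmetric]\<close>)
  have ne: "gen (tr c w1 u) \<noteq> gen (tr c (w1 + w2) u)"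
    by (rule gen_neqI[of _ _ c "b + h1" "b + h1 + h2"]) (use st' ont on not_dvd_period[of h2] h bl dvd_minus_iff[of "p * N" h2] in auto)
  have e: "emb (w1 + w2) h1" "emb w1 (h1 + h2)"
    by (rule emb_narrow; use w h bl in linarith)+
  let ?A = "{c, c + w1, c + w1 + w2}" and ?B = "{b, b + h1, b + h1 + h2}"
  have mid: "clear u {c, c + w1, c + w1 + w2} c (w1 + w2) (box c b (w1 + w2) h1)"
    by (rule clear_mid[OF w, of _ _ "b + h1 + h2"]) (use st on h in auto)
  have "omega u c b w1 (h1 + h2) * omega (tr c w1 u) (c + w1) b w2 h1 =
     omega u c b (w1 + w2) h1 * omega (tr c (w1 + w2) u) c (b + h1) w1 h2"
  proof (rule omega_square[OF r1 r2 r3 r4 tr_triple(4)[OF w] ne in_cols_triple(1,2,2,3,1,4,1,2) clear_left[OF w] clear_right[OF w] mid clear_left[OF w]])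
    show "\<exists>a\<in>?A. on u a b'" if "b' \<in> ?B" for b' using on that by auto
    show "ind (pt s t) (box c b w1 (h1 + h2)) + ind (pt s t) (box (c + w1) b w2 h1) =
        ind (pt s t) (box c b (w1 + w2) h1) + ind (pt s t) (box c (b + h1) w1 h2)" if av: "avoids s t ?A ?B" for s t
      using box_split_width[OF _ _ e(1) av, of c b] box_split_height[OF _ _ e(2) av, of b c] w h by auto
  qed
  then show ?thesis using eps_eq[OF r1] eps_eq[OF r2] eps_eq[OF r3] eps_eq[OF r4] bl w by simp
qed

lemma square_213:
  assumes st: "state u" and w: "0 < w1" "0 < w2" "w1 + w2 < N" and h: "0 < h1" "0 < h2" "h1 + h2 < p * N"
    and on: "on u c (b + h1)" "on u (c + w1) b" "on u (c + w1 + w2) (b + h1 + h2)"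
  shows "eps u (c + w1) w2 * eps (tr (c + w1) w2 u) c w1 = eps u c (w1 + w2) * eps (tr c (w1 + w2) u) (c + w1) w2"
proof -
  note ont = on_triple[OF w]
  note st' = state_tr[OF st]
  have bl: "w1 < N" "w2 < N" "h1 < p * N" "h2 < p * N" using w h by linarith+
  have r1: "rc u (c + w1) b w2 (h1 + h2)" by (rule rc_narrowI) (use st w h bl on in \<open>auto simp: add.assoc[symmetric]\<close>)
  have r2: "rc (tr (c + w1) w2 u) c (b + h1) w1 h2"
    by (rule rc_narrowI) (use st' w h bl on ont in \<open>auto simp: add.assoc[symmetric]\<close>)
  have r3: "rc u c (b + h1) (w1 + w2) h2" by (rule rc_narrowI) (use st w h bl on in \<open>auto simp: add.assoc[symmetric]\<close>)
  have r4: "rc (tr c (w1 + w2) u) (c + w1) b w2 h1"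
    by (rule rc_narrowI) (use st' w h bl on ont in \<open>auto simp: add.assoc[symmetric]\<close>)
  have ne: "gen (tr (c + w1) w2 u) \<noteq> gen (tr c (w1 + w2) u)"
    by (rule gen_neqI[of _ _ c "b + h1 + h2" "b + h1"]) (use st' ont on not_dvd_period[of h2] h bl dvd_minus_iff[of "p * N" h2] in auto)
  have e: "emb (w1 + w2) h2" "emb w2 (h1 + h2)"
    by (rule emb_narrow; use w h bl in linarith)+
  let ?A = "{c, c + w1, c + w1 + w2}" and ?B = "{b, b + h1, b + h1 + h2}"
  have mid: "clear u {c, c + w1, c + w1 + w2} c (w1 + w2) (box c (b + h1) (w1 + w2) h2)"
    by (rule clear_mid[OF w, of _ _ "b + p * N"]) (use st on h on_lat[of 0 "p * N" "u" "c + w1" b] lat_vert[of "p * N"] in auto)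
  have "omega u (c + w1) b w2 (h1 + h2) * omega (tr (c + w1) w2 u) c (b + h1) w1 h2 =
     omega u c (b + h1) (w1 + w2) h2 * omega (tr c (w1 + w2) u) (c + w1) b w2 h1"
  proof (rule omega_square[OF r1 r2 r3 r4 tr_triple(2)[OF w, symmetric] ne in_cols_triple(2,3,1,2,1,4,2,3) clear_right[OF w] clear_left[OF w] mid clear_right[OF w]])
    show "\<exists>a\<in>?A. on u a b'" if "b' \<in> ?B" for b' using on that by auto
    show "ind (pt s t) (box (c + w1) b w2 (h1 + h2)) + ind (pt s t) (box c (b + h1) w1 h2) =
        ind (pt s t) (box c (b + h1) (w1 + w2) h2) + ind (pt s t) (box (c + w1) b w2 h1)" if av: "avoids s t ?A ?B" for s t
      using box_split_width[OF _ _ e(1) av, of c "b + h1"] box_split_height[OF _ _ e(2) av, of b "c + w1"] w h by auto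
  qed
  then show ?thesis using eps_eq[OF r1] eps_eq[OF r2] eps_eq[OF r3] eps_eq[OF r4] bl w by simp
qed

section \<open>Wide rectangles\<close>

lemma col_tr_fold:
  assumes w: "\<not> N dvd w" and l: "N dvd l"
  shows "col_tr a (l + w) (col_tr a w z) = col_tr a w (col_tr (a + w) (l - w) z)"
proof -
  consider j where "z - a = N * j" | j where "z - (a + w) = N * j" | "\<not> N dvd z - a" "\<not> N dvd z - (a + w)"
    unfolding dvd_def by metis
  then show ?thesis
  proof cases
    case 1
    then have z: "N dvd z - a" by simp
    have "\<not> N dvd z + w - a" using w dvd_lin[OF z, of "z + w - a" w "-1" 1] by auto
    moreover have "N dvd z + w - (a + (l + w))" by (rule dvd_lin[OF z l, of _ 1 "-1"]) simp
    ultimately have 1: "col_tr a (l + w) (col_tr a w z) = z - l" unfolding col_tr_def using z by simp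
    have "\<not> N dvd z - (a + w)" using w dvd_lin[OF z, of "z - (a + w)" w 1 "-1"] by auto
    moreover have "N dvd z - (a + w + (l - w))" by (rule dvd_lin[OF z l, of _ 1 "-1"]) simp
    ultimately have 2: "col_tr (a + w) (l - w) z = z - (l - w)"
      unfolding col_tr_def by (simp only: if_True if_False)
    have "\<not> N dvd z - (l - w) - a" using w dvd_lin[OF dvd_diff[OF z l], of "z - (l - w) - a" w "-1" 1] by auto
    moreover have "N dvd z - (l - w) - (a + w)" by (rule dvd_lin[OF z l, of _ 1 "-1"]) simp
    ultimately show ?thesis unfolding 1 2 unfolding col_tr_def by simp
  next
    case 2
    then have z: "N dvd z - (a + w)" by simp
    have "\<not> N dvd z - a" using w dvd_lin[OF z, of "z - a" w "-1" 1] by auto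
    moreover have "N dvd z - w - a" using z by (simp add: diff_diff_eq add.commute)
    ultimately have 1: "col_tr a (l + w) (col_tr a w z) = z + l" unfolding col_tr_def using z by simp
    have 2: "col_tr (a + w) (l - w) z = z + (l - w)" unfolding col_tr_def using z by simp
    have "N dvd z + (l - w) - a" by (rule dvd_lin[OF z l, of _ 1 1]) simp
    then show ?thesis unfolding 1 2 unfolding col_tr_def by simp
  next
    case 3
    have "\<not> N dvd z - (a + (l + w))" "\<not> N dvd z - (a + l)"
      using 3 dvd_lin[OF l, of "z - (a + (l + w))" "z - (a + w)" 1 1] dvd_lin[OF l, of "z - (a + l)" "z - a" 1 1] by auto
    then show ?thesis using 3 unfolding col_tr_def by simp
  qed
qed

text \<open>Here \<open>(l1, l2)\<close> is a lattice vector, and the rectangle of width \<open>l1 + w\<close> starts at \<open>tr a w x\<close>. Embeddedness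
  of the wide rectangle bounds \<open>l2\<close> from both sides, and this makes the tall rectangles of width \<open>w\<close>
  embedded.\<close>

lemma fold_configuration:
  assumes r2: "rc (tr a w x) a b (l1 + w) H" and w: "0 < w" "w < N" and l: "lat l1 l2" "0 < l1" "0 < l2" "l2 < p * N"
    and st: "state x"
  shows "H < l2" "l2 + H < p * N" "w < l1" "on x a (b + H - l2)" "on x (a + w) b"
    "rc x a (b + H - l2) w (l2 - H)" "rc x (a + w) b (l1 - w) H"
    "rc (tr (a + w) (l1 - w) x) a (b - l2) w (H + l2)"
    "on (tr a w x) (a + w) (b + H - l2)" "on (tr (a + w) (l1 - w) x) (a + w) (b + H)"
proof -
  note r = r2[unfolded rc_def]
  have e: "emb (l1 + w) H" using r by blast
  show Hl: "H < l2" using embD[OF e l(1)] w l by linarith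
  \<comment> \<open>Both \<open>(l1, l2)\<close> and \<open>(l1, l2 - p N)\<close> are lattice vectors, and neither fits into the wide rectangle.\<close>
  have "lat l1 (l2 - p * N)" using lat_diff[OF l(1), of 0 "p * N"] lat_vert[of "p * N"] by simp
  then show Hl': "l2 + H < p * N" using embD[OF e, of l1 "l2 - p * N"] w l by linarith
  have Nl: "N dvd l1" using lat_dvd l by blast
  then show wl: "w < l1" using w l zdvd_imp_le[of N l1] by linarith
  have nd: "\<not> N dvd w" using not_dvd_narrow w by blast
  have ndl: "\<not> N dvd l1 - w" using nd dvd_diff_right_iff[OF Nl] by blast
  show xb: "on x (a + w) b" using r on_tr_left[OF nd] by blast
  have "on (tr a w x) (a + (l1 + w)) (b + H)" using r by blast
  then show y1: "on (tr a w x) (a + w) (b + H - l2)"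
    by (rule on_latI) (use lat_uminus[OF l(1)] in simp)
  then show xa: "on x a (b + H - l2)" using on_tr_right[OF nd] by blast
  show "rc x a (b + H - l2) w (l2 - H)" by (rule rc_narrowI) (use st w xa xb Hl r l in auto)
  have xl: "on x (a + l1) (b + H)" by (rule on_latI[OF xa]) (use l in simp)
  show "rc x (a + w) b (l1 - w) H" unfolding rc_def
    using st wl r xb xl emb_mono[OF e, of "l1 - w" H] w by simp
  show y'1: "on (tr (a + w) (l1 - w) x) (a + w) (b + H)" using on_tr_left[OF ndl] xl by simp
  have "on (tr (a + w) (l1 - w) x) (a + w + (l1 - w)) b" using on_tr_right[OF ndl] xb by blast
  then have "on (tr (a + w) (l1 - w) x) a (b - l2)"
    by (rule on_latI) (use lat_uminus[OF l(1)] in simp)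
  then show "rc (tr (a + w) (l1 - w) x) a (b - l2) w (H + l2)"
    by (intro rc_narrowI) (use state_tr[OF st] w r l Hl' y'1 in \<open>auto simp: add.commute\<close>)
qed

text \<open>A square that moves only two points of the generator. The union of a narrow tall rectangle \<open>T\<close> and a wide rectangle
  \<open>R\<close> of width \<open>l1 + w\<close> on its upper side also decomposes otherwise. Cut \<open>R\<close> at the columns \<open>a + w\<close> and
  \<open>a + l1\<close> into pieces of width \<open>w\<close>, \<open>l1 - w\<close> and \<open>w\<close>. The left piece extends \<open>T\<close> upwards, and the right
  piece, moved by \<open>- (l1, l2)\<close>, extends \<open>T\<close> downwards. So the wide rectangle is replaced by its
  middle piece of width \<open>l1 - w\<close>, and the other two rectangles have width \<open>w < N\<close>.\<close>

lemma omega_fold: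
  assumes r2: "rc (tr a w x) a b (l1 + w) H" and w: "0 < w" "w < N" and l: "lat l1 l2" "0 < l1" "0 < l2" "l2 < p * N"
    and st: "state x"
  shows "omega x a (b + H - l2) w (l2 - H) * omega (tr a w x) a b (l1 + w) H =
    omega x (a + w) b (l1 - w) H * omega (tr (a + w) (l1 - w) x) a (b - l2) w (H + l2)"
proof -
  note cfg = fold_configuration[OF r2 w l st]
  note r = r2[unfolded rc_def]
  have Nl: "N dvd l1" using lat_dvd l by blast
  have nd: "\<not> N dvd w" using not_dvd_narrow w by blast
  have tr_eq: "tr a (l1 + w) (tr a w x) = tr a w (tr (a + w) (l1 - w) x)"
    unfolding tr_def using col_tr_fold[OF nd Nl] by auto
  have ne: "gen (tr a w x) \<noteq> gen (tr (a + w) (l1 - w) x)"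
  proof (rule gen_neqI[OF state_tr[OF st] cfg(10,9)])
    have "b + H - (b + H - l2) = l2" by simp
    then show "\<not> p * N dvd b + H - (b + H - l2)" using not_dvd_period l by metis
  qed
  let ?A = "{a, a + w, a + l1}" and ?B = "{b + H - l2, b}"
  have cols: "in_cols ?A a" "in_cols ?A (a + w)" "in_cols ?A (a + (l1 + w))" "in_cols ?A (a + w + (l1 - w))"
    unfolding in_cols_def using Nl by auto
  have cl: "clear v ?A d w' r" if "\<And>e. e \<in> ?A \<Longrightarrow> N dvd e - d \<or> N dvd e - (d + w')" for v d w' r
    using that unfolding clear_def by blast
  show ?thesis
  proof (rule omega_square[OF cfg(6) r2 cfg(7,8) tr_eq ne cols(1,2,1,3,2,4,1,2)])
    show "clear x ?A a w (box a (b + H - l2) w (l2 - H))" "clear (tr a w x) ?A a (l1 + w) (box a b (l1 + w) H)"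
      "clear x ?A (a + w) (l1 - w) (box (a + w) b (l1 - w) H)"
      "clear (tr (a + w) (l1 - w) x) ?A a w (box a (b - l2) w (H + l2))" by (rule cl; use Nl in auto)+
    show "\<exists>a\<in>?A. on x a b'" if "b' \<in> ?B" for b' using that cfg(4,5) by blast
    show "ind (pt s t) (box a (b + H - l2) w (l2 - H)) + ind (pt s t) (box a b (l1 + w) H) =
       ind (pt s t) (box (a + w) b (l1 - w) H) + ind (pt s t) (box a (b - l2) w (H + l2))" if av: "avoids s t ?A ?B" for s t
    proof -
      have e1: "emb (w + l1) H" using r by (simp add: add.commute)
      have e2: "emb ((l1 - w) + w) H" using emb_mono[OF e1] w by simp
      have e3: "emb w (H + l2)" "emb w ((l2 - H) + H)" using emb_narrow w cfg(1,2) r l by auto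
      have "ind (pt s t) (box a b (w + l1) H) = ind (pt s t) (box a b w H) + ind (pt s t) (box (a + w) b l1 H)"
        by (rule box_split_width[OF _ _ e1 av]) (use w l in auto)
      moreover have "ind (pt s t) (box (a + w) b ((l1 - w) + w) H) =
          ind (pt s t) (box (a + w) b (l1 - w) H) + ind (pt s t) (box (a + w + (l1 - w)) b w H)"
        by (rule box_split_width[OF _ _ e2 av]) (use w cfg in auto)
      moreover have "box (a + w + (l1 - w)) b w H = box a (b - l2) w H"
        by (rule box_shift[OF l(1)]) auto
      moreover have "ind (pt s t) (box a (b - l2) w (H + l2)) =
          ind (pt s t) (box a (b - l2) w H) + ind (pt s t) (box a (b - l2 + H) w l2)"
        by (rule box_split_height[OF _ _ e3(1) av]) (use r l in auto)
      moreover have "ind (pt s t) (box a (b + H - l2) w ((l2 - H) + H)) =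
          ind (pt s t) (box a (b + H - l2) w (l2 - H)) + ind (pt s t) (box a (b + H - l2 + (l2 - H)) w H)"
        by (rule box_split_height[OF _ _ e3(2) av]) (use r cfg in auto)
      ultimately show ?thesis by (simp add: add_ac algebra_simps)
    qed
  qed
qed

text \<open>The two rectangles of a horizontal annulus of length \<open>l\<close> shift the two columns involved in
  opposite directions.\<close>

lemma col_tr_round:
  assumes w: "\<not> N dvd w" and l: "N dvd l"
  shows "col_tr (a + w) (l - w) (col_tr a w z) = (if N dvd z - a then z + l else if N dvd z - (a + w) then z - l else z)"
proof -
  consider (left) "N dvd z - a" | (right) "\<not> N dvd z - a" "N dvd z - (a + w)" | (other) "\<not> N dvd z - a" "\<not> N dvd z - (a + w)" by blast
  then show ?thesis
  proof cases
    case left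
    then show ?thesis unfolding col_tr_def by simp
  next
    case right
    have "\<not> N dvd z - w - (a + w)" using w dvd_lin[OF right(2), of "z - w - (a + w)" w 1 "-1"] by auto
    moreover have "N dvd z - w - (a + w + (l - w))" by (rule dvd_lin[OF right(2) l, of _ 1 "-1"]) simp
    ultimately show ?thesis using right unfolding col_tr_def by simp
  next
    case other
    have "\<not> N dvd z - (a + w + (l - w))" using other dvd_lin[OF l, of "z - (a + w + (l - w))" "z - a" 1 1] by auto
    then show ?thesis using other unfolding col_tr_def by simp
  qed
qed

end

context grid_torus
begin

section \<open>Annuli\<close>

lemma pt_surj: "tor (x, y) = pt (p * real n * x + q * real n * y) (real n * y)"
proof -
  have "real n > 0" "real_of_int p > 0" using N_pos p_pos by simp_all
  then have "gvec g (p * real n * x + q * real n * y, real n * y) = (x, y)"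
    by (simp add: gvec_def field_simps)
  then show ?thesis unfolding pt_def by simp
qed

definition vstrip :: "int \<Rightarrow> int \<Rightarrow> tpoint set" where
  "vstrip c W = {pt s t | s t. of_int c \<le> s \<and> s \<le> of_int (c + W)}"

definition hstrip :: "int \<Rightarrow> int \<Rightarrow> tpoint set" where
  "hstrip b H = {pt s t | s t. of_int b \<le> t \<and> t \<le> of_int (b + H)}"

lemma mem_vstrip: "pt s t \<in> vstrip c W \<longleftrightarrow>
  (\<exists>x y. lat x y \<and> of_int c \<le> s + of_int x \<and> s + of_int x \<le> of_int (c + W))"
proof
  assume "pt s t \<in> vstrip c W"
  then obtain s' t' where st: "pt s' t' = pt s t" "of_int c \<le> s'" "s' \<le> of_int (c + W)"
    unfolding vstrip_def by (smt (verit) mem_Collect_eq)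
  then obtain x y where "lat x y" "s' - s = of_int x" unfolding pt_eq_iff by blast
  moreover from this have "s + of_int x = s'" by simp
  ultimately show "\<exists>x y. lat x y \<and> of_int c \<le> s + of_int x \<and> s + of_int x \<le> of_int (c + W)"
    using st by metis
next
  assume "\<exists>x y. lat x y \<and> of_int c \<le> s + of_int x \<and> s + of_int x \<le> of_int (c + W)"
  then obtain x y where xy: "lat x y" "of_int c \<le> s + of_int x" "s + of_int x \<le> of_int (c + W)" by blast
  have "pt s t = pt (s + of_int x) (t + of_int y)" unfolding pt_eq_iff
    by (rule exI[of _ "- x"], rule exI[of _ "- y"]) (use lat_uminus[OF xy(1)] in simp)
  then show "pt s t \<in> vstrip c W" unfolding vstrip_def using xy by blast
qed

lemma mem_hstrip: "pt s t \<in> hstrip b H \<longleftrightarrow>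
  (\<exists>x y. lat x y \<and> of_int b \<le> t + of_int y \<and> t + of_int y \<le> of_int (b + H))"
proof
  assume "pt s t \<in> hstrip b H"
  then obtain s' t' where st: "pt s' t' = pt s t" "of_int b \<le> t'" "t' \<le> of_int (b + H)"
    unfolding hstrip_def by (smt (verit) mem_Collect_eq)
  then obtain x y where "lat x y" "t' - t = of_int y" unfolding pt_eq_iff by blast
  moreover from this have "t + of_int y = t'" by simp
  ultimately show "\<exists>x y. lat x y \<and> of_int b \<le> t + of_int y \<and> t + of_int y \<le> of_int (b + H)"
    using st by metis
next
  assume "\<exists>x y. lat x y \<and> of_int b \<le> t + of_int y \<and> t + of_int y \<le> of_int (b + H)"
  then obtain x y where xy: "lat x y" "of_int b \<le> t + of_int y" "t + of_int y \<le> of_int (b + H)" by blast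
  have "pt s t = pt (s + of_int x) (t + of_int y)" unfolding pt_eq_iff
    by (rule exI[of _ "- x"], rule exI[of _ "- y"]) (use lat_uminus[OF xy(1)] in simp)
  then show "pt s t \<in> hstrip b H" unfolding hstrip_def using xy by blast
qed

lemma vertical_annulusI:
  assumes "0 < W" "W < N" and "\<And>P. P \<in> off_circles g \<Longrightarrow> ind P r1 + ind P r2 = ind P (vstrip c W)"
  shows "vertical_annulus g r1 r2"
proof -
  have pos: "real n > 0" "real_of_int p > 0" using N_pos p_pos by simp_all
  let ?c = "real_of_int c / (p * real n)" and ?d = "real_of_int (c + W) / (p * real n)"
  have line: "tor ` {(x, y). x = real_of_int e / (p * real n) - lq g / lp g * y} \<subseteq> betas g" for e
  proof
    fix P assume "P \<in> tor ` {(x, y). x = real_of_int e / (p * real n) - lq g / lp g * y}"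
    then obtain y where P: "P = tor (real_of_int e / (p * real n) - lq g / lp g * y, y)" by auto
    have "p * real n * (real_of_int e / (p * real n) - lq g / lp g * y) + q * real n * y = of_int e"
      using pos by (simp add: field_simps)
    then show "P \<in> betas g" unfolding P pt_surj betas_iff by simp
  qed
  have strip: "tor ` {(x, y). ?c - lq g / lp g * y \<le> x \<and> x \<le> ?d - lq g / lp g * y} = vstrip c W"
  proof (intro equalityI subsetI)
    fix P assume "P \<in> tor ` {(x, y). ?c - lq g / lp g * y \<le> x \<and> x \<le> ?d - lq g / lp g * y}"
    then obtain x y where P: "P = tor (x, y)" "?c - lq g / lp g * y \<le> x" "x \<le> ?d - lq g / lp g * y" by auto
    have "p * real n * (real_of_int e / (p * real n) - lq g / lp g * y) = of_int e - q * real n * y" for e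
      using pos by (simp add: field_simps)
    note scaled = mult_left_mono[OF P(2), of "p * real n", unfolded this] mult_left_mono[OF P(3), of "p * real n", unfolded this]
    have "0 \<le> p * real n" using pos by simp
    then have "of_int c \<le> p * real n * x + q * real n * y" "p * real n * x + q * real n * y \<le> of_int (c + W)"
      using scaled by linarith+
    then show "P \<in> vstrip c W" unfolding P(1) pt_surj vstrip_def by blast
  next
    fix P assume "P \<in> vstrip c W"
    then obtain s t where P: "P = pt s t" "of_int c \<le> s" "s \<le> of_int (c + W)" unfolding vstrip_def by blast
    let ?x = "s / (p * real n) - t * q / (p * real n)" and ?y = "t / real n"
    have "P = tor (?x, ?y)" unfolding P(1) pt_def gvec_def by simp
    moreover have "real_of_int e / (p * real n) - lq g / lp g * ?y = (e - t * q) / (p * real n)" for e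
      using pos by (simp add: field_simps)
    moreover have "?x = (s - t * q) / (p * real n)" by (simp add: diff_divide_distrib)
    moreover have "(c - t * q) / (p * real n) \<le> (s - t * q) / (p * real n)"
      "(s - t * q) / (p * real n) \<le> (real_of_int (c + W) - t * q) / (p * real n)"
      using P pos by (auto intro!: divide_right_mono)
    ultimately have "P = tor (?x, ?y)" "?c - lq g / lp g * ?y \<le> ?x" "?x \<le> ?d - lq g / lp g * ?y" by (simp_all only:)
    then show "P \<in> tor ` {(x, y). ?c - lq g / lp g * y \<le> x \<and> x \<le> ?d - lq g / lp g * y}" by blast
  qed
  have "?c < ?d" using assms(1) pos by (simp add: divide_strict_right_mono)
  moreover have "?d < ?c + 1 / lp g"
  proof -
    have "real_of_int W < real n" using assms(2) by (metis of_int_less_iff of_int_of_nat_eq)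
    then show ?thesis using pos by (simp add: field_simps)
  qed
  moreover have "is_annulus g r1 r2 (vstrip c W)" unfolding is_annulus_def domain2_def using assms(3) by simp
  ultimately show ?thesis unfolding vertical_annulus_def
    by (intro exI[of _ ?c] exI[of _ ?d] conjI line) (simp_all only: strip)
qed

lemma horizontal_annulusI:
  assumes "0 < H" "H < N" and "\<And>P. P \<in> off_circles g \<Longrightarrow> ind P r1 + ind P r2 = ind P (hstrip b H)"
  shows "horizontal_annulus g r1 r2"
proof -
  have pos: "real n > 0" "real_of_int p > 0" using N_pos p_pos by simp_all
  let ?c = "real_of_int b / real n" and ?d = "real_of_int (b + H) / real n"
  have line: "tor ` {(x, y). y = real_of_int e / real n} \<subseteq> alphas g" for e
  proof
    fix P assume "P \<in> tor ` {(x, y). y = real_of_int e / real n}"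
    then obtain x where P: "P = tor (x, real_of_int e / real n)" by auto
    show "P \<in> alphas g" unfolding P pt_surj alphas_iff using pos by simp
  qed
  have strip: "tor ` {(x, y). ?c \<le> y \<and> y \<le> ?d} = hstrip b H"
  proof (intro equalityI subsetI)
    fix P assume "P \<in> tor ` {(x, y). ?c \<le> y \<and> y \<le> ?d}"
    then obtain x y where P: "P = tor (x, y)" "?c \<le> y" "y \<le> ?d" by auto
    have "of_int b \<le> real n * y" "real n * y \<le> of_int (b + H)"
      using P pos by (simp_all add: field_simps)
    then show "P \<in> hstrip b H" unfolding P(1) pt_surj hstrip_def by blast
  next
    fix P assume "P \<in> hstrip b H"
    then obtain s t where P: "P = pt s t" "of_int b \<le> t" "t \<le> of_int (b + H)" unfolding hstrip_def by blast
    let ?x = "s / (p * real n) - t * q / (p * real n)" and ?y = "t / real n"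
    have "P = tor (?x, ?y)" unfolding P(1) pt_def gvec_def by simp
    moreover have "?c \<le> ?y" "?y \<le> ?d" using P pos by (simp_all add: divide_right_mono)
    ultimately show "P \<in> tor ` {(x, y). ?c \<le> y \<and> y \<le> ?d}" by blast
  qed
  have "?c < ?d" using assms(1) pos by (simp add: divide_strict_right_mono)
  moreover have "?d < ?c + 1"
  proof -
    have "real_of_int H < real n" using assms(2) by (metis of_int_less_iff of_int_of_nat_eq)
    then show ?thesis using pos by (simp add: field_simps)
  qed
  moreover have "is_annulus g r1 r2 (hstrip b H)" unfolding is_annulus_def domain2_def using assms(3) by simp
  ultimately show ?thesis unfolding horizontal_annulus_def
    by (intro exI[of _ ?c] exI[of _ ?d] conjI line) (simp_all only: strip)
qed

text \<open>Every point of the strip has a lift in the \<open>W\<close> by \<open>p N\<close> box formed by the two rectangles, obtained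
  by a vertical translation, and this lift is unique off the horizontal sides.\<close>

lemma vertical_annulus_ind:
  assumes "0 < W" "W < N" "0 < H" "H < p * N" "avoids s t A {b, b + H}"
  shows "ind (pt s t) (box c b W H) + ind (pt s t) (box c (b + H) W (p * N - H)) = ind (pt s t) (vstrip c W)"
proof -
  have cut: "t + of_int y \<noteq> of_int b" "t + of_int y \<noteq> of_int (b + H)" if "lat x y" for x y
    using assms(5) that unfolding avoids_def by blast+
  have pN: "p * N > 0" using p_pos N_pos by simp
  have disj: "\<not> (pt s t \<in> box c b W H \<and> pt s t \<in> box c (b + H) W (p * N - H))"
  proof
    assume "pt s t \<in> box c b W H \<and> pt s t \<in> box c (b + H) W (p * N - H)"
    then obtain x y x' y' where 1: "lat x y" "of_int c \<le> s + of_int x" "s + of_int x \<le> of_int (c + W)"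
        "of_int b \<le> t + of_int y" "t + of_int y \<le> of_int (b + H)"
      and 2: "lat x' y'" "of_int c \<le> s + of_int x'" "s + of_int x' \<le> of_int (c + W)"
        "of_int (b + H) \<le> t + of_int y'" "t + of_int y' \<le> of_int (b + H + (p * N - H))"
      unfolding mem_box by blast
    have l: "lat (x' - x) (y' - y)" using lat_diff 1 2 by blast
    have "real_of_int \<bar>x' - x\<bar> \<le> of_int W" using 1 2 by auto
    then have "x' - x = 0" using dvd_small[OF lat_dvd(1)[OF l]] assms(2) by linarith
    then have d: "p * N dvd y' - y" using l lat_vert by simp
    have c2: "t + of_int y' \<noteq> of_int (b + H)" "t + of_int y \<noteq> of_int b" using cut 1 2 by blast+
    have c3: "t + of_int y \<noteq> of_int (b + H)" using cut 1 by blast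
    have "real_of_int y < of_int y'" using 1 2 c2 by linarith
    then have "0 < y' - y" by simp
    moreover have "real_of_int y' - of_int y < of_int (p * N)" using 1 2 c2 by simp
    then have "y' - y < p * N" by linarith
    ultimately show False using zdvd_not_zless d by blast
  qed
  have "pt s t \<in> box c b W H \<or> pt s t \<in> box c (b + H) W (p * N - H)" if strip: "pt s t \<in> vstrip c W"
  proof -
    obtain x y where 1: "lat x y" "of_int c \<le> s + of_int x" "s + of_int x \<le> of_int (c + W)"
      using strip unfolding mem_vstrip by blast
    define k where "k = \<lfloor>(t + of_int y - of_int b) / of_int (p * N)\<rfloor>"
    have kk: "of_int k \<le> (t + of_int y - of_int b) / of_int (p * N)"
      "(t + of_int y - of_int b) / of_int (p * N) < of_int k + 1" unfolding k_def by linarith+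
    have pr: "real_of_int (p * N) > 0" using pN by linarith
    \<comment> \<open>The translate of the point into the fundamental window that starts at the row \<open>b\<close>.\<close>
    define y2 where "y2 = y - p * N * k"
    have l2: "lat x y2" unfolding y2_def using lat_diff[OF 1(1), of 0 "p * N * k"] lat_vert[of "p * N * k"] by simp
    have "of_int k * real_of_int (p * N) \<le> t + of_int y - of_int b" using kk(1) pr by (simp add: pos_le_divide_eq)
    moreover have "t + of_int y - of_int b < (of_int k + 1) * real_of_int (p * N)" using kk(2) pr by (simp only: pos_divide_less_eq)
    ultimately have "of_int b \<le> t + of_int y2" "t + of_int y2 \<le> of_int (b + p * N)"
      unfolding y2_def by (simp_all add: algebra_simps)
    then show ?thesis
    proof (cases "t + of_int y2 \<le> of_int (b + H)")
      case True
      show ?thesis unfolding mem_box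
        by (rule disjI1, rule exI[of _ x], rule exI[of _ y2]) (use True 1 l2 \<open>of_int b \<le> t + of_int y2\<close> in simp)
    next
      case False
      show ?thesis unfolding mem_box
        by (rule disjI2, rule exI[of _ x], rule exI[of _ y2]) (use False 1 l2 \<open>t + of_int y2 \<le> of_int (b + p * N)\<close> in simp)
    qed
  qed
  moreover have "pt s t \<in> vstrip c W" if "pt s t \<in> box c b W H \<or> pt s t \<in> box c (b + H) W (p * N - H)"
    using that unfolding mem_box mem_vstrip by blast
  ultimately show ?thesis using disj by auto
qed

lemma horizontal_annulus_ind:
  assumes "0 < H" "H < N" "0 < W" "W < p * N" "avoids s t {c, c + W} B"
  shows "ind (pt s t) (box c b W H) + ind (pt s t) (box (c + W) b (p * N - W) H) = ind (pt s t) (hstrip b H)"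
proof -
  have cut: "s + of_int x \<noteq> of_int c" "s + of_int x \<noteq> of_int (c + W)" if "lat x y" for x y
    using assms(5) that unfolding avoids_def by blast+
  have pN: "p * N > 0" using p_pos N_pos by simp
  have disj: "\<not> (pt s t \<in> box c b W H \<and> pt s t \<in> box (c + W) b (p * N - W) H)"
  proof
    assume "pt s t \<in> box c b W H \<and> pt s t \<in> box (c + W) b (p * N - W) H"
    then obtain x y x' y' where 1: "lat x y" "of_int c \<le> s + of_int x" "s + of_int x \<le> of_int (c + W)"
        "of_int b \<le> t + of_int y" "t + of_int y \<le> of_int (b + H)"
      and 2: "lat x' y'" "of_int (c + W) \<le> s + of_int x'" "s + of_int x' \<le> of_int (c + W + (p * N - W))"
        "of_int b \<le> t + of_int y'" "t + of_int y' \<le> of_int (b + H)"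
      unfolding mem_box by blast
    have l: "lat (x' - x) (y' - y)" using lat_diff 1 2 by blast
    have "real_of_int \<bar>y' - y\<bar> \<le> of_int H" using 1 2 by auto
    then have "y' - y = 0" using dvd_small[OF lat_dvd(2)[OF l]] assms(2) by linarith
    then have d: "p * N dvd x' - x" using l lat_horiz by simp
    have c2: "s + of_int x' \<noteq> of_int (c + W)" "s + of_int x \<noteq> of_int c" using cut 1 2 by blast+
    have "real_of_int x < of_int x'" using 1 2 c2 by linarith
    then have "0 < x' - x" by simp
    moreover have "real_of_int x' - of_int x < of_int (p * N)" using 1 2 c2 by simp
    then have "x' - x < p * N" by linarith
    ultimately show False using zdvd_not_zless d by blast
  qed
  have "pt s t \<in> box c b W H \<or> pt s t \<in> box (c + W) b (p * N - W) H" if strip: "pt s t \<in> hstrip b H"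
  proof -
    obtain x y where 1: "lat x y" "of_int b \<le> t + of_int y" "t + of_int y \<le> of_int (b + H)"
      using strip unfolding mem_hstrip by blast
    define k where "k = \<lfloor>(s + of_int x - of_int c) / of_int (p * N)\<rfloor>"
    have kk: "of_int k \<le> (s + of_int x - of_int c) / of_int (p * N)"
      "(s + of_int x - of_int c) / of_int (p * N) < of_int k + 1" unfolding k_def by linarith+
    have pr: "real_of_int (p * N) > 0" using pN by linarith
    \<comment> \<open>The translate of the point into the fundamental window that starts at the column \<open>c\<close>.\<close>
    define x2 where "x2 = x - p * N * k"
    have l2: "lat x2 y" unfolding x2_def using lat_diff[OF 1(1), of "p * N * k" 0] lat_horiz[of "p * N * k"] by simp
    have "of_int k * real_of_int (p * N) \<le> s + of_int x - of_int c" using kk(1) pr by (simp add: pos_le_divide_eq)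
    moreover have "s + of_int x - of_int c < (of_int k + 1) * real_of_int (p * N)" using kk(2) pr by (simp only: pos_divide_less_eq)
    ultimately have "of_int c \<le> s + of_int x2" "s + of_int x2 \<le> of_int (c + p * N)"
      unfolding x2_def by (simp_all add: algebra_simps)
    then show ?thesis
    proof (cases "s + of_int x2 \<le> of_int (c + W)")
      case True
      show ?thesis unfolding mem_box
        by (rule disjI1, rule exI[of _ x2], rule exI[of _ y]) (use True 1 l2 \<open>of_int c \<le> s + of_int x2\<close> in simp)
    next
      case False
      show ?thesis unfolding mem_box
        by (rule disjI2, rule exI[of _ x2], rule exI[of _ y]) (use False 1 l2 \<open>s + of_int x2 \<le> of_int (c + p * N)\<close> in simp)
    qed
  qed
  moreover have "pt s t \<in> hstrip b H" if "pt s t \<in> box c b W H \<or> pt s t \<in> box (c + W) b (p * N - W) H"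
    using that unfolding mem_box mem_hstrip by blast
  ultimately show ?thesis using disj by auto
qed

text \<open>The residues of \<open>f k - c\<close> run through \<open>0, \<dots>, N - 1\<close>, and the condition selects those strictly
  between \<open>0\<close> and \<open>W\<close>. It is used with the columns and with the rows of the points of a state.\<close>

lemma card_window:
  assumes inj: "\<And>i j. i < n \<Longrightarrow> j < n \<Longrightarrow> N dvd f i - f j \<Longrightarrow> i = j" and W: "0 < W" "W < N"
  shows "card {k. k < n \<and> \<not> N dvd f k - c \<and> \<not> N dvd f k - (c + W) \<and>
     (\<exists>x. N dvd x \<and> c \<le> f k + x \<and> f k + x \<le> c + W)} = nat (W - 1)" (is "card ?S = _")
proof -
  define \<phi> where "\<phi> k = (f k - c) mod N" for k
  have injphi: "inj_on \<phi> {..<n}"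
  proof (rule inj_onI)
    fix i j assume "i \<in> {..<n}" "j \<in> {..<n}" "\<phi> i = \<phi> j"
    then have "N dvd (f i - c) - (f j - c)" unfolding \<phi>_def using mod_eq_dvd_iff by blast
    then show "i = j" using inj \<open>i \<in> _\<close> \<open>j \<in> _\<close> by simp
  qed
  have "\<phi> ` {..<n} \<subseteq> {0..<N}" unfolding \<phi>_def using N_pos by auto
  moreover have "card (\<phi> ` {..<n}) = card {0..<N}" using injphi by (simp add: card_image)
  ultimately have img: "\<phi> ` {..<n} = {0..<N}" by (intro card_subset_eq) auto
  have "?S = {k \<in> {..<n}. \<phi> k \<in> {1..<W}}"
  proof (intro equalityI subsetI)
    fix k assume k: "k \<in> ?S"
    then obtain x where x: "N dvd x" "c \<le> f k + x" "f k + x \<le> c + W" by blast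
    have "\<phi> k = (f k + x - c) mod N" unfolding \<phi>_def mod_eq_dvd_iff using x(1) by (simp add: dvd_diff_commute)
    also have "\<dots> = f k + x - c" using x W by (intro mod_pos_pos_trivial) auto
    finally have phi: "\<phi> k = f k + x - c" .
    have "f k + x - c \<noteq> 0" "f k + x - c \<noteq> W"
    proof -
      show "f k + x - c \<noteq> 0"
      proof
        assume "f k + x - c = 0"
        then have "f k - c = - x" by simp
        then show False using k x(1) by simp
      qed
      show "f k + x - c \<noteq> W"
      proof
        assume "f k + x - c = W"
        then have "f k - (c + W) = - x" by simp
        then show False using k x(1) by simp
      qed
    qed
    then show "k \<in> {k \<in> {..<n}. \<phi> k \<in> {1..<W}}" using k x phi by auto
  next
    fix k assume k: "k \<in> {k \<in> {..<n}. \<phi> k \<in> {1..<W}}"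
    define x where "x = - (N * ((f k - c) div N))"
    have x: "N dvd x" "f k + x = c + \<phi> k" unfolding x_def \<phi>_def by (simp_all add: minus_mult_div_eq_mod[symmetric])
    have "\<not> N dvd f k - c" using k unfolding \<phi>_def by (auto simp: dvd_eq_mod_eq_0)
    moreover have "\<not> N dvd f k - (c + W)"
    proof
      assume "N dvd f k - (c + W)"
      then have "N dvd (f k - c) - W" by (simp add: algebra_simps)
      then have "\<phi> k = W mod N" unfolding \<phi>_def mod_eq_dvd_iff .
      then show False using k W by simp
    qed
    moreover have "c \<le> f k + x" "f k + x \<le> c + W" using k x(2) by auto
    ultimately show "k \<in> ?S" using k x(1) by blast
  qed
  moreover have "\<phi> ` {k \<in> {..<n}. \<phi> k \<in> {1..<W}} = {1..<W}"
  proof (intro equalityI subsetI)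
    fix d assume d: "d \<in> {1..<W}"
    then have "d \<in> \<phi> ` {..<n}" unfolding img using W by auto
    then show "d \<in> \<phi> ` {k \<in> {..<n}. \<phi> k \<in> {1..<W}}" using d by auto
  qed auto
  moreover have "inj_on \<phi> {k \<in> {..<n}. \<phi> k \<in> {1..<W}}" using injphi by (rule inj_on_subset) auto
  ultimately have "card ?S = card {1..<W}" using card_image[of \<phi> "{k \<in> {..<n}. \<phi> k \<in> {1..<W}}"] by (simp only:)
  then show ?thesis by simp
qed

lemma mark_in_column: "pt (of_int a + 1/2) (of_int b + 1/2) \<in> gcolumn g i \<longleftrightarrow> N dvd a - int i"
proof -
  have pos: "real n > 0" "real_of_int p > 0" using N_pos p_pos by simp_all
  have scale: "p * real n * (real_of_int e / (p * real n) - lq g / lp g * y) = of_int e - q * real n * y" for e y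
    using pos by (simp add: field_simps)
  have pn: "0 < p * real n" using pos by simp
  show ?thesis
  proof
    assume "pt (of_int a + 1/2) (of_int b + 1/2) \<in> gcolumn g i"
    then obtain x y where P: "pt (of_int a + 1/2) (of_int b + 1/2) = tor (x, y)"
      "real_of_int (int i) / (real_of_int p * real n) - lq g / lp g * y < x"
      "x < real_of_int (int i + 1) / (real_of_int p * real n) - lq g / lp g * y"
      unfolding gcolumn_def by auto
    note s = mult_strict_left_mono[OF P(2) pn, unfolded scale] mult_strict_left_mono[OF P(3) pn, unfolded scale]
    obtain z w where z: "lat z w" "of_int a + 1/2 - (p * real n * x + q * real n * y) = of_int z"
      using P(1) unfolding pt_surj pt_eq_iff by blast
    have "of_int (int i) < of_int a - of_int z + (1/2::real)" "of_int a - of_int z + (1/2::real) < of_int (int i + 1)"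
      using s z(2) by linarith+
    then have "a - z = int i" by linarith
    then have "a - int i = z" by simp
    then show "N dvd a - int i" using lat_dvd(1)[OF z(1)] by simp
  next
    assume "N dvd a - int i"
    then obtain w where w: "lat (a - int i) w" using lat_ex_right by blast
    let ?s = "real i + 1/2" and ?t = "of_int (b - w) + 1/2 :: real"
    let ?x = "?s / (p * real n) - ?t * q / (p * real n)" and ?y = "?t / real n"
    have "pt (of_int a + 1/2) (of_int b + 1/2) = pt ?s ?t" unfolding pt_eq_iff
      by (rule exI[of _ "a - int i"], rule exI[of _ w]) (use w in simp)
    also have "\<dots> = tor (?x, ?y)" unfolding pt_def gvec_def by simp
    also have "\<dots> \<in> gcolumn g i" unfolding gcolumn_def using pos by (intro imageI) (simp add: field_simps)
    finally show "pt (of_int a + 1/2) (of_int b + 1/2) \<in> gcolumn g i" .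
  qed
qed

lemma mark_in_row: "pt (of_int a + 1/2) (of_int b + 1/2) \<in> grow g i \<longleftrightarrow> N dvd b - int i"
proof -
  have pos: "real n > 0" "real_of_int p > 0" using N_pos p_pos by simp_all
  show ?thesis
  proof
    assume "pt (of_int a + 1/2) (of_int b + 1/2) \<in> grow g i"
    then obtain x y where P: "pt (of_int a + 1/2) (of_int b + 1/2) = tor (x, y)"
      "real i / real n < y" "y < (real i + 1) / real n"
      unfolding grow_def by auto
    have s: "real i < real n * y" "real n * y < real i + 1" using P pos by (simp_all add: field_simps)
    obtain z w where z: "lat w z" "of_int b + 1/2 - real n * y = of_int z"
      using P(1) unfolding pt_surj pt_eq_iff by blast
    have "real i < of_int b - of_int z + (1/2::real)" "of_int b - of_int z + (1/2::real) < real i + 1"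
      using s z(2) by linarith+
    then have "b - z = int i" by linarith
    then have "b - int i = z" by simp
    then show "N dvd b - int i" using lat_dvd(2)[OF z(1)] by simp
  next
    assume "N dvd b - int i"
    then obtain w where w: "lat w (b - int i)" using lat_ex_left by blast
    let ?t = "real i + 1/2" and ?s = "of_int (a - w) + 1/2 :: real"
    let ?x = "?s / (p * real n) - ?t * q / (p * real n)" and ?y = "?t / real n"
    have "pt (of_int a + 1/2) (of_int b + 1/2) = pt ?s ?t" unfolding pt_eq_iff
      by (rule exI[of _ w], rule exI[of _ "b - int i"]) (use w in simp)
    also have "\<dots> = tor (?x, ?y)" unfolding pt_def gvec_def by simp
    also have "\<dots> \<in> grow g i" unfolding grow_def using pos by (intro imageI) (simp add: field_simps)
    finally show "pt (of_int a + 1/2) (of_int b + 1/2) \<in> grow g i" .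
  qed
qed

text \<open>A line of the grid carries either one \<open>X\<close> or one \<open>XX\<close>.\<close>

lemma line_ok_card: "line_ok g L \<Longrightarrow> card (marks \<inter> L) = 1"
proof -
  have "marks \<inter> L = (L \<inter> mX g) \<union> (L \<inter> mXX g)" by blast
  then show "line_ok g L \<Longrightarrow> card (marks \<inter> L) = 1" unfolding line_ok_def by auto
qed

lemma card_marks_strip:
  assumes W: "0 < W" "W < N"
    and L: "\<And>i. i < n \<Longrightarrow> card (marks \<inter> L i) = 1"
    and mem: "\<And>a b i. pt (of_int a + 1/2) (of_int b + 1/2) \<in> L i \<longleftrightarrow> N dvd f a b - int i"
    and strip: "\<And>a b. pt (of_int a + 1/2) (of_int b + 1/2) \<in> S \<longleftrightarrow> (\<exists>d\<in>{c..<c + W}. N dvd f a b - d)"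
  shows "card (marks \<inter> S) = nat W"
proof -
  have res: "N dvd x - int (nat (d mod N)) \<longleftrightarrow> N dvd x - d" for x d
    using N_pos by (simp add: mod_eq_dvd_iff[symmetric])
  have "marks \<inter> S = (\<Union>d\<in>{c..<c + W}. marks \<inter> L (nat (d mod N)))"
  proof (intro equalityI subsetI)
    fix P assume P: "P \<in> marks \<inter> S"
    then obtain a b where ab: "P = pt (of_int a + 1/2) (of_int b + 1/2)" using marks_centres by blast
    then obtain d where "d \<in> {c..<c + W}" "N dvd f a b - d" using P strip by blast
    then have "P \<in> L (nat (d mod N))" unfolding ab mem res by blast
    then show "P \<in> (\<Union>d\<in>{c..<c + W}. marks \<inter> L (nat (d mod N)))" using P \<open>d \<in> _\<close> by blast
  next
    fix P assume "P \<in> (\<Union>d\<in>{c..<c + W}. marks \<inter> L (nat (d mod N)))"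
    then obtain d where d: "d \<in> {c..<c + W}" "P \<in> marks" "P \<in> L (nat (d mod N))" by blast
    then obtain a b where ab: "P = pt (of_int a + 1/2) (of_int b + 1/2)" using marks_centres by blast
    have "N dvd f a b - d" using d(3) unfolding ab mem res .
    then show "P \<in> marks \<inter> S" using strip[of a b] d ab by blast
  qed
  moreover have "card (\<Union>d\<in>{c..<c + W}. marks \<inter> L (nat (d mod N))) = (\<Sum>d\<in>{c..<c + W}. card (marks \<inter> L (nat (d mod N))))"
  proof (rule card_UN_disjoint)
    show "\<forall>d\<in>{c..<c + W}. \<forall>e\<in>{c..<c + W}. d \<noteq> e \<longrightarrow> (marks \<inter> L (nat (d mod N))) \<inter> (marks \<inter> L (nat (e mod N))) = {}"
    proof (intro ballI impI, rule ccontr)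
      fix d e assume de: "d \<in> {c..<c + W}" "e \<in> {c..<c + W}" "d \<noteq> e"
        "(marks \<inter> L (nat (d mod N))) \<inter> (marks \<inter> L (nat (e mod N))) \<noteq> {}"
      then obtain a b where "pt (of_int a + 1/2) (of_int b + 1/2) \<in> L (nat (d mod N))"
        "pt (of_int a + 1/2) (of_int b + 1/2) \<in> L (nat (e mod N))" using marks_centres by blast
      then have "N dvd f a b - d" "N dvd f a b - e" unfolding mem res by blast+
      then have "N dvd d - e" using dvd_shift by blast
      moreover have "\<bar>d - e\<bar> < N" using de(1,2) W by auto
      ultimately show False using dvd_small de(3) by force
    qed
  qed (use finite_marks in auto)
  moreover have "card (marks \<inter> L (nat (d mod N))) = 1" for d
    using L N_pos by (simp add: nat_less_iff)
  ultimately show ?thesis by simp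
qed

lemma card_marks_vstrip: assumes W: "0 < W" "W < N" shows "card (marks \<inter> vstrip c W) = nat W"
proof (rule card_marks_strip[OF W, of "gcolumn g" "\<lambda>a b. a"])
  show "card (marks \<inter> gcolumn g i) = 1" if "i < n" for i
    using that grid line_ok_card unfolding grid_diagram_def by blast
  show "pt (of_int a + 1/2) (of_int b + 1/2) \<in> vstrip c W \<longleftrightarrow> (\<exists>d\<in>{c..<c + W}. N dvd a - d)" for a b
  proof
    assume "pt (of_int a + 1/2) (of_int b + 1/2) \<in> vstrip c W"
    then obtain x y where xy: "lat x y" "of_int c \<le> of_int a + 1/2 + (of_int x :: real)" "of_int a + 1/2 + of_int x \<le> (of_int (c + W) :: real)"
      unfolding mem_vstrip by blast
    then have "a + x \<in> {c..<c + W}" by (auto; linarith)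
    moreover have "N dvd a - (a + x)" using lat_dvd(1)[OF xy(1)] by simp
    ultimately show "\<exists>d\<in>{c..<c + W}. N dvd a - d" by blast
  next
    assume "\<exists>d\<in>{c..<c + W}. N dvd a - d"
    then obtain d where d: "d \<in> {c..<c + W}" "N dvd a - d" by blast
    then have "N dvd d - a" by (simp add: dvd_diff_commute)
    then obtain y where "lat (d - a) y" using lat_ex_right by blast
    then show "pt (of_int a + 1/2) (of_int b + 1/2) \<in> vstrip c W"
      unfolding mem_vstrip using d(1) by (intro exI[of _ "d - a"] exI[of _ y]) (auto; linarith)
  qed
qed (rule mark_in_column)

lemma card_marks_hstrip: assumes W: "0 < W" "W < N" shows "card (marks \<inter> hstrip c W) = nat W"
proof (rule card_marks_strip[OF W, of "grow g" "\<lambda>a b. b"])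
  show "card (marks \<inter> grow g i) = 1" if "i < n" for i
    using that grid line_ok_card unfolding grid_diagram_def by blast
  show "pt (of_int a + 1/2) (of_int b + 1/2) \<in> hstrip c W \<longleftrightarrow> (\<exists>d\<in>{c..<c + W}. N dvd b - d)" for a b
  proof
    assume "pt (of_int a + 1/2) (of_int b + 1/2) \<in> hstrip c W"
    then obtain x y where xy: "lat x y" "of_int c \<le> of_int b + 1/2 + (of_int y :: real)" "of_int b + 1/2 + of_int y \<le> (of_int (c + W) :: real)"
      unfolding mem_hstrip by blast
    then have "b + y \<in> {c..<c + W}" by (auto; linarith)
    moreover have "N dvd b - (b + y)" using lat_dvd(2)[OF xy(1)] by simp
    ultimately show "\<exists>d\<in>{c..<c + W}. N dvd b - d" by blast
  next
    assume "\<exists>d\<in>{c..<c + W}. N dvd b - d"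
    then obtain d where d: "d \<in> {c..<c + W}" "N dvd b - d" by blast
    then have "N dvd d - b" by (simp add: dvd_diff_commute)
    then obtain x where "lat x (d - b)" using lat_ex_left by blast
    then show "pt (of_int a + 1/2) (of_int b + 1/2) \<in> hstrip c W"
      unfolding mem_hstrip using d(1) by (intro exI[of _ x] exI[of _ "d - b"]) (auto; linarith)
  qed
qed (rule mark_in_row)

end

context sign_quotient
begin

text \<open>The annulus contains one mark more than unmoved points, so the sign correction contributes \<open>-1\<close>, which
  cancels the value \<open>-1\<close> of \<open>Q\<close>.\<close>

lemma omega_annulus:
  assumes r1: "rc u c b W H" and r2: "rc (tr c W u) c' b' W' H'"
    and returns: "gen (tr c' W' (tr c W u)) = gen u"
    and cols: "in_cols {c, c + W} c'" "in_cols {c, c + W} (c' + W')" "in_cols {c', c' + W'} c" "in_cols {c', c' + W'} (c + W)"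
    and ann: "vertical_annulus g (box c b W H) (box c' b' W' H') \<or> horizontal_annulus g (box c b W H) (box c' b' W' H')"
    and ind: "\<And>s t. avoids s t {c, c + W} {b, b + H} \<Longrightarrow> ind (pt s t) (box c b W H) + ind (pt s t) (box c' b' W' H') = ind (pt s t) S"
    and marks: "card (marks \<inter> S) = Suc m"
    and strands: "card {k. k < n \<and> \<not> in_cols {c, c + W} (u k) \<and> ipt (u k) (int k) \<in> S} = m"
  shows "omega u c b W H * omega (tr c W u) c' b' W' H' = 1"
proof -
  define B1 B2 where "B1 = box c b W H" and "B2 = box c' b' W' H'"
  note Bs = B1_def[symmetric] B2_def[symmetric]
  let ?A = "{c, c + W}"
  have A: "in_cols ?A c" "in_cols ?A (c + W)" by (auto simp: in_cols_def)
  define K where "K = {k \<in> {..<n}. \<not> in_cols ?A (u k)}"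
  have K: "finite K" unfolding K_def by simp
  have Q: "Q (gen u) (gen (tr c W u)) B1 * Q (gen (tr c W u)) (gen u) B2 = -1"
    using ann rc_gens[OF r1] rc_Rect[OF r1] rc_Rect[OF r2] Q_vertical Q_horizontal unfolding returns Bs by blast
  have "card (marks \<inter> B1) + card (marks \<inter> B2) = card (marks \<inter> S)"
    unfolding card_marks sum.distrib[symmetric]
  proof (rule sum.cong)
    fix P assume "P \<in> marks"
    then have "P \<in> off_circles g" using marks_off by blast
    then obtain s t where "P = pt s t" "s \<notin> \<int>" "t \<notin> \<int>" unfolding off_circles_iff by blast
    then show "ind P B1 + ind P B2 = ind P S" using ind[OF avoids_non_int] unfolding Bs by blast
  qed simp
  moreover have "others u c W B1 = {k \<in> K. ipt (u k) (int k) \<in> B1}"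
  proof -
    have "others u c W B1 = {k. k < n \<and> \<not> in_cols ?A (u k) \<and> ipt (u k) (int k) \<in> B1}"
      by (rule others_eq[OF _ _ A]) (auto simp: clear_def)
    then show ?thesis unfolding K_def by auto
  qed
  moreover have "others (tr c W u) c' W' B2 = {k \<in> K. ipt (u k) (int k) \<in> B2}"
  proof -
    have "others (tr c W u) c' W' B2 = {k. k < n \<and> \<not> in_cols ?A (u k) \<and> ipt (u k) (int k) \<in> B2}"
    proof (rule others_eq[OF _ _ cols(1,2)])
      show "clear (tr c W u) ?A c' W' B2" using cols(3,4) unfolding clear_def in_cols_def by auto
    qed (use tr_in_cols[OF A] in auto)
    then show ?thesis unfolding K_def by auto
  qed
  moreover have "card {k \<in> K. ipt (u k) (int k) \<in> B1} + card {k \<in> K. ipt (u k) (int k) \<in> B2} = card {k \<in> K. ipt (u k) (int k) \<in> S}"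
    unfolding card_eq_sum_of_bool[OF K] sum.distrib[symmetric]
  proof (rule sum.cong)
    fix k assume k: "k \<in> K"
    have "avoids (of_int (u k)) (of_int (int k)) ?A {b, b + H}"
    proof (rule avoids_int)
      show "\<not> N dvd u k - a" if "a \<in> ?A" for a using k that unfolding K_def in_cols_def by blast
      show "\<not> N dvd int k - e" if e: "e \<in> {b, b + H}" for e
      proof
        assume d: "N dvd int k - e"
        obtain a where a: "a \<in> ?A" "on u a e" using r1 e unfolding rc_def by blast
        have "lat (u k - a) (int k - e)" using on_row[OF on_strand a(2) d] k unfolding K_def by blast
        then show False using lat_dvd(1) k a unfolding K_def in_cols_def by blast
      qed
    qed
    then show "ind (ipt (u k) (int k)) B1 + ind (ipt (u k) (int k)) B2 = ind (ipt (u k) (int k)) S"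
      using ind unfolding ipt_def Bs by blast
  qed simp
  moreover have "card {k \<in> K. ipt (u k) (int k) \<in> S} = m" using strands unfolding K_def by (simp add: conj_assoc)
  ultimately have tot: "(card (marks \<inter> B1) + card (others u c W B1)) + (card (marks \<inter> B2) + card (others (tr c W u) c' W' B2)) = Suc (2 * m)"
    using marks by simp
  have "(-1::int) ^ (card (marks \<inter> B1) + card (others u c W B1)) * (-1) ^ (card (marks \<inter> B2) + card (others (tr c W u) c' W' B2)) = -1"
    unfolding power_add[symmetric] tot by simp
  moreover have "(a * s) * (d * t) = 1" if "a * d = -1" "s * t = -1" for a s d t :: int
  proof -
    have "(a * s) * (d * t) = (a * d) * (s * t)" by (simp add: mult_ac)
    then show ?thesis using that by simp
  qed
  ultimately show ?thesis unfolding omega_def Bs returns using Q by blast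
qed

lemma omega_vertical:
  assumes r: "rc u c b W H" and W: "W < N"
  shows "omega u c b W H * omega (tr c W u) c (b + H) W (p * N - H) = 1" "rc (tr c W u) c (b + H) W (p * N - H)"
proof -
  note r' = r[unfolded rc_def]
  have nd: "\<not> N dvd W" using rc_not_dvd r by blast
  have H: "H < p * N" using emb_bounds(2)[of W H] r' by simp
  have on: "on (tr c W u) c (b + H)" using on_tr_left[OF nd] r' by blast
  have "on (tr c W u) (c + W) b" using on_tr_right[OF nd] r' by blast
  then have on2: "on (tr c W u) (c + W) (b + H + (p * N - H))"
    by (rule on_latI) (use lat_vert[of "p * N"] in simp)
  show r2: "rc (tr c W u) c (b + H) W (p * N - H)"
    by (rule rc_narrowI) (use state_tr r' W H on on2 in auto)
  have ind: "ind (pt s t) (box c b W H) + ind (pt s t) (box c (b + H) W (p * N - H)) = ind (pt s t) (vstrip c W)"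
    if "avoids s t A {b, b + H}" for s t A
    using vertical_annulus_ind[OF _ W _ H that] r' by blast
  have off: "ind P (box c b W H) + ind P (box c (b + H) W (p * N - H)) = ind P (vstrip c W)" if "P \<in> off_circles g" for P
    using that ind[OF avoids_non_int] unfolding off_circles_iff by blast
  have strands: "{k. k < n \<and> \<not> in_cols {c, c + W} (u k) \<and> ipt (u k) (int k) \<in> vstrip c W} =
     {k. k < n \<and> \<not> N dvd u k - c \<and> \<not> N dvd u k - (c + W) \<and> (\<exists>x. N dvd x \<and> c \<le> u k + x \<and> u k + x \<le> c + W)}"
  proof -
    have "ipt (u k) (int k) \<in> vstrip c W \<longleftrightarrow> (\<exists>x. N dvd x \<and> c \<le> u k + x \<and> u k + x \<le> c + W)" for k
      unfolding ipt_def mem_vstrip of_int_add[symmetric] of_int_le_iff by (meson lat_ex_right lat_dvd(1))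
    then show ?thesis unfolding in_cols_def by auto
  qed
  show "omega u c b W H * omega (tr c W u) c (b + H) W (p * N - H) = 1"
  proof (rule omega_annulus[OF r r2, where S = "vstrip c W" and m = "nat (W - 1)"])
    show "gen (tr c W (tr c W u)) = gen u" using tr_tr[OF nd] by simp
    show "card (marks \<inter> vstrip c W) = Suc (nat (W - 1))"
      using card_marks_vstrip[of W c] r' W Suc_nat_eq_nat_zadd1[of "W - 1"] by simp
    show "card {k. k < n \<and> \<not> in_cols {c, c + W} (u k) \<and> ipt (u k) (int k) \<in> vstrip c W} = nat (W - 1)"
      unfolding strands by (rule card_window) (use state_inj r' W in blast)+
    show "vertical_annulus g (box c b W H) (box c (b + H) W (p * N - H)) \<or> horizontal_annulus g (box c b W H) (box c (b + H) W (p * N - H))"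
      using vertical_annulusI[OF _ W off] r' by blast
  qed (use ind in \<open>auto simp: in_cols_def\<close>)
qed

text \<open>The composite of the two rectangles returns to the same generator but not to the same state: it shifts two
  entries of \<open>u\<close> by \<open>p N\<close> in opposite directions. So this relation constrains the potential on lifts,
  see \<open>potential_shift_less\<close>.\<close>

lemma omega_horizontal:
  assumes r: "rc u c b W H" and H: "H < N"
  shows "omega u c b W H * omega (tr c W u) (c + W) b (p * N - W) H = 1" "rc (tr c W u) (c + W) b (p * N - W) H"
proof -
  note r' = r[unfolded rc_def]
  have nd: "\<not> N dvd W" using rc_not_dvd r by blast
  have W: "W < p * N" using emb_bounds(1)[of W H] r' by simp
  have on: "on (tr c W u) (c + W) b" using on_tr_right[OF nd] r' by blast
  have "on (tr c W u) c (b + H)" using on_tr_left[OF nd] r' by blast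
  then have on2: "on (tr c W u) (c + W + (p * N - W)) (b + H)"
    by (rule on_latI) (use lat_horiz[of "p * N"] in simp)
  show r2: "rc (tr c W u) (c + W) b (p * N - W) H" unfolding rc_def
    using state_tr r' W on on2 emb_low[OF H, of "p * N - W"] by auto
  have ind: "ind (pt s t) (box c b W H) + ind (pt s t) (box (c + W) b (p * N - W) H) = ind (pt s t) (hstrip b H)"
    if "avoids s t {c, c + W} B" for s t B
    using horizontal_annulus_ind[OF _ H _ W that] r' by blast
  have off: "ind P (box c b W H) + ind P (box (c + W) b (p * N - W) H) = ind P (hstrip b H)" if "P \<in> off_circles g" for P
    using that ind[OF avoids_non_int] unfolding off_circles_iff by blast
  have cr: "in_cols {c, c + W} (u k) \<longleftrightarrow> N dvd int k - b \<or> N dvd int k - (b + H)" if k: "k < n" for k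
  proof -
    have "N dvd u k - c \<longleftrightarrow> N dvd int k - b"
      using on_row[OF on_strand[OF k, of u], of c b] on_column[OF _ on_strand[OF k], of u c b] r' lat_dvd by blast
    moreover have "N dvd u k - (c + W) \<longleftrightarrow> N dvd int k - (b + H)"
      using on_row[OF on_strand[OF k, of u], of "c + W" "b + H"] on_column[OF _ on_strand[OF k], of u "c + W" "b + H"] r' lat_dvd by blast
    ultimately show ?thesis unfolding in_cols_def by auto
  qed
  have strands: "{k. k < n \<and> \<not> in_cols {c, c + W} (u k) \<and> ipt (u k) (int k) \<in> hstrip b H} =
     {k. k < n \<and> \<not> N dvd int k - b \<and> \<not> N dvd int k - (b + H) \<and> (\<exists>x. N dvd x \<and> b \<le> int k + x \<and> int k + x \<le> b + H)}"
  proof -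
    have "ipt (u k) (int k) \<in> hstrip b H \<longleftrightarrow> (\<exists>x. N dvd x \<and> b \<le> int k + x \<and> int k + x \<le> b + H)" for k
      unfolding ipt_def mem_hstrip of_int_add[symmetric] of_int_le_iff by (meson lat_ex_left lat_dvd(2))
    then show ?thesis using cr by auto
  qed
  have returns: "gen (tr (c + W) (p * N - W) (tr c W u)) = gen u"
    using gen_eq_iff[of "tr (c + W) (p * N - W) (tr c W u)" u] r' state_tr col_tr_round[OF nd, of "p * N"]
    unfolding tr_def by auto
  show "omega u c b W H * omega (tr c W u) (c + W) b (p * N - W) H = 1"
  proof (rule omega_annulus[OF r r2 returns, where S = "hstrip b H" and m = "nat (H - 1)"])
    show "card (marks \<inter> hstrip b H) = Suc (nat (H - 1))"
      using card_marks_hstrip[of H b] r' H Suc_nat_eq_nat_zadd1[of "H - 1"] by simp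
    show "card {k. k < n \<and> \<not> in_cols {c, c + W} (u k) \<and> ipt (u k) (int k) \<in> hstrip b H} = nat (H - 1)"
      unfolding strands by (rule card_window) (use row_inj r' H in blast)+
    show "vertical_annulus g (box c b W H) (box (c + W) b (p * N - W) H) \<or> horizontal_annulus g (box c b W H) (box (c + W) b (p * N - W) H)"
      using horizontal_annulusI[OF _ H off] r' by blast
  qed (use ind in \<open>auto simp: in_cols_def\<close>)
qed

end

section \<open>Potentials from descents\<close>

text \<open>A labelled form of Newman's lemma. Each move \<open>D\<close> decreases \<open>\<mu>\<close>, and \<open>G x\<close> is defined by following
  arbitrarily chosen moves. The hypothesis \<open>peak\<close> says that any two moves from \<open>x\<close> lead to the same value,
  provided that the values below \<open>x\<close> are consistent; by induction the value then does not depend on the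
  choices.\<close>

lemma descent_potential:
  fixes \<mu> :: "'a \<Rightarrow> nat" and D :: "'a \<Rightarrow> 'c \<Rightarrow> bool" and mv :: "'c \<Rightarrow> 'a \<Rightarrow> 'a" and e :: "'a \<Rightarrow> 'c \<Rightarrow> int"
  assumes dec: "\<And>x c. D x c \<Longrightarrow> \<mu> (mv c x) < \<mu> x"
    and unit: "\<And>x c. D x c \<Longrightarrow> e x c \<in> {1, -1}"
    and peak: "\<And>G x c c'. D x c \<Longrightarrow> D x c' \<Longrightarrow>
      (\<And>x' d. \<mu> x' < \<mu> x \<Longrightarrow> D x' d \<Longrightarrow> G x' = e x' d * G (mv d x')) \<Longrightarrow>
      e x c * G (mv c x) = e x c' * G (mv c' x)"
  shows "\<exists>G. (\<forall>x c. D x c \<longrightarrow> G x = e x c * G (mv c x)) \<and> (\<forall>x. G x \<in> {1, -1})"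
proof -
  define \<Phi> where "\<Phi> f x = (if \<exists>c. D x c then let c = SOME c. D x c in e x c * f (mv c x) else 1)" for f x
  define G where "G = wfrec (measure \<mu>) \<Phi>"
  have G: "G x = \<Phi> G x" for x
  proof -
    have "G x = \<Phi> (cut G (measure \<mu>) x) x" unfolding G_def by (subst wfrec) auto
    also have "\<dots> = \<Phi> G x"
    proof (cases "\<exists>c. D x c")
      case True
      then have "D x (SOME c. D x c)" by (rule someI_ex)
      then have "cut G (measure \<mu>) x (mv (SOME c. D x c) x) = G (mv (SOME c. D x c) x)"
        using dec by (intro cut_apply) simp
      then show ?thesis unfolding \<Phi>_def Let_def by (simp only:)
    qed (simp add: \<Phi>_def)
    finally show ?thesis .
  qed
  have eq: "G x = e x c * G (mv c x)" if "D x c" for x c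
    using that
  proof (induction "\<mu> x" arbitrary: x c rule: less_induct)
    case less
    let ?d = "SOME c. D x c"
    have d: "D x ?d" using less.prems by (rule someI)
    have "G x = e x ?d * G (mv ?d x)" using G[of x] less.prems unfolding \<Phi>_def Let_def by auto
    also have "\<dots> = e x c * G (mv c x)" by (rule peak[OF d less.prems]) (rule less.hyps)
    finally show ?case .
  qed
  have "G x \<in> {1, -1}" for x
  proof (induction "\<mu> x" arbitrary: x rule: less_induct)
    case less
    show ?case
    proof (cases "\<exists>c. D x c")
      case True
      then obtain c where c: "D x c" by blast
      then show ?thesis using eq[OF c] less[OF dec[OF c]] unit[OF c] by auto
    next
      case False
      then show ?thesis using G[of x] unfolding \<Phi>_def if_not_P[OF False] by simp
    qed
  qed
  then show ?thesis using eq by blast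
qed

context grid_torus
begin

text \<open>The inverse of the affine permutation \<open>u\<close>: extended by \<open>u (k + N) = u k + N\<close>, a state is a bijection of
  the integers, and \<open>x\<close> is the row with column \<open>c\<close>. The shift by \<open>N\<close> in this extension serves only to order
  the columns; it is not the translation by a lattice vector.\<close>

definition val :: "(nat \<Rightarrow> int) \<Rightarrow> int \<Rightarrow> int \<Rightarrow> bool" where
  "val u c x \<longleftrightarrow> (\<exists>k<n. N dvd u k - c \<and> x = int k - u k + c)"

lemma val_ex: "state u \<Longrightarrow> \<exists>x. val u c x"
  unfolding val_def using strand_ex by blast

lemma val_unique: "state u \<Longrightarrow> val u c x \<Longrightarrow> val u c y \<Longrightarrow> x = y"
proof -
  assume u: "state u" "val u c x" "val u c y"
  obtain i where i: "i < n" "N dvd u i - c" "x = int i - u i + c" using u unfolding val_def by blast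
  obtain j where j: "j < n" "N dvd u j - c" "y = int j - u j + c" using u unfolding val_def by blast
  have "N dvd u i - u j" using dvd_lin[OF i(2) j(2), of "u i - u j" 1 "-1"] by simp
  then show "x = y" using state_inj u(1) i j by blast
qed

lemma val_distinct:
  assumes "state u" "val u c x" "val u d y" "\<not> N dvd c - d" shows "x \<noteq> y"
proof
  assume xy: "x = y"
  obtain i where i: "i < n" "N dvd u i - c" "x = int i - u i + c" using assms unfolding val_def by blast
  obtain j where j: "j < n" "N dvd u j - d" "y = int j - u j + d" using assms unfolding val_def by blast
  have "int i - int j = (u i - c) - (u j - d)" using i(3) j(3) xy by linarith
  then have "N dvd int i - int j" using i(2) j(2) by (metis dvd_diff)
  then have "i = j" using row_inj i j by blast
  then have "c = d" using i j xy by simp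
  then show False using assms(4) by simp
qed

lemma val_shift: "N dvd y \<Longrightarrow> val u (c + y) (x + y) \<longleftrightarrow> val u c x"
proof -
  assume y: "N dvd y"
  have "N dvd u k - (c + y) \<longleftrightarrow> N dvd u k - c" for k
  proof -
    have "u k - c = (u k - (c + y)) + y" by simp
    then show ?thesis using dvd_add_left_iff[OF y] by metis
  qed
  then show ?thesis unfolding val_def by auto
qed

lemma val_tr_left:
  assumes W: "\<not> N dvd W" and v: "val u (c + W) x" shows "val (tr c W u) c x"
proof -
  obtain k where k: "k < n" "N dvd u k - (c + W)" "x = int k - u k + (c + W)" using v unfolding val_def by blast
  then have "\<not> N dvd u k - c" using W dvd_lin[of N "u k - (c + W)" "u k - c" W "-1" 1] by auto
  then have "tr c W u k = u k - W" using k unfolding tr_alt by auto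
  moreover have "N dvd u k - W - c" using k(2) by (simp add: diff_diff_eq add.commute)
  ultimately show ?thesis unfolding val_def using k by (intro exI[of _ k]) simp
qed

lemma val_tr_right:
  assumes v: "val u c x" shows "val (tr c W u) (c + W) x"
proof -
  obtain k where k: "k < n" "N dvd u k - c" "x = int k - u k + c" using v unfolding val_def by blast
  then have "tr c W u k = u k + W" unfolding tr_alt by auto
  then show ?thesis unfolding val_def using k by (intro exI[of _ k]) simp
qed

lemma val_tr_other:
  assumes d: "\<not> N dvd d - c" "\<not> N dvd d - (c + W)" and v: "val u d x" shows "val (tr c W u) d x"
proof -
  obtain k where k: "k < n" "N dvd u k - d" "x = int k - u k + d" using v unfolding val_def by blast
  then have "\<not> N dvd u k - c" "\<not> N dvd u k - (c + W)" using d dvd_shift by blast+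
  then have "tr c W u k = u k" unfolding tr_alt by auto
  then show ?thesis unfolding val_def using k by (intro exI[of _ k]) simp
qed

definition descent :: "(nat \<Rightarrow> int) \<Rightarrow> int \<Rightarrow> bool" where
  "descent u c \<longleftrightarrow> state u \<and> (\<exists>x y. val u c x \<and> val u (c + 1) y \<and> y < x)"

definition spread :: "(nat \<Rightarrow> int) \<Rightarrow> nat" where
  "spread u = nat (\<Sum>k<n. (int k - u k)\<^sup>2)"

text \<open>The exchange moves two of the entries \<open>k - u k\<close>, which differ by more than one, towards each other by one
  each.\<close>

lemma spread_less:
  assumes N2: "1 < N" and D: "descent u c" shows "spread (tr c 1 u) < spread u"
proof -
  have 1: "\<not> N dvd 1" using not_dvd_narrow N2 by simp
  obtain x y where st: "state u" and v: "val u c x" "val u (c + 1) y" "y < x" using D unfolding descent_def by blast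
  obtain i where i: "i < n" "N dvd u i - c" "x = int i - u i + c" using v unfolding val_def by blast
  obtain j where j: "j < n" "N dvd u j - (c + 1)" "y = int j - u j + (c + 1)" using v unfolding val_def by blast
  have nj: "\<not> N dvd u j - c" using 1 dvd_lin[of N "u j - (c + 1)" "u j - c" 1 "-1" 1] j by auto
  have ti: "tr c 1 u i = u i + 1" using i unfolding tr_alt by simp
  have tj: "tr c 1 u j = u j - 1" using j nj unfolding tr_alt by simp
  have to: "tr c 1 u k = u k" if "k < n" "k \<noteq> i" "k \<noteq> j" for k
  proof -
    have "\<not> N dvd u k - c" "\<not> N dvd u k - (c + 1)"
      using that i j state_inj[OF st] dvd_shift[of "u k" c "u i"] dvd_shift[of "u k" "c + 1" "u j"] dvd_diff_commute by blast+
    then show ?thesis unfolding tr_alt by simp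
  qed
  have ij: "i \<noteq> j" using i nj by blast
  have split: "(\<Sum>k<n. f k) = f i + f j + (\<Sum>k\<in>{..<n} - {i} - {j}. f k)" for f :: "nat \<Rightarrow> int"
    using sum.remove[of "{..<n}" i f] sum.remove[of "{..<n} - {i}" j f] i(1) j(1) ij by simp
  have rest: "(\<Sum>k\<in>{..<n} - {i} - {j}. (int k - tr c 1 u k)\<^sup>2) = (\<Sum>k\<in>{..<n} - {i} - {j}. (int k - u k)\<^sup>2)"
    by (rule sum.cong) (use to in auto)
  define a b where "a = int i - u i" and "b = int j - u j"
  have ab: "b + 1 < a" using v(3) i(3) j(3) unfolding a_def b_def by linarith
  have "(a - 1)\<^sup>2 + (b + 1)\<^sup>2 < a\<^sup>2 + b\<^sup>2" using ab by (simp add: power2_eq_square algebra_simps)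
  moreover have new: "int i - tr c 1 u i = a - 1" "int j - tr c 1 u j = b + 1" unfolding a_def b_def ti tj by simp_all
  ultimately have "(\<Sum>k<n. (int k - tr c 1 u k)\<^sup>2) < (\<Sum>k<n. (int k - u k)\<^sup>2)"
    unfolding split[of "\<lambda>k. (int k - tr c 1 u k)\<^sup>2"] split[of "\<lambda>k. (int k - u k)\<^sup>2"] rest new a_def[symmetric] b_def[symmetric] by simp
  moreover have "0 \<le> (\<Sum>k<n. (int k - tr c 1 u k)\<^sup>2)" by (intro sum_nonneg) simp
  ultimately show ?thesis unfolding spread_def by simp
qed

lemma descent_or_swapped:
  assumes N2: "1 < N" and st: "state u" shows "descent u c \<or> descent (tr c 1 u) c"
proof -
  have 1: "\<not> N dvd 1" using not_dvd_narrow N2 by simp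
  obtain x where x: "val u c x" using val_ex st by blast
  obtain y where y: "val u (c + 1) y" using val_ex st by blast
  have "x \<noteq> y" using val_distinct[OF st x y] 1 by simp
  moreover have "val (tr c 1 u) c y" "val (tr c 1 u) (c + 1) x" using val_tr_left[OF 1 y] val_tr_right[OF x] .
  ultimately show ?thesis unfolding descent_def using st state_tr x y by (meson linorder_neqE)
qed

lemma descent_shift: "N dvd y \<Longrightarrow> descent u (c + y) \<longleftrightarrow> descent u c"
proof -
  have *: "descent u (c + y)" if y: "N dvd y" and d: "descent u c" for y c
  proof -
    obtain a b where "state u" "val u c a" "val u (c + 1) b" "b < a" using d unfolding descent_def by blast
    moreover from this have "val u (c + y) (a + y)" "val u (c + 1 + y) (b + y)" using val_shift[OF y] by blast+
    moreover have "c + 1 + y = c + y + 1" by simp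
    ultimately show ?thesis unfolding descent_def by (metis add_strict_right_mono)
  qed
  assume y: "N dvd y"
  show ?thesis using *[OF y] *[of "- y" "c + y"] y by auto
qed

end

context sign_quotient
begin

section \<open>The potential on thin rectangles\<close>

text \<open>The rectangle back is the complement in the vertical annulus.\<close>

lemma eps_sym:
  assumes "state u" "0 < W" "W < N" shows "eps (tr c W u) c W = eps u c W"
proof -
  obtain b where b: "on u c b" using on_ex assms by blast
  then obtain H where r: "rc u c b W H" using rc_ex_narrow assms by blast
  note v = omega_vertical[OF r assms(3)]
  have "omega u c b W H * omega (tr c W u) c (b + H) W (p * N - H) = 1" using v(1) .
  then have "omega u c b W H = omega (tr c W u) c (b + H) W (p * N - H)"
    using omega_unit[OF r] omega_unit[OF v(2)] by auto
  then show ?thesis using eps_eq[OF r] eps_eq[OF v(2)] assms by simp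
qed

text \<open>The two L-shaped squares give these relations for the orders of the rows in which they are stated. Any order
  is one of them up to vertical translations by \<open>p N\<close> of some of the points, which rotate the order
  cyclically, and up to reading the square backwards from its last generator \<open>v\<close> by means
  of \<open>eps_sym\<close>.\<close>

lemma eps_triple:
  assumes st: "state u" and w: "0 < w1" "0 < w2" "w1 + w2 < N"
  shows "eps u (c + w1) w2 * eps (tr (c + w1) w2 u) c w1 = eps u c w1 * eps (tr c w1 u) c (w1 + w2)" (is ?eqA)
    and "eps u (c + w1) w2 * eps (tr (c + w1) w2 u) c w1 = eps u c (w1 + w2) * eps (tr c (w1 + w2) u) (c + w1) w2" (is ?eqB)
proof -
  have bl: "w1 < N" "w2 < N" "0 < w1 + w2" using w by linarith+
  have nd: "\<not> N dvd w1" "\<not> N dvd w2" "\<not> N dvd w1 + w2"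
    using not_dvd_narrow w bl by blast+
  note ont = on_triple[OF w]
  have pN: "p * N > 0" using p_pos N_pos by simp
  have period: "on v d (e + p * N) \<longleftrightarrow> on v d e" "on v d (e - p * N) \<longleftrightarrow> on v d e" for v d e
    using on_lat[of 0 "p * N" v d e] on_lat[of 0 "p * N" v d "e - p * N"] lat_vert[of "p * N"] by simp_all
  \<comment> \<open>The three intermediate states and the common end \<open>v\<close> of the three factorizations.\<close>
  define y1 y2 y3 v where "y1 = tr (c + w1) w2 u" and "y2 = tr c (w1 + w2) u" and "y3 = tr c w1 u" and "v = tr c w1 y1"
  have sts: "state y1" "state y2" "state y3" "state v" unfolding y1_def y2_def y3_def v_def using st state_tr by blast+
  have v: "v = tr (c + w1) w2 y2" "v = tr c (w1 + w2) y3"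
    unfolding v_def y1_def y2_def y3_def using tr_triple(1,2)[OF w] by simp_all
  have bk: "tr c w1 v = y1" "tr (c + w1) w2 v = y2" "tr c (w1 + w2) v = y3"
    unfolding v_def using tr_tr nd v by (metis v_def)+
  have sym: "eps v c w1 = eps y1 c w1" "eps v (c + w1) w2 = eps y2 (c + w1) w2" "eps v c (w1 + w2) = eps y3 c (w1 + w2)"
    "eps y1 (c + w1) w2 = eps u (c + w1) w2" "eps y2 c (w1 + w2) = eps u c (w1 + w2)" "eps y3 c w1 = eps u c w1"
  proof -
    show "eps v c w1 = eps y1 c w1" unfolding v_def by (rule eps_sym[OF sts(1) w(1) bl(1)])
    show "eps v (c + w1) w2 = eps y2 (c + w1) w2" unfolding v(1) by (rule eps_sym[OF sts(2) w(2) bl(2)])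
    show "eps v c (w1 + w2) = eps y3 c (w1 + w2)" unfolding v(2) by (rule eps_sym[OF sts(3) bl(3) w(3)])
    show "eps y1 (c + w1) w2 = eps u (c + w1) w2" unfolding y1_def by (rule eps_sym[OF st w(2) bl(2)])
    show "eps y2 c (w1 + w2) = eps u c (w1 + w2)" unfolding y2_def by (rule eps_sym[OF st bl(3) w(3)])
    show "eps y3 c w1 = eps u c w1" unfolding y3_def by (rule eps_sym[OF st w(1) bl(1)])
  qed
  obtain b where b: "on u c b" using on_ex st by blast
  obtain H1 where r1: "rc u c b w1 H1" using rc_ex_narrow[OF st _ _ b] w bl by blast
  obtain H2 where r2: "rc u c b (w1 + w2) H2" using rc_ex_narrow[OF st _ _ b] w bl by blast
  have on: "on u (c + w1) (b + H1)" "on u (c + w1 + w2) (b + H2)" and H: "0 < H1" "H1 < p * N" "0 < H2" "H2 < p * N"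
    using r1 r2 emb_bounds(2)[of w1 H1] emb_bounds(2)[of "w1 + w2" H2] w unfolding rc_def by (auto simp: add.assoc)
  have "\<not> N dvd (c + w1) - (c + w1 + w2)" using nd(2) by simp
  then have ne: "H1 \<noteq> H2" using on_diff_rows(1)[OF on] by auto
  have "?eqA \<and> ?eqB"
  \<comment> \<open>The order of the rows is 123 for \<open>u\<close> and a rotation of it for \<open>v\<close>, or 132 and a rotation of it.\<close>
  proof (cases "H1 < H2")
    case True
    have A: ?eqA using squares_123(1)[OF st w, of H1 "H2 - H1" c b] True H on b by simp
    have onv: "on v c (b + H2 - p * N)" "on v (c + w1) b" "on v (c + w1 + w2) (b + H1)"
      unfolding v_def y1_def ont period using on b by (simp_all add: period)
    have "eps v c w1 * eps (tr c w1 v) (c + w1) w2 = eps v (c + w1) w2 * eps (tr (c + w1) w2 v) c (w1 + w2)"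
      using squares_123(2)[OF sts(4) w, of "p * N - H2" H1 c "b + H2 - p * N"] True H onv by simp
    then have ?eqB unfolding bk sym by (simp add: y1_def[symmetric] y2_def[symmetric] mult.commute)
    then show ?thesis using A by blast
  next
    case False
    then have lt: "H2 < H1" using ne by simp
    have onu: "on u c (b + H1 - p * N + (p * N - H1))" "on u (c + w1) (b + H1 - p * N)" "on u (c + w1 + w2) (b + H1 - p * N + (p * N - H1) + H2)"
      using on b by (simp_all add: period)
    have B: ?eqB using square_213[OF st w, of "p * N - H1" H2 c "b + H1 - p * N"] lt H onu by simp
    have onv: "on v c (b + H2)" "on v (c + w1) (b + p * N)" "on v (c + w1 + w2) (b + H1)"
      unfolding v_def y1_def ont period using on b by (simp_all add: period)
    have "eps v c w1 * eps (tr c w1 v) (c + w1) w2 = eps v c (w1 + w2) * eps (tr c (w1 + w2) v) c w1"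
      using square_132[OF sts(4) w, of "H1 - H2" "p * N - H1" c "b + H2"] lt H onv by simp
    then have ?eqA unfolding bk sym by (simp add: y1_def[symmetric] y3_def[symmetric] mult.commute)
    then show ?thesis using B by blast
  qed
  then show ?eqA ?eqB by blast+
qed

text \<open>Both moves can be continued by two further descents to the same state. The two paths form the braid
  hexagon, which is the union of two squares that share an edge of width two. For \<open>N = 2\<close> the two descents
  cannot occur together.\<close>

lemma braid_peak:
  assumes D: "descent u c" "descent u (c + 1)" and N2: "1 < N"
    and G: "\<And>v d. spread v < spread u \<Longrightarrow> descent v d \<Longrightarrow> G v = eps v d 1 * G (tr d 1 v)"
  shows "eps u c 1 * G (tr c 1 u) = eps u (c + 1) 1 * G (tr (c + 1) 1 u)"
proof -
  have st: "state u" using D unfolding descent_def by blast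
  have 1: "\<not> N dvd 1" using not_dvd_narrow N2 by simp
  obtain x y where xy: "val u c x" "val u (c + 1) y" "y < x" using D(1) unfolding descent_def by blast
  obtain y' z where "val u (c + 1) y'" "val u (c + 1 + 1) z" "z < y'" using D(2) unfolding descent_def by blast
  then have z: "val u (c + 1 + 1) z" "z < y" using val_unique[OF st xy(2)] by blast+
  \<comment> \<open>For \<open>N = 2\<close> the column \<open>c + 2\<close> is a translate of \<open>c\<close>, and the values would increase by \<open>2\<close>.\<close>
  have N3: "1 + 1 < N"
  proof (rule ccontr)
    assume "\<not> 1 + 1 < N"
    then have "N = 2" using N2 by simp
    then have "val u (c + 2) (x + 2)" using val_shift[of 2 u c x] xy(1) by simp
    then have "z = x + 2" using val_unique[OF st, of "c + 2"] z(1) by (simp add: add.assoc)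
    then show False using xy z by simp
  qed
  then have 2: "\<not> N dvd 2" using not_dvd_narrow[of 2] by simp
  have nd: "\<not> N dvd (c + 1 + 1) - c" "\<not> N dvd (c + 1 + 1) - (c + 1)" "\<not> N dvd c - (c + 1)" "\<not> N dvd c - (c + 1 + 1)"
    using 1 2 dvd_minus_iff[of N 1] dvd_minus_iff[of N 2] by (simp_all del: dvd_minus_iff)
  define u1 u2 v1 v2 where "u1 = tr c 1 u" and "u2 = tr (c + 1) 1 u1" and "v1 = tr (c + 1) 1 u" and "v2 = tr c 1 v1"
  have sts: "state u1" "state u2" "state v1" "state v2" unfolding u1_def u2_def v1_def v2_def using st state_tr by blast+
  have u1: "val u1 c y" "val u1 (c + 1) x" "val u1 (c + 1 + 1) z" unfolding u1_def
    using val_tr_left[OF 1 xy(2)] val_tr_right[OF xy(1), of 1] val_tr_other[OF nd(1,2) z(1)] by blast+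
  have u2: "val u2 c y" "val u2 (c + 1) z" unfolding u2_def
    using val_tr_left[OF 1 u1(3)] val_tr_other[OF nd(3,4) u1(1)] by blast+
  have v1: "val v1 c x" "val v1 (c + 1) z" "val v1 (c + 1 + 1) y" unfolding v1_def
    using val_tr_left[OF 1 z(1)] val_tr_right[OF xy(2), of 1] val_tr_other[OF nd(3,4) xy(1)] by blast+
  have v2: "val v2 (c + 1) x" "val v2 (c + 1 + 1) y" unfolding v2_def
    using val_tr_right[OF v1(1), of 1] val_tr_other[OF nd(1,2) v1(3)] by blast+
  have d: "descent u1 (c + 1)" "descent u2 c" "descent v1 c" "descent v2 (c + 1)"
    unfolding descent_def using sts u1 u2 v1 v2 xy(3) z(2) by (metis order.strict_trans)+
  have less: "spread u1 < spread u" "spread v1 < spread u" "spread u2 < spread u" "spread v2 < spread u"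
    using spread_less[OF N2 D(1)] spread_less[OF N2 D(2)] spread_less[OF N2 d(1)] spread_less[OF N2 d(3)]
    unfolding u1_def[symmetric] v1_def[symmetric] u2_def[symmetric] v2_def[symmetric] by linarith+
  have G1: "G u1 = eps u1 (c + 1) 1 * (eps u2 c 1 * G (tr c 1 u2))"
    using G[OF less(1) d(1)] G[OF less(3) d(2)] unfolding u2_def by simp
  have G2: "G v1 = eps v1 c 1 * (eps v2 (c + 1) 1 * G (tr (c + 1) 1 v2))"
    using G[OF less(2) d(3)] G[OF less(4) d(4)] unfolding v2_def by simp
  have w: "(0::int) < 1" "(0::int) < 1" "1 + 1 < N" using N3 by simp_all
  have v2': "v2 = tr c (1 + 1) u1" unfolding v2_def v1_def u1_def using tr_triple(1)[OF w] by simp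
  have end_eq: "tr c 1 u2 = tr (c + 1) 1 v2" unfolding u2_def v2' using tr_triple(2)[OF w] by simp
  have T1: "eps u (c + 1) 1 * eps v1 c 1 = eps u c 1 * eps u1 c (1 + 1)"
    using eps_triple(1)[OF st w] unfolding v1_def u1_def by simp
  have T2: "eps u1 (c + 1) 1 * eps u2 c 1 = eps u1 c (1 + 1) * eps v2 (c + 1) 1"
    using eps_triple(2)[OF sts(1) w] unfolding u2_def v2' by simp
  have "eps u c 1 * G u1 = eps u c 1 * (eps u1 (c + 1) 1 * eps u2 c 1) * G (tr c 1 u2)"
    unfolding G1 by (simp add: mult.assoc)
  also have "\<dots> = (eps u c 1 * eps u1 c (1 + 1)) * eps v2 (c + 1) 1 * G (tr c 1 u2)"
    unfolding T2 by (simp add: mult.assoc)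
  also have "\<dots> = eps u (c + 1) 1 * G v1" unfolding T1[symmetric] G2 end_eq by (simp add: mult.assoc)
  finally show ?thesis unfolding u1_def v1_def .
qed

text \<open>Two moves from one state are equal, commute, or generate a braid hexagon; these are the relations of the
  affine symmetric group. An edge that is not a descent is one in the opposite direction.\<close>

lemma eps_thin_coboundary:
  assumes N2: "1 < N"
  shows "\<exists>F. (\<forall>u c. state u \<longrightarrow> eps u c 1 = F u * F (tr c 1 u)) \<and> (\<forall>u. F u \<in> {1, -1})"
proof -
  have 1: "\<not> N dvd 1" using not_dvd_narrow N2 by simp
  have "\<exists>G. (\<forall>u c. descent u c \<longrightarrow> G u = eps u c 1 * G (tr c 1 u)) \<and> (\<forall>u. G u \<in> {1, -1})"
  proof (rule descent_potential[where \<mu> = spread])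
    show "spread (tr c 1 u) < spread u" if "descent u c" for u c using spread_less N2 that by blast
    show "eps u c 1 \<in> {1, -1}" if "descent u c" for u c
      using that eps_unit[of u 1 c] N2 unfolding descent_def by simp
    fix G u c c'
    assume D: "descent u c" "descent u c'"
      and G: "\<And>v d. spread v < spread u \<Longrightarrow> descent v d \<Longrightarrow> G v = eps v d 1 * G (tr d 1 v)"
    have st: "state u" using D unfolding descent_def by blast
    have shift: "eps u (d + x) 1 * G (tr (d + x) 1 u) = eps u d 1 * G (tr d 1 u)" if "N dvd x" for d x
      using eps_shift[OF st _ _ that, of 1 d] tr_shift[OF that, of d 1 u] N2 by simp
    consider "N dvd c' - c" | "N dvd c' - (c + 1)" | "N dvd c - (c' + 1)" |
      "\<not> N dvd c - c'" "\<not> N dvd c - (c' + 1)" "\<not> N dvd (c + 1) - c'"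
      using dvd_diff_commute by blast
    then show "eps u c 1 * G (tr c 1 u) = eps u c' 1 * G (tr c' 1 u)"
    proof cases
      case 1
      then show ?thesis using shift[of "c' - c" c] by simp
    next
      case 2
      have "descent u (c + 1)" using descent_shift[OF 2, of u "c + 1"] D(2) by simp
      then show ?thesis using braid_peak[OF D(1) _ N2 G] shift[OF 2, of "c + 1"] by simp
    next
      case 3
      have "descent u (c' + 1)" using descent_shift[OF 3, of u "c' + 1"] D(1) by simp
      then show ?thesis using braid_peak[OF D(2) _ N2 G] shift[OF 3, of "c' + 1"] by simp
    next
      case 4
      have nd: "\<not> N dvd c' - c" "\<not> N dvd c' - (c + 1)" "\<not> N dvd (c' + 1) - c" "\<not> N dvd (c' + 1) - (c + 1)" "\<not> N dvd (c + 1) - (c' + 1)"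
        using 4 dvd_diff_commute by (metis, metis, metis, metis add_diff_cancel_right, metis add_diff_cancel_right)
      have d1: "descent (tr c 1 u) c'" unfolding descent_def
        using D(2) st state_tr val_tr_other[OF nd(1,2)] val_tr_other[OF nd(3,4)] unfolding descent_def by blast
      have d2: "descent (tr c' 1 u) c" unfolding descent_def
        using D(1) st state_tr val_tr_other[OF 4(1,2)] val_tr_other[OF 4(3) nd(5)] unfolding descent_def by blast
      have "G (tr c 1 u) = eps (tr c 1 u) c' 1 * G (tr c' 1 (tr c 1 u))"
        using G[OF spread_less[OF N2 D(1)] d1] .
      moreover have "G (tr c' 1 u) = eps (tr c' 1 u) c 1 * G (tr c 1 (tr c' 1 u))"
        using G[OF spread_less[OF N2 D(2)] d2] .
      ultimately show ?thesis using eps_commute[OF st 4 N2] tr_commute[OF 4, of u]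
        by (simp flip: mult.assoc)
    qed
  qed
  then obtain G where G: "\<And>u c. descent u c \<Longrightarrow> G u = eps u c 1 * G (tr c 1 u)" "\<And>u. G u \<in> {1, -1}" by blast
  have "eps u c 1 = G u * G (tr c 1 u)" if st: "state u" for u c
  proof -
    have *: "eps v c 1 = G v * G (tr c 1 v)" if "descent v c" for v
      using G(1)[OF that] G(2)[of v] G(2)[of "tr c 1 v"] by auto
    show ?thesis
    proof (cases "descent u c")
      case False
      then have "descent (tr c 1 u) c" using descent_or_swapped[OF N2 st] by blast
      then have "eps (tr c 1 u) c 1 = G (tr c 1 u) * G u" using *[of "tr c 1 u"] tr_tr[OF 1] by simp
      then show ?thesis using eps_sym[OF st, of 1 c] N2 by (simp add: mult.commute)
    qed (rule *)
  qed
  then show ?thesis using G(2) by blast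
qed

end

context sign_quotient
begin

section \<open>The potential on all rectangles\<close>

text \<open>A transposition of columns at distance \<open>W\<close> is conjugate by a thin transposition to one at
  distance \<open>W - 1\<close>, and \<open>eps_triple\<close> is the corresponding relation.\<close>

lemma eps_coboundary:
  assumes F: "\<And>u c. state u \<Longrightarrow> eps u c 1 = F u * F (tr c 1 u)" "\<And>u. F u \<in> {1, -1}"
    and st: "state u" and W: "0 < W" "W < N"
  shows "eps u c W = F u * F (tr c W u)"
  using W st
proof (induction "nat W" arbitrary: W u c rule: less_induct)
  case less
  show ?case
  proof (cases "W = 1")
    case True
    then show ?thesis using F(1) less.prems by simp
  next
    case False
    let ?w = "W - 1"
    have w: "0 < ?w" "(0::int) < 1" "?w + 1 < N" using False less.prems by auto
    have st': "state (tr (c + ?w) 1 u)" using less.prems state_tr by blast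
    have IH: "eps (tr (c + ?w) 1 u) c ?w = F (tr (c + ?w) 1 u) * F (tr c ?w (tr (c + ?w) 1 u))"
      using less.hyps[of ?w] w st' less.prems by simp
    have e1: "eps u (c + ?w) 1 = F u * F (tr (c + ?w) 1 u)" using F(1) less.prems by blast
    have e2: "eps (tr c W u) (c + ?w) 1 = F (tr c W u) * F (tr c ?w (tr (c + ?w) 1 u))"
      using F(1)[of "tr c W u" "c + ?w"] state_tr less.prems tr_triple(2)[OF w, of c u] by simp
    have "eps u (c + ?w) 1 * eps (tr (c + ?w) 1 u) c ?w = eps u c W * eps (tr c W u) (c + ?w) 1"
      using eps_triple(2)[OF less.prems(3) w, of c] by simp
    then show ?thesis unfolding e1 e2 IH
      using F(2)[of u] F(2)[of "tr (c + ?w) 1 u"] F(2)[of "tr c W u"] F(2)[of "tr c ?w (tr (c + ?w) 1 u)"]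
      by auto
  qed
qed

text \<open>Write a width above \<open>N\<close> as \<open>l1 + w\<close> with \<open>l1\<close> divisible by \<open>N\<close> and \<open>0 < w < N\<close>. The fold expresses the value
  on the rectangle by values on rectangles of widths \<open>w\<close> and \<open>l1 - w\<close>.\<close>

lemma omega_coboundary:
  assumes F: "\<And>u c. state u \<Longrightarrow> eps u c 1 = F u * F (tr c 1 u)" "\<And>u. F u \<in> {1, -1}"
    and r: "rc u c b W H"
  shows "omega u c b W H = F u * F (tr c W u)"
  using r
proof (induction "nat W" arbitrary: u c b W H rule: less_induct)
  case less
  note r = less.prems[unfolded rc_def]
  show ?case
  proof (cases "W < N")
    case True
    then show ?thesis using eps_eq[OF less.prems] eps_coboundary[OF F, where u = u and c = c] r by simp
  next
    case False
    define w where "w = W mod N"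
    define l1 where "l1 = W - w"
    have nW: "\<not> N dvd W" using rc_not_dvd less.prems by blast
    have "0 \<le> w" "w \<noteq> 0" unfolding w_def using nW N_pos by (simp, metis dvd_eq_mod_eq_0)
    moreover have "w < N" unfolding w_def using N_pos by simp
    ultimately have w: "0 < w" "w < N" by simp_all
    have l1: "N dvd l1" unfolding l1_def w_def by (rule dvd_minus_mod)
    have l1': "0 < l1" unfolding l1_def using False w by linarith
    note l1 = l1 l1'
    have W: "W = l1 + w" unfolding l1_def by simp
    have nd: "\<not> N dvd w" using not_dvd_narrow w by blast
    have pN: "p * N > 0" using p_pos N_pos by simp
    have Wb: "W < p * N" using emb_bounds(1)[of W H] r by simp
    obtain y0 where y0: "lat l1 y0" using lat_ex_right l1 by blast
    define l2 where "l2 = y0 mod (p * N)"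
    have "lat 0 (y0 - l2)" unfolding lat_vert l2_def by (simp add: dvd_minus_mod)
    then have l: "lat l1 l2" using lat_diff[OF y0] by fastforce
    have l2: "0 \<le> l2" "l2 < p * N" unfolding l2_def using pN by simp_all
    have "l2 \<noteq> 0"
    proof
      assume "l2 = 0"
      then have "p * N dvd l1" using l lat_horiz by simp
      then show False using not_dvd_period[of l1] l1 Wb W w by linarith
    qed
    then have l2': "0 < l2" using l2 by simp
    define x where "x = tr c w u"
    have x: "state x" "tr c w x = u" unfolding x_def using r state_tr tr_tr[OF nd] by simp_all
    have r2: "rc (tr c w x) c b (l1 + w) H" using less.prems W x by simp
    note cfg = fold_configuration[OF r2 w l l1(2) l2' l2(2) x(1)]
    have a1: "omega x c (b + H - l2) w (l2 - H) = F x * F u"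
      using less.hyps[of w, OF _ cfg(6)] w W l1 x by simp
    have a3: "omega x (c + w) b (l1 - w) H = F x * F (tr (c + w) (l1 - w) x)"
      by (rule less.hyps[OF _ cfg(7)]) (use cfg(3) w W in simp)
    have a4: "omega (tr (c + w) (l1 - w) x) c (b - l2) w (H + l2) = F (tr (c + w) (l1 - w) x) * F (tr c w (tr (c + w) (l1 - w) x))"
      by (rule less.hyps[OF _ cfg(8)]) (use w W l1 in simp)
    have z: "tr c w (tr (c + w) (l1 - w) x) = tr c W u"
    proof -
      have "tr c (l1 + w) (tr c w x) = tr c w (tr (c + w) (l1 - w) x)"
        unfolding tr_def using col_tr_fold[OF nd l1(1)] by auto
      then show ?thesis using W x by simp
    qed
    have "(F x * F u) * omega u c b W H = (F x * F (tr (c + w) (l1 - w) x)) * (F (tr (c + w) (l1 - w) x) * F (tr c W u))"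
      using omega_fold[OF r2 w l l1(2) l2' l2(2) x(1)] a1 a3 a4 unfolding z x(2) W[symmetric] by simp
    then show ?thesis
      using F(2)[of u] F(2)[of x] F(2)[of "tr (c + w) (l1 - w) x"] F(2)[of "tr c W u"] by auto
  qed
qed

section \<open>Descent of the potential to generators\<close>

definition shift_pair :: "nat \<Rightarrow> nat \<Rightarrow> (nat \<Rightarrow> int) \<Rightarrow> nat \<Rightarrow> int" where
  "shift_pair i j u = (\<lambda>k. if k = i then u k + p * N else if k = j then u k - p * N else u k)"

text \<open>The points on the rows \<open>i\<close> and \<open>j\<close> span a rectangle of height \<open>j - i\<close>, less than \<open>N\<close>, which is therefore
  embedded. Together with its complement in the horizontal annulus it shifts the two entries.\<close>

lemma potential_shift_less:
  assumes F: "\<And>u c b W H. rc u c b W H \<Longrightarrow> omega u c b W H = F u * F (tr c W u)" "\<And>u. F u \<in> {1, -1}"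
    and st: "state u" and ij: "i < j" "j < n"
  shows "F (shift_pair i j u) = F u"
proof -
  have pN: "p * N > 0" using p_pos N_pos by simp
  define W where "W = (u j - u i) mod (p * N)"
  have W: "0 \<le> W" "W < p * N" unfolding W_def using pN by simp_all
  have dW: "p * N dvd u i + W - u j"
  proof -
    have "p * N dvd (u j - u i) - W" unfolding W_def by (simp add: dvd_minus_mod)
    moreover have "u i + W - u j = - ((u j - u i) - W)" by simp
    ultimately show ?thesis by (simp only: dvd_minus_iff)
  qed
  have nij: "\<not> N dvd u i - u j" using state_inj[OF st, of i j] ij by auto
  have NdW: "N dvd u i + W - u j" using dW dvd_mult_right by blast
  have nW: "\<not> N dvd W" using nij dvd_lin[OF NdW, of W "u i - u j" 1 "-1"] by auto
  have Wp: "0 < W" using W nW by (cases "W = 0") auto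
  define H where "H = int j - int i"
  have H: "0 < H" "H < N" unfolding H_def using ij by auto
  have on1: "on u (u i) (int i)" using on_strand ij by simp
  have "on u (u j) (int j)" using on_strand ij by simp
  then have on2: "on u (u i + W) (int i + H)"
    by (rule on_latI) (use dW lat_horiz H_def in simp)
  have r: "rc u (u i) (int i) W H" unfolding rc_def using st Wp H on1 on2 emb_low[OF H(2) W(2)] by blast
  note h = omega_horizontal[OF r H(2)]
  have cols: "N dvd u k - u i \<longleftrightarrow> k = i" "N dvd u k - (u i + W) \<longleftrightarrow> k = j" if k: "k < n" for k
  proof -
    show "N dvd u k - u i \<longleftrightarrow> k = i" using state_inj[OF st k, of i] ij by auto
    have "N dvd u k - (u i + W) \<longleftrightarrow> N dvd u k - u j"
    proof -
      have "u k - u j = (u k - (u i + W)) + (u i + W - u j)" by simp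
      then show ?thesis using dvd_add_left_iff[OF NdW] by metis
    qed
    then show "N dvd u k - (u i + W) \<longleftrightarrow> k = j" using state_inj[OF st k, of j] ij by auto
  qed
  have eq: "tr (u i + W) (p * N - W) (tr (u i) W u) = shift_pair i j u"
  proof
    fix k
    show "tr (u i + W) (p * N - W) (tr (u i) W u) k = shift_pair i j u k"
    proof (cases "k < n")
      case True
      have "tr (u i + W) (p * N - W) (tr (u i) W u) k = col_tr (u i + W) (p * N - W) (col_tr (u i) W (u k))"
        unfolding tr_def using True by simp
      also have "\<dots> = shift_pair i j u k"
        unfolding col_tr_round[OF nW dvd_triv_right] cols[OF True] shift_pair_def ..
      finally show ?thesis .
    qed (use ij in \<open>simp add: tr_def shift_pair_def\<close>)
  qed
  have "(F u * F (tr (u i) W u)) * (F (tr (u i) W u) * F (shift_pair i j u)) = 1"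
    using h(1) F(1)[OF r] F(1)[OF h(2)] unfolding eq by simp
  then show ?thesis using F(2)[of u] F(2)[of "tr (u i) W u"] F(2)[of "shift_pair i j u"] by auto
qed

lemma state_shift_pair:
  assumes "state u" "i < n" "j < n" shows "state (shift_pair i j u)"
proof -
  have d: "N dvd shift_pair i j u k - u k" for k unfolding shift_pair_def by simp
  have "N dvd u k - u l" if "N dvd shift_pair i j u k - shift_pair i j u l" for k l
    using dvd_congruent[OF d d that] .
  then have "\<forall>k<n. \<forall>l<n. N dvd shift_pair i j u k - shift_pair i j u l \<longrightarrow> k = l"
    using state_inj[OF assms(1)] by blast
  moreover have "\<forall>k\<ge>n. shift_pair i j u k = 0" using assms unfolding state_def shift_pair_def by auto
  ultimately show ?thesis unfolding state_def by blast
qed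

lemma potential_shift:
  assumes F: "\<And>u c b W H. rc u c b W H \<Longrightarrow> omega u c b W H = F u * F (tr c W u)" "\<And>u. F u \<in> {1, -1}"
    and st: "state u" and ij: "i \<noteq> j" "i < n" "j < n"
  shows "F (shift_pair i j u) = F u"
proof (cases "i < j")
  case True
  then show ?thesis using potential_shift_less[OF F st] ij by blast
next
  case False
  have "shift_pair j i (shift_pair i j u) = u" unfolding shift_pair_def using ij by auto
  then show ?thesis using potential_shift_less[OF F state_shift_pair[OF st ij(2,3)], of j i] False ij by simp
qed

text \<open>The difference of the two lifts has sum zero and entries divisible by \<open>p N\<close>, so it is a sum of the
  shifts above. Each step below moves a too small and a too large entry towards each other.\<close>

lemma potential_periodic:
  assumes F: "\<And>u c b W H. rc u c b W H \<Longrightarrow> omega u c b W H = F u * F (tr c W u)" "\<And>u. F u \<in> {1, -1}"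
    and st: "state u" "state v" and per: "\<And>k. k < n \<Longrightarrow> p * N dvd u k - v k" and sum: "(\<Sum>k<n. u k) = (\<Sum>k<n. v k)"
  shows "F u = F v"
  using st(1) per sum
proof (induction "nat (\<Sum>k<n. \<bar>u k - v k\<bar>)" arbitrary: u rule: less_induct)
  case less
  show ?case
  proof (cases "\<forall>k<n. u k = v k")
    case True
    then have "u = v" using less.prems(1) st(2) unfolding state_def by (metis ext not_le)
    then show ?thesis by simp
  next
    case False
    have pN: "p * N > 0" using p_pos N_pos by simp
    have s0: "(\<Sum>k<n. u k - v k) = 0" using less.prems(3) by (simp add: sum_subtractf)
    have "\<exists>i<n. u i < v i"
    proof (rule ccontr)
      assume "\<not> (\<exists>i<n. u i < v i)"
      then have nn: "\<forall>k\<in>{..<n}. 0 \<le> u k - v k" by auto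
      then have "\<forall>k\<in>{..<n}. u k - v k = 0" using s0 sum_nonneg_eq_0_iff[of "{..<n}" "\<lambda>k. u k - v k"] by blast
      then show False using False by auto
    qed
    then obtain i where i: "i < n" "u i < v i" by blast
    have "\<exists>j<n. v j < u j"
    proof (rule ccontr)
      assume "\<not> (\<exists>j<n. v j < u j)"
      then have nn: "\<forall>k\<in>{..<n}. 0 \<le> v k - u k" by auto
      have "(\<Sum>k<n. v k - u k) = 0" using less.prems(3) by (simp add: sum_subtractf)
      then have "\<forall>k\<in>{..<n}. v k - u k = 0" using nn sum_nonneg_eq_0_iff[of "{..<n}" "\<lambda>k. v k - u k"] by blast
      then show False using False by auto
    qed
    then obtain j where j: "j < n" "v j < u j" by blast
    have ij: "i \<noteq> j" using i j by auto
    define u' where "u' = shift_pair i j u"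
    have st': "state u'" unfolding u'_def using state_shift_pair less.prems(1) i j by blast
    have ui: "u' i = u i + p * N" "u' j = u j - p * N" and uo: "\<And>k. k \<noteq> i \<Longrightarrow> k \<noteq> j \<Longrightarrow> u' k = u k"
      unfolding u'_def shift_pair_def using ij by auto
    have bi: "u i + p * N \<le> v i" and bj: "v j + p * N \<le> u j"
    proof -
      have "p * N dvd v i - u i" using less.prems(2)[OF i(1)] by (simp add: dvd_diff_commute)
      then show "u i + p * N \<le> v i" using zdvd_imp_le[of "p * N" "v i - u i"] i by simp
      show "v j + p * N \<le> u j" using zdvd_imp_le[OF less.prems(2)[OF j(1)]] j by simp
    qed
    have split: "(\<Sum>k<n. f k) = f i + f j + (\<Sum>k\<in>{..<n} - {i} - {j}. f k)" for f :: "nat \<Rightarrow> int"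
      using sum.remove[of "{..<n}" i f] sum.remove[of "{..<n} - {i}" j f] i(1) j(1) ij by simp
    have rest: "(\<Sum>k\<in>{..<n} - {i} - {j}. f (u' k) k) = (\<Sum>k\<in>{..<n} - {i} - {j}. f (u k) k)" for f :: "int \<Rightarrow> nat \<Rightarrow> int"
      by (rule sum.cong) (use uo in auto)
    have "(\<Sum>k<n. u' k) = (\<Sum>k<n. u k)"
      unfolding split[of u'] split[of u] using rest[of "\<lambda>x k. x"] ui by simp
    then have sum': "(\<Sum>k<n. u' k) = (\<Sum>k<n. v k)" using less.prems(3) by simp
    have per': "p * N dvd u' k - v k" if "k < n" for k
    proof -
      have "u' k - v k = (u k - v k) + (if k = i then p * N else if k = j then - (p * N) else 0)"
        unfolding u'_def shift_pair_def by simp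
      moreover have "p * N dvd (if k = i then p * N else if k = j then - (p * N) else 0)" by simp
      ultimately show ?thesis using less.prems(2)[OF that] by (simp only: dvd_add)
    qed
    have "(\<Sum>k<n. \<bar>u' k - v k\<bar>) < (\<Sum>k<n. \<bar>u k - v k\<bar>)"
      unfolding split[of "\<lambda>k. \<bar>u' k - v k\<bar>"] split[of "\<lambda>k. \<bar>u k - v k\<bar>"]
      using rest[of "\<lambda>x k. \<bar>x - v k\<bar>"] ui bi bj pN by simp
    moreover have "0 \<le> (\<Sum>k<n. \<bar>u' k - v k\<bar>)" by (simp add: sum_nonneg)
    ultimately have "nat (\<Sum>k<n. \<bar>u' k - v k\<bar>) < nat (\<Sum>k<n. \<bar>u k - v k\<bar>)" by linarith
    then have "F u' = F v" using less.hyps[OF _ st' per' sum'] by blast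
    moreover have "F u' = F u" unfolding u'_def using potential_shift[OF F less.prems(1) ij i(1) j(1)] .
    ultimately show ?thesis by simp
  qed
qed

lemma sum_tr:
  assumes "rc u c b W H" shows "(\<Sum>k<n. tr c W u k) = (\<Sum>k<n. u k)"
proof -
  have st: "state u" using assms unfolding rc_def by blast
  have nW: "\<not> N dvd W" using rc_not_dvd assms by blast
  obtain i where i: "i < n" "N dvd u i - c" using strand_ex[OF st] by blast
  obtain j where j: "j < n" "N dvd u j - (c + W)" using strand_ex[OF st] by blast
  have nj: "\<not> N dvd u j - c" using nW dvd_lin[OF j(2), of "u j - c" W "-1" 1] by auto
  have ij: "i \<noteq> j" using i nj by blast
  have split: "(\<Sum>k<n. f k) = f i + f j + (\<Sum>k\<in>{..<n} - {i} - {j}. f k)" for f :: "nat \<Rightarrow> int"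
    using sum.remove[of "{..<n}" i f] sum.remove[of "{..<n} - {i}" j f] i(1) j(1) ij by simp
  have "tr c W u k = u k" if k: "k \<in> {..<n} - {i} - {j}" for k
  proof -
    have "\<not> N dvd u k - c" "\<not> N dvd u k - (c + W)"
      using k i j state_inj[OF st] dvd_shift[of "u k" c "u i"] dvd_shift[of "u k" "c + W" "u j"]
      by (metis DiffE dvd_diff_commute lessThan_iff singletonI)+
    then show ?thesis unfolding tr_alt by simp
  qed
  then have "(\<Sum>k\<in>{..<n} - {i} - {j}. tr c W u k) = (\<Sum>k\<in>{..<n} - {i} - {j}. u k)" by (rule sum.cong[OF refl])
  moreover have "tr c W u i = u i + W" "tr c W u j = u j - W" using i j nj unfolding tr_alt by auto
  ultimately show ?thesis unfolding split[of "tr c W u"] split[of u] by simp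
qed

text \<open>Rectangles preserve the sum of the entries of a state (\<open>sum_tr\<close>), so lifts whose sum
  lies between \<open>0\<close> and \<open>p N - 1\<close> are compatible with all rectangles.\<close>

lemma normalized_lift_ex:
  assumes "x \<in> gens g" shows "\<exists>u. state u \<and> gen u = x \<and> (\<Sum>k<n. u k) div (p * N) = 0"
proof -
  obtain u where u: "state u" "gen u = x" using gens_ex assms by blast
  have n0: "0 < n" using N_pos by simp
  have pN: "p * N > 0" using p_pos N_pos by simp
  define m where "m = (\<Sum>k<n. u k) div (p * N)"
  define v where "v = (\<lambda>k. if k = 0 then u k - p * N * m else u k)"
  have vk: "v k = u k \<or> v k = u k - p * N * m" for k unfolding v_def by simp
  have st: "state v"
  proof -
    have "N dvd u i - u j" if "N dvd v i - v j" for i j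
    proof -
      have "N dvd v i - u i" "N dvd v j - u j" unfolding v_def by auto
      then show ?thesis using that by (rule dvd_congruent)
    qed
    then have "\<forall>i<n. \<forall>j<n. N dvd v i - v j \<longrightarrow> i = j" using state_inj[OF u(1)] by blast
    moreover have "\<forall>k\<ge>n. v k = 0" using u(1) n0 unfolding state_def v_def by auto
    ultimately show ?thesis unfolding state_def by blast
  qed
  have "gen v = x" using gen_eq_iff[OF st u(1)] vk u(2) by (auto simp: v_def)
  moreover have "(\<Sum>k<n. v k) = (\<Sum>k<n. u k) - p * N * m"
  proof -
    have "(\<Sum>k<n. v k) = v 0 + (\<Sum>k\<in>{..<n} - {0}. v k)" "(\<Sum>k<n. u k) = u 0 + (\<Sum>k\<in>{..<n} - {0}. u k)"
      using n0 by (simp_all add: sum.remove)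
    moreover have "(\<Sum>k\<in>{..<n} - {0}. v k) = (\<Sum>k\<in>{..<n} - {0}. u k)" by (rule sum.cong) (auto simp: v_def)
    ultimately show ?thesis by (simp add: v_def)
  qed
  then have "(\<Sum>k<n. v k) div (p * N) = 0" unfolding m_def by (simp add: minus_mult_div_eq_mod)
  ultimately show ?thesis using st by blast
qed

text \<open>The potential \<open>F\<close> on normalized lifts depends only on the generator. For \<open>N = 1\<close> there are no
  rectangles.\<close>

lemma omega_gauge:
  "\<exists>f. (\<forall>x. f x \<in> {1, -1}) \<and> (\<forall>u c b W H. rc u c b W H \<longrightarrow> omega u c b W H = f (gen u) * f (gen (tr c W u)))"
proof (cases "1 < N")
  case False
  have "N = 1" using False N_pos by linarith
  then have "\<not> rc u c b W H" for u c b W H using rc_not_dvd(1)[of u c b W H] by auto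
  then show ?thesis by (intro exI[of _ "\<lambda>x. 1"]) simp
next
  case True
  obtain F where F: "\<And>u c. state u \<Longrightarrow> eps u c 1 = F u * F (tr c 1 u)" "\<And>u. F u \<in> {1, -1::int}"
    using eps_thin_coboundary[OF True] by blast
  have FF: "omega u c b W H = F u * F (tr c W u)" if "rc u c b W H" for u c b W H
    by (rule omega_coboundary[where F = F]) (use F that in blast)+
  have pN: "p * N > 0" using p_pos N_pos by simp
  define lift where "lift x = (SOME u. state u \<and> gen u = x \<and> (\<Sum>k<n. u k) div (p * N) = 0)" for x
  have lift: "state (lift x)" "gen (lift x) = x" "(\<Sum>k<n. lift x k) div (p * N) = 0" if "x \<in> gens g" for x
    using someI_ex[OF normalized_lift_ex[OF that]] unfolding lift_def by blast+
  \<comment> \<open>Two normalized lifts have congruent sums in the same period, hence equal sums.\<close>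
  have Flift: "F u = F (lift (gen u))" if st: "state u" and nrm: "(\<Sum>k<n. u k) div (p * N) = 0" for u
  proof -
    have g: "gen u \<in> gens g" using gen_in_gens st by blast
    have per: "\<And>k. k < n \<Longrightarrow> p * N dvd u k - lift (gen u) k" using gen_eq_iff[OF st lift(1)[OF g]] lift(2)[OF g] by simp
    have "p * N dvd (\<Sum>k<n. u k - lift (gen u) k)" by (rule dvd_sum) (use per in auto)
    then have "(\<Sum>k<n. u k) mod (p * N) = (\<Sum>k<n. lift (gen u) k) mod (p * N)"
      by (simp add: sum_subtractf mod_eq_dvd_iff)
    then have "(\<Sum>k<n. u k) = (\<Sum>k<n. lift (gen u) k)" using nrm lift(3)[OF g] by (metis div_mult_mod_eq)
    then show ?thesis by (intro potential_periodic[where F = F]) (use FF F(2) st lift(1)[OF g] per in blast)+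
  qed
  have "omega u c b W H = F (lift (gen u)) * F (lift (gen (tr c W u)))" if r: "rc u c b W H" for u c b W H
  proof -
    have g: "gen u \<in> gens g" using rc_gens r by blast
    define v where "v = lift (gen u)"
    have v: "state v" "gen v = gen u" "(\<Sum>k<n. v k) div (p * N) = 0" unfolding v_def using lift[OF g] by blast+
    have on: "on v d e \<longleftrightarrow> on u d e" for d e unfolding on_iff v(2) by simp
    have rv: "rc v c b W H" using r v(1) unfolding rc_def on by simp
    have "gen (tr c W v) = gen (tr c W u)"
    proof -
      have "A = (B - (B - A)) \<union> (A - B)" for A B :: gen by blast
      then show ?thesis using gen_tr_diff[OF r] gen_tr_diff[OF rv] v(2) by metis
    qed
    moreover have "card (others v c W (box c b W H)) = card (others u c W (box c b W H))"
    proof -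
      have "p * N dvd v k - u k" if "k < n" for k using gen_eq_iff[of v u] v r that unfolding rc_def by blast
      then have d: "N dvd v k - u k" and i: "ipt (v k) (int k) = ipt (u k) (int k)" if "k < n" for k
        using that dvd_mult_right lat_horiz unfolding ipt_eq by auto
      have "others v c W (box c b W H) = others u c W (box c b W H)" unfolding others_def
        by (rule Collect_cong) (use i dvd_shift[OF d] in metis)
      then show ?thesis by simp
    qed
    ultimately have "omega u c b W H = omega v c b W H" unfolding omega_def v(2) by simp
    also have "\<dots> = F v * F (tr c W v)" by (rule FF[OF rv])
    also have "F (tr c W v) = F (lift (gen (tr c W v)))"
      by (rule Flift) (use state_tr v sum_tr[OF rv] in auto)
    finally show ?thesis unfolding v_def[symmetric] \<open>gen (tr c W v) = gen (tr c W u)\<close> .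
  qed
  then show ?thesis using F(2) by (intro exI[of _ "\<lambda>x. F (lift x)"]) blast
qed

end

context sign_quotient
begin

section \<open>The isomorphism of homologies\<close>

text \<open>A point in the closed rectangle that is no corner lies in its interior: each side lies on a circle whose only
  point in the generator is a corner.\<close>

lemma others_empty:
  assumes r: "rc u c b W H" and e: "tor ` open_pgram g (of_int c) (of_int b) (of_int W) (of_int H) \<inter> gen u = {}"
  shows "others u c W (box c b W H) = {}"
proof (rule ccontr)
  assume "others u c W (box c b W H) \<noteq> {}"
  then obtain k where k: "k < n" "\<not> N dvd u k - c" "\<not> N dvd u k - (c + W)" "ipt (u k) (int k) \<in> box c b W H"
    unfolding others_def by blast
  then obtain x y where xy: "lat x y" "c \<le> u k + x" "u k + x \<le> c + W" "b \<le> int k + y" "int k + y \<le> b + H"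
    unfolding ipt_def mem_box_int by blast
  have on: "on u (u k + x) (int k + y)" using on_lat[OF xy(1)] on_strand[OF k(1)] by blast
  have Nx: "N dvd x" using lat_dvd xy by blast
  have c1: "\<not> N dvd u k + x - c" "\<not> N dvd u k + x - (c + W)"
    using k(2,3) dvd_lin[OF _ Nx, of "u k + x - c" "u k - c" 1 "-1"] dvd_lin[OF _ Nx, of "u k + x - (c + W)" "u k - (c + W)" 1 "-1"] by auto
  have "u k + x \<noteq> c" "u k + x \<noteq> c + W" using c1 by auto
  moreover have "int k + y \<noteq> b" "int k + y \<noteq> b + H"
    using on_diff_rows(1)[OF on _ c1(1), of b] on_diff_rows(1)[OF on _ c1(2), of "b + H"] r unfolding rc_def by auto
  ultimately have "c < u k + x" "u k + x < c + W" "b < int k + y" "int k + y < b + H" using xy by auto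
  then have "gvec g (of_int (u k + x), of_int (int k + y)) \<in> open_pgram g (of_int c) (of_int b) (of_int W) (of_int H)"
    unfolding open_pgram_def by (intro imageI) (simp flip: of_int_add)
  then have "ipt (u k + x) (int k + y) \<in> tor ` open_pgram g (of_int c) (of_int b) (of_int W) (of_int H)"
    unfolding ipt_def pt_def by blast
  then show False using e on on_iff by blast
qed

text \<open>On empty rectangles without \<open>X\<close> and \<open>XX\<close> marks the sign correction is trivial.\<close>

lemma gauge_on_counted_rectangles:
  "\<exists>f. (\<forall>x. f x \<in> {1, -1}) \<and> (\<forall>x\<in>gens g. \<forall>y\<in>gens g. \<forall>r\<in>empty_Rect g x y.
     card (marks \<inter> r) = 0 \<longrightarrow> Q x y r = f x * f y)"
proof -
  obtain f where f: "\<And>x. f x \<in> {1, -1::int}" "\<And>u c b W H. rc u c b W H \<Longrightarrow> omega u c b W H = f (gen u) * f (gen (tr c W u))"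
    using omega_gauge by blast
  have "Q x y r = f x * f y" if x: "x \<in> gens g" and y: "y \<in> gens g" and r: "r \<in> empty_Rect g x y" and m: "card (marks \<inter> r) = 0" for x y r
  proof -
    obtain u where u: "state u" "gen u = x" using gens_ex x by blast
    obtain a b w h where r': "r = tor ` pgram g a b w h" "is_rect g (gen u) y a b w h"
      "tor ` open_pgram g a b w h \<inter> (gen u \<union> y) = {}"
      using r u unfolding empty_Rect_def by blast
    obtain c e W H where ce: "a = of_int c" "b = of_int e" "w = of_int W" "h = of_int H" "rc u c e W H" "y = gen (tr c W u)"
      using is_rect_rc[OF u(1) y r'(2)] by blast
    have rb: "r = box c e W H" unfolding r'(1) ce box_def ..
    have "others u c W (box c e W H) = {}" by (rule others_empty[OF ce(5)]) (use r'(3) ce in blast)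
    then have "omega u c e W H = Q x y r" unfolding omega_def using m rb u ce by simp
    then show ?thesis using f(2)[OF ce(5)] u ce by simp
  qed
  then show ?thesis using f(1) by blast
qed

end

lemma keys_uminus_upoly: "Poly_Mapping.keys (- (f :: upoly)) = Poly_Mapping.keys f"
  by (simp add: keys.rep_eq uminus_poly_mapping.rep_eq)

text \<open>Multiplication of the coefficients by \<open>f\<close> intertwines the differentials, commutes with scalars and
  does not change the monomials that occur. So it preserves bidegrees, and the shifts of the relative bigrading
  can be taken to be zero.\<close>

lemma gauge_isomorphic_homology:
  fixes f :: "gen \<Rightarrow> int"
  assumes f: "\<And>x. f x \<in> {1, -1}"
    and S': "\<And>x y r. x \<in> gens g \<Longrightarrow> y \<in> gens g \<Longrightarrow> r \<in> empty_Rect g x y \<Longrightarrow>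
      card ((mX g \<union> mXX g) \<inter> r) = 0 \<Longrightarrow> S' x y r = f x * f y * S x y r"
  shows "isomorphic_homology g V R S S'"
proof -
  define h :: "gen \<Rightarrow> upoly" where "h x = of_int (f x)" for x
  have h: "h x = 1 \<or> h x = -1" for x using f[of x] unfolding h_def by auto
  have hh: "h x * h x = 1" for x using h[of x] by auto
  define \<Phi> :: "(gen \<Rightarrow> upoly) \<Rightarrow> gen \<Rightarrow> upoly" where "\<Phi> c = (\<lambda>x. h x * c x)" for c
  have inv: "\<Phi> (\<Phi> c) = c" for c unfolding \<Phi>_def using hh by (simp flip: mult.assoc)
  have inj: "inj \<Phi>" by (rule inj_on_inverseI[of _ \<Phi>]) (rule inv)
  have add: "\<Phi> (\<lambda>x. c x + d x) = (\<lambda>x. \<Phi> c x + \<Phi> d x)" for c d unfolding \<Phi>_def by (simp add: distrib_left)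
  have scale: "\<Phi> (\<lambda>x. a * c x) = (\<lambda>x. a * \<Phi> c x)" for a c unfolding \<Phi>_def by (simp add: mult.left_commute)
  have zero: "\<Phi> (\<lambda>x. 0) = (\<lambda>x. 0)" unfolding \<Phi>_def by simp
  have keys: "Poly_Mapping.keys (\<Phi> c x) = Poly_Mapping.keys (c x)" for c x
    unfolding \<Phi>_def using h[of x] keys_uminus_upoly by auto
  have carrier: "\<Phi> c \<in> carrier (cfk g V)" if "c \<in> carrier (cfk g V)" for c
    using that keys[of c] unfolding cfk_def poly_ring_def by (auto simp: \<Phi>_def)
  have coeff: "diff_coeff g V S' x y = h x * h y * diff_coeff g V S x y" if "x \<in> gens g" "y \<in> gens g" for x y
    unfolding diff_coeff_def sum_distrib_left
    by (rule sum.cong) (use S'[OF that] in \<open>auto simp: h_def mult.assoc\<close>)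
  have diff: "cfk_diff g V S' (\<Phi> c) = \<Phi> (cfk_diff g V S c)" for c
  proof
    fix y
    show "cfk_diff g V S' (\<Phi> c) y = \<Phi> (cfk_diff g V S c) y"
    proof (cases "y \<in> gens g")
      case True
      have "(\<Sum>x\<in>gens g. \<Phi> c x * diff_coeff g V S' x y) = (\<Sum>x\<in>gens g. h y * (c x * diff_coeff g V S x y))"
      proof (rule sum.cong)
        fix x assume x: "x \<in> gens g"
        have "\<Phi> c x * diff_coeff g V S' x y = (h x * h x) * (h y * (c x * diff_coeff g V S x y))"
          unfolding coeff[OF x True] \<Phi>_def by (simp add: mult_ac)
        then show "\<Phi> c x * diff_coeff g V S' x y = h y * (c x * diff_coeff g V S x y)" unfolding hh by simp
      qed simp
      then show ?thesis unfolding cfk_diff_def \<Phi>_def using True by (simp add: sum_distrib_left)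
    qed (simp add: cfk_diff_def \<Phi>_def)
  qed
  have image_eq: "\<Phi> ` A = B" if "\<And>c. c \<in> A \<Longrightarrow> \<Phi> c \<in> B" "\<And>c. c \<in> B \<Longrightarrow> \<Phi> c \<in> A" for A B
  proof (intro equalityI subsetI)
    fix c assume "c \<in> B"
    then have "\<Phi> (\<Phi> c) \<in> \<Phi> ` A" using that(2) by blast
    then show "c \<in> \<Phi> ` A" unfolding inv .
  qed (use that(1) in blast)
  have carrier_image: "\<Phi> ` carrier (cfk g V) = carrier (cfk g V)" by (rule image_eq) (use carrier in auto)
  have diff0: "cfk_diff g V S (\<Phi> c) = \<Phi> (cfk_diff g V S' c)" for c
    using diff[of "\<Phi> c"] inv by metis
  define Z Z' B B' where "Z = cfk_cycles g V S" and "Z' = cfk_cycles g V S'"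
    and "B = cfk_boundaries g V S" and "B' = cfk_boundaries g V S'"
  have ker: "c \<in> cfk_cycles g V T \<longleftrightarrow> c \<in> carrier (cfk g V) \<and> cfk_diff g V T c = (\<lambda>x. 0)" for c T
    unfolding cfk_cycles_def kernel_def by (simp add: cfk_def)
  have Z: "\<Phi> ` Z = Z'"
    unfolding Z_def Z'_def by (rule image_eq) (use ker carrier diff diff0 zero in auto)
  have B: "\<Phi> ` B = B'"
  proof -
    have "\<Phi> ` B = (\<lambda>c. cfk_diff g V S' (\<Phi> c)) ` carrier (cfk g V)"
      unfolding B_def cfk_boundaries_def diff image_image ..
    also have "\<dots> = cfk_diff g V S' ` \<Phi> ` carrier (cfk g V)" by (simp add: image_image)
    finally show ?thesis unfolding carrier_image B'_def cfk_boundaries_def .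
  qed
  have coset: "\<Phi> ` (B #>\<^bsub>cfk g V\<^esub> c) = B' #>\<^bsub>cfk g V\<^esub> \<Phi> c" for c
    unfolding B[symmetric] r_coset_def by (simp add: cfk_def image_UN add)
  have setmult: "\<Phi> ` (X <#>\<^bsub>cfk g V\<^esub> Y) = (\<Phi> ` X) <#>\<^bsub>cfk g V\<^esub> (\<Phi> ` Y)" for X Y
    unfolding set_mult_def by (simp add: cfk_def image_UN add)
  have hom_carrier: "carrier (grid_homology g V T) = (\<lambda>c. cfk_boundaries g V T #>\<^bsub>cfk g V\<^esub> c) ` cfk_cycles g V T" for T
    unfolding grid_homology_def FactGroup_def RCOSETS_def r_coset_def by auto
  have hom_mult: "X \<otimes>\<^bsub>grid_homology g V T\<^esub> Y = X <#>\<^bsub>cfk g V\<^esub> Y" for T X Y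
    unfolding grid_homology_def FactGroup_def set_mult_def by simp
  have img: "(\<lambda>\<xi>. \<Phi> ` \<xi>) ` carrier (grid_homology g V S) = carrier (grid_homology g V S')"
    unfolding hom_carrier image_image Z_def[symmetric] Z'_def[symmetric] B_def[symmetric] B'_def[symmetric] coset Z[symmetric] ..
  have iso: "(\<lambda>\<xi>. \<Phi> ` \<xi>) \<in> iso (grid_homology g V S) (grid_homology g V S')"
    unfolding iso_def hom_def bij_betw_def mem_Collect_eq
  proof (intro conjI)
    show "(\<lambda>\<xi>. \<Phi> ` \<xi>) \<in> carrier (grid_homology g V S) \<rightarrow> carrier (grid_homology g V S')" using img by blast
    show "\<forall>x\<in>carrier (grid_homology g V S). \<forall>y\<in>carrier (grid_homology g V S).
        \<Phi> ` (x \<otimes>\<^bsub>grid_homology g V S\<^esub> y) = \<Phi> ` x \<otimes>\<^bsub>grid_homology g V S'\<^esub> \<Phi> ` y"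
      unfolding hom_mult using setmult by blast
    show "inj_on (\<lambda>\<xi>. \<Phi> ` \<xi>) (carrier (grid_homology g V S))"
      using inj by (simp add: inj_on_def inj_image_eq_iff)
  qed (rule img)
  have hs: "\<Phi> ` hscale g V S a \<xi> = hscale g V S' a (\<Phi> ` \<xi>)" for a \<xi>
  proof -
    have "\<Phi> ` (\<lambda>c x. a * c x) ` \<xi> = (\<lambda>c x. a * c x) ` \<Phi> ` \<xi>" unfolding image_image scale ..
    then show ?thesis unfolding hscale_def setmult B_def[symmetric] B'_def[symmetric] B by simp
  qed
  have hp: "(\<lambda>\<xi>. \<Phi> ` \<xi>) ` hpart g V S x a b = hpart g V S' x (a + 0) (b + 0)" for x a b
  proof -
    have hg: "homogeneous g x a b (\<Phi> c) \<longleftrightarrow> homogeneous g x a b c" for c unfolding homogeneous_def keys ..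
    have eq: "hpart g V T x a b = (\<lambda>c. cfk_boundaries g V T #>\<^bsub>cfk g V\<^esub> c) ` {c \<in> cfk_cycles g V T. homogeneous g x a b c}" for T a b
      unfolding hpart_def by blast
    have "\<Phi> ` {c \<in> Z. homogeneous g x a b c} = {c \<in> Z'. homogeneous g x a b c}"
      by (rule image_eq) (use Z hg inv in \<open>auto simp: image_iff\<close>)
    then show ?thesis unfolding eq image_image Z_def[symmetric] Z'_def[symmetric] B_def[symmetric] B'_def[symmetric] coset
      by (simp add: image_image[of "\<lambda>c. B' #>\<^bsub>cfk g V\<^esub> c" \<Phi>, symmetric])
  qed
  show ?thesis unfolding isomorphic_homology_def
  proof (intro bexI[OF _ iso] conjI ballI)
    fix x
    show "\<exists>dM dA. \<forall>a b. (\<lambda>\<xi>. \<Phi> ` \<xi>) ` hpart g V S x a b = hpart g V S' x (a + dM) (b + dA)"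
      using hp by (intro exI[of _ 0]) blast
  qed (rule hs)
qed

lemma sign_assignmentD:
  assumes "sign_assignment e g S" "x \<in> gens g" "y \<in> gens g"
  shows "r \<in> Rect g x y \<Longrightarrow> S x y r \<in> {1, -1}"
    and "y' \<in> gens g \<Longrightarrow> z \<in> gens g \<Longrightarrow> r1 \<in> Rect g x y \<Longrightarrow> r2 \<in> Rect g y z \<Longrightarrow> r1' \<in> Rect g x y' \<Longrightarrow>
      r2' \<in> Rect g y' z \<Longrightarrow> y \<noteq> y' \<Longrightarrow> domain2 g r1 r2 = domain2 g r1' r2' \<Longrightarrow>
      S x y r1 * S y z r2 = - (S x y' r1' * S y' z r2')"
    and "r1 \<in> Rect g x y \<Longrightarrow> r2 \<in> Rect g y x \<Longrightarrow> horizontal_annulus g r1 r2 \<Longrightarrow> S x y r1 * S y x r2 = e"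
    and "r1 \<in> Rect g x y \<Longrightarrow> r2 \<in> Rect g y x \<Longrightarrow> vertical_annulus g r1 r2 \<Longrightarrow> S x y r1 * S y x r2 = - e"
proof -
  note A = assms(1)[unfolded sign_assignment_def]
  note A1 = A[THEN conjunct1] and A2 = A[THEN conjunct2, THEN conjunct1]
    and A3 = A[THEN conjunct2, THEN conjunct2, THEN conjunct1] and A4 = A[THEN conjunct2, THEN conjunct2, THEN conjunct2]
  show "r \<in> Rect g x y \<Longrightarrow> S x y r \<in> {1, -1}"
    using A1[THEN bspec, OF assms(2), THEN bspec, OF assms(3)] by blast
  show "y' \<in> gens g \<Longrightarrow> z \<in> gens g \<Longrightarrow> r1 \<in> Rect g x y \<Longrightarrow> r2 \<in> Rect g y z \<Longrightarrow> r1' \<in> Rect g x y' \<Longrightarrow>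
      r2' \<in> Rect g y' z \<Longrightarrow> y \<noteq> y' \<Longrightarrow> domain2 g r1 r2 = domain2 g r1' r2' \<Longrightarrow>
      S x y r1 * S y z r2 = - (S x y' r1' * S y' z r2')"
    using A2[THEN bspec, OF assms(2), THEN bspec, OF assms(3)] by blast
  show "r1 \<in> Rect g x y \<Longrightarrow> r2 \<in> Rect g y x \<Longrightarrow> horizontal_annulus g r1 r2 \<Longrightarrow> S x y r1 * S y x r2 = e"
    using A3[THEN bspec, OF assms(2), THEN bspec, OF assms(3)] by blast
  show "r1 \<in> Rect g x y \<Longrightarrow> r2 \<in> Rect g y x \<Longrightarrow> vertical_annulus g r1 r2 \<Longrightarrow> S x y r1 * S y x r2 = - e"
    using A4[THEN bspec, OF assms(2), THEN bspec, OF assms(3)] by blast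
qed

lemma sign_quotient_true_false:
  assumes "grid_diagram g" "true_sign_assignment g S" "false_sign_assignment g S'"
  shows "sign_quotient g (\<lambda>x y r. S x y r * S' x y r)"
proof -
  have sq: "a * b * (a' * b') = c * d * (c' * d')" if "a * a' = - (c * c')" "b * b' = - (d * d')" for a b c d a' b' c' d' :: int
  proof -
    have "a * b * (a' * b') = (a * a') * (b * b')" "c * d * (c' * d') = (c * c') * (d * d')" by (simp_all add: mult_ac)
    then show ?thesis using that by simp
  qed
  have an: "a * b * (a' * b') = -1" if "a * a' = e" "b * b' = - e" "e \<in> {1, -1}" for a b a' b' e :: int
  proof -
    have "a * b * (a' * b') = (a * a') * (b * b')" by (simp add: mult_ac)
    then show ?thesis using that by auto
  qed
  note T = sign_assignmentD[OF assms(2)[unfolded true_sign_assignment_def]]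
  note F = sign_assignmentD[OF assms(3)[unfolded false_sign_assignment_def]]
  show ?thesis
  proof (unfold_locales, rule assms(1))
    show "S x y r * S' x y r \<in> {1, -1}" if "x \<in> gens g" "y \<in> gens g" "r \<in> Rect g x y" for x y r
    proof -
      have "S x y r \<in> {1, -1}" "S' x y r \<in> {1, -1}" using T(1) F(1) that by blast+
      then show ?thesis by auto
    qed
    show "S x y r1 * S' x y r1 * (S y z r2 * S' y z r2) = S x y' r1' * S' x y' r1' * (S y' z r2' * S' y' z r2')"
      if "x \<in> gens g" "y \<in> gens g" "y' \<in> gens g" "z \<in> gens g" "r1 \<in> Rect g x y" "r2 \<in> Rect g y z"
        "r1' \<in> Rect g x y'" "r2' \<in> Rect g y' z" "y \<noteq> y'" "domain2 g r1 r2 = domain2 g r1' r2'" for x y y' z r1 r2 r1' r2'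
      by (rule sq) (rule T(2) F(2); use that in blast)+
    show "S x y r1 * S' x y r1 * (S y x r2 * S' y x r2) = -1"
      if "x \<in> gens g" "y \<in> gens g" "r1 \<in> Rect g x y" "r2 \<in> Rect g y x" "horizontal_annulus g r1 r2" for x y r1 r2
    proof (rule an)
      show "S x y r1 * S y x r2 = 1" using T(3) that by blast
      show "S' x y r1 * S' y x r2 = - 1" using F(3) that by blast
    qed simp
    show "S x y r1 * S' x y r1 * (S y x r2 * S' y x r2) = -1"
      if "x \<in> gens g" "y \<in> gens g" "r1 \<in> Rect g x y" "r2 \<in> Rect g y x" "vertical_annulus g r1 r2" for x y r1 r2
    proof (rule an)
      show "S x y r1 * S y x r2 = - 1" using T(4) that by blast
      have "S' x y r1 * S' y x r2 = - (- 1)" using F(4) that by blast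
      then show "S' x y r1 * S' y x r2 = - (- 1)" .
    qed simp
  qed
qed

theorem theorem1p6:
  fixes g :: grid and S S' :: signs and n k m :: nat
  assumes "grid_diagram g"
    and "n = nXX g" and "k = nX g" and "m = num_circles g"
    and "true_sign_assignment g S"
    and "false_sign_assignment g S'"
  shows "isomorphic_homology g {..<2 * n + k} {..<2 * n + m} S S' \<and>
         isomorphic_homology g {2 * n + m..<2 * n + k} {} S S' \<and>
         isomorphic_homology g {} {} S S'"
proof -
  interpret sign_quotient g "\<lambda>x y r. S x y r * S' x y r"
    by (rule sign_quotient_true_false[OF assms(1,5,6)])
  obtain f :: "gen \<Rightarrow> int" where f: "\<And>x. f x \<in> {1, -1}"
    and Q: "\<And>x y r. x \<in> gens g \<Longrightarrow> y \<in> gens g \<Longrightarrow> r \<in> empty_Rect g x y \<Longrightarrow>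
      card ((mX g \<union> mXX g) \<inter> r) = 0 \<Longrightarrow> S x y r * S' x y r = f x * f y"
    using gauge_on_counted_rectangles by blast
  have "S' x y r = f x * f y * S x y r"
    if "x \<in> gens g" "y \<in> gens g" "r \<in> empty_Rect g x y" "card ((mX g \<union> mXX g) \<inter> r) = 0" for x y r
  proof -
    have "r \<in> Rect g x y" using that(3) unfolding empty_Rect_def Rect_def by blast
    then have "S x y r \<in> {1, -1}" using sign_assignmentD(1)[OF _ that(1,2)] assms(5) unfolding true_sign_assignment_def by blast
    then show ?thesis using Q[OF that] by auto
  qed
  then have "isomorphic_homology g V R S S'" for V R
    using f by (intro gauge_isomorphic_homology[where f = f]) blast+
  then show ?thesis by blast
qed

end
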